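(* Let $\alpha\in(0,1/2)$ be irrational, let $R$ be the rotation by the angle $2\pi\alpha$ on the unit circle $\mathbb T$, let $\mu$ be a probability measure on $\mathbb T$, and suppose that $\mu\circ R^{2n}$ is absolutely continuous with respect to $\mu$ for all $n\in\mathbb Z$. Then the support of the state $\omega_\mu$ of $\mathbb A_{2\alpha}$ in the bidual is central: $s(\omega_\mu)\in Z(\mathbb A_{2\alpha}^{**})$.
   Context: $\mathbb A_{2\alpha}$ is the universal unital $C^*$-algebra generated by unitaries $U,V$ with $UV=e^{4\pi\imath\alpha}VU$. For $(k,n)\in\mathbb Z^2$, $W(k,n):=e^{-2\pi\imath\alpha kn}U^kV^n$, and for finitely supported $f:\mathbb Z^2\to\mathbb C$, $W(f):=\sum f(k,n)W(k,n)$; such elements form a dense $*$-subalgebra. For a probability measure $\mu$ on $\mathbb T$, $\check\mu(k)=\int_{\mathbb T}z^k\,\mathrm d\mu(z)$, and $\omega_\mu$ is the state on $\mathbb A_{2\alpha}$ determined by $\omega_\mu(W(f))=\sum_{k\in\mathbb Z}\check\mu(k)f(k,0)$. $R(z)=e^{2\pi\imath\alpha}z$ and $(\mu\circ R^{j})(E)=\mu(R^jE)$. $Z(\cdot)$ denotes the centre. *)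

theory Defs
  imports "HOL-Probability.Probability" "HOL-Algebra.Subrings"
begin

section \<open>Unital C*-algebras\<close>

record 'a cstar = "'a ring" +
  scale :: "complex \<Rightarrow> 'a \<Rightarrow> 'a"
  star :: "'a \<Rightarrow> 'a"
  cnorm :: "'a \<Rightarrow> real"

locale cstar_algebra = ring A for A :: "('a, 'm) cstar_scheme" (structure) +
  assumes scale_closed: "x \<in> carrier A \<Longrightarrow> scale A c x \<in> carrier A"
    and scale_add_left: "x \<in> carrier A \<Longrightarrow> scale A (c + d) x = scale A c x \<oplus> scale A d x"
    and scale_add_right:
      "\<lbrakk>x \<in> carrier A; y \<in> carrier A\<rbrakk> \<Longrightarrow> scale A c (x \<oplus> y) = scale A c x \<oplus> scale A c y"
    and scale_scale: "x \<in> carrier A \<Longrightarrow> scale A c (scale A d x) = scale A (c * d) x"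
    and scale_one: "x \<in> carrier A \<Longrightarrow> scale A 1 x = x"
    and scale_mult_left:
      "\<lbrakk>x \<in> carrier A; y \<in> carrier A\<rbrakk> \<Longrightarrow> scale A c x \<otimes> y = scale A c (x \<otimes> y)"
    and scale_mult_right:
      "\<lbrakk>x \<in> carrier A; y \<in> carrier A\<rbrakk> \<Longrightarrow> x \<otimes> scale A c y = scale A c (x \<otimes> y)"
    and star_closed: "x \<in> carrier A \<Longrightarrow> star A x \<in> carrier A"
    and star_star: "x \<in> carrier A \<Longrightarrow> star A (star A x) = x"
    and star_add:
      "\<lbrakk>x \<in> carrier A; y \<in> carrier A\<rbrakk> \<Longrightarrow> star A (x \<oplus> y) = star A x \<oplus> star A y"
    and star_scale: "x \<in> carrier A \<Longrightarrow> star A (scale A c x) = scale A (cnj c) (star A x)"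
    and star_mult:
      "\<lbrakk>x \<in> carrier A; y \<in> carrier A\<rbrakk> \<Longrightarrow> star A (x \<otimes> y) = star A y \<otimes> star A x"
    and cnorm_nonneg: "x \<in> carrier A \<Longrightarrow> 0 \<le> cnorm A x"
    and cnorm_eq_zero: "x \<in> carrier A \<Longrightarrow> cnorm A x = 0 \<longleftrightarrow> x = \<zero>"
    and cnorm_triangle:
      "\<lbrakk>x \<in> carrier A; y \<in> carrier A\<rbrakk> \<Longrightarrow> cnorm A (x \<oplus> y) \<le> cnorm A x + cnorm A y"
    and cnorm_scale: "x \<in> carrier A \<Longrightarrow> cnorm A (scale A c x) = cmod c * cnorm A x"
    and cnorm_mult:
      "\<lbrakk>x \<in> carrier A; y \<in> carrier A\<rbrakk> \<Longrightarrow> cnorm A (x \<otimes> y) \<le> cnorm A x * cnorm A y"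
    and cnorm_star_mult: "x \<in> carrier A \<Longrightarrow> cnorm A (star A x \<otimes> x) = (cnorm A x)\<^sup>2"
    and cnorm_complete:
      "\<lbrakk>\<And>n::nat. s n \<in> carrier A;
        \<And>e. 0 < e \<Longrightarrow> \<exists>N. \<forall>m\<ge>N. \<forall>n\<ge>N. cnorm A (s m \<ominus> s n) < e\<rbrakk>
       \<Longrightarrow> \<exists>l\<in>carrier A. (\<lambda>n. cnorm A (s n \<ominus> l)) \<longlonglongrightarrow> 0"

definition unitary :: "('a, 'm) cstar_scheme \<Rightarrow> 'a \<Rightarrow> bool" where
  "unitary A u \<longleftrightarrow> u \<in> carrier A \<and>
     star A u \<otimes>\<^bsub>A\<^esub> u = \<one>\<^bsub>A\<^esub> \<and> u \<otimes>\<^bsub>A\<^esub> star A u = \<one>\<^bsub>A\<^esub>"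

definition projection :: "('a, 'm) cstar_scheme \<Rightarrow> 'a \<Rightarrow> bool" where
  "projection A p \<longleftrightarrow> p \<in> carrier A \<and> p \<otimes>\<^bsub>A\<^esub> p = p \<and> star A p = p"

definition centre :: "('a, 'm) cstar_scheme \<Rightarrow> 'a set" where
  "centre A = {z \<in> carrier A. \<forall>x\<in>carrier A. z \<otimes>\<^bsub>A\<^esub> x = x \<otimes>\<^bsub>A\<^esub> z}"

definition cstar_subalgebra :: "'a set \<Rightarrow> ('a, 'm) cstar_scheme \<Rightarrow> bool" where
  "cstar_subalgebra S A \<longleftrightarrow> subring S A \<and>
     (\<forall>c. \<forall>x\<in>S. scale A c x \<in> S) \<and> (\<forall>x\<in>S. star A x \<in> S) \<and>
     (\<forall>s l. (\<forall>n::nat. s n \<in> S) \<and> l \<in> carrier A \<and> (\<lambda>n. cnorm A (s n \<ominus>\<^bsub>A\<^esub> l)) \<longlonglongrightarrow> 0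
        \<longrightarrow> l \<in> S)"

definition cstar_hom :: "('a, 'm) cstar_scheme \<Rightarrow> ('b, 'n) cstar_scheme \<Rightarrow> ('a \<Rightarrow> 'b) set" where
  "cstar_hom A B = {h \<in> ring_hom A B \<inter> extensional (carrier A).
     \<forall>x\<in>carrier A. (\<forall>c. h (scale A c x) = scale B c (h x)) \<and> h (star A x) = star B (h x)}"


section \<open>The universal rotation algebra\<close>

definition rotation_pair :: "real \<Rightarrow> ('a, 'm) cstar_scheme \<Rightarrow> 'a \<Rightarrow> 'a \<Rightarrow> bool" where
  "rotation_pair \<theta> A U V \<longleftrightarrow> unitary A U \<and> unitary A V \<and>
     U \<otimes>\<^bsub>A\<^esub> V = scale A (exp (2 * of_real pi * \<i> * of_real \<theta>)) (V \<otimes>\<^bsub>A\<^esub> U)"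

text \<open>
  The universal property is tested against all unital C*-algebras \<open>B\<close> whose elements are taken
  from the type \<open>nat \<Rightarrow> complex\<close>. This loses nothing: only the C*-subalgebra generated by the
  two given unitaries matters; it is separable, hence of cardinality at most that of the continuum,
  and so it is isomorphic to one carried by a subset of this type.
\<close>

locale universal_rotation_algebra = cstar_algebra A for A :: "('a, 'm) cstar_scheme" (structure) +
  fixes \<theta> :: real and U V :: 'a
  assumes generators: "rotation_pair \<theta> A U V"
    and generated: "\<lbrakk>cstar_subalgebra S A; U \<in> S; V \<in> S\<rbrakk> \<Longrightarrow> S = carrier A"
    and universal:
      "\<And>(B :: (nat \<Rightarrow> complex) cstar) u v. \<lbrakk>cstar_algebra B; rotation_pair \<theta> B u v\<rbrakk>
         \<Longrightarrow> \<exists>!h. h \<in> cstar_hom A B \<and> h U = u \<and> h V = v"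

text \<open>
  The integer power is the one of \<open>HOL-Algebra\<close>; on a unitary its negative powers are
  the powers of the multiplicative inverse, that is, of the adjoint.
\<close>

definition W :: "real \<Rightarrow> ('a, 'm) cstar_scheme \<Rightarrow> 'a \<Rightarrow> 'a \<Rightarrow> int \<times> int \<Rightarrow> 'a" where
  "W \<alpha> A U V = (\<lambda>(k, n). scale A (exp (- 2 * of_real pi * \<i> * of_real \<alpha> * of_int k * of_int n))
                            (U [^]\<^bsub>A\<^esub> k \<otimes>\<^bsub>A\<^esub> V [^]\<^bsub>A\<^esub> n))"

definition Wsum ::
  "real \<Rightarrow> ('a, 'm) cstar_scheme \<Rightarrow> 'a \<Rightarrow> 'a \<Rightarrow> (int \<times> int \<Rightarrow> complex) \<Rightarrow> 'a" where
  "Wsum \<alpha> A U V f = (\<Oplus>\<^bsub>A\<^esub>x\<in>{x. f x \<noteq> 0}. scale A (f x) (W \<alpha> A U V x))"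


section \<open>Dual and bidual\<close>

text \<open>
  Bounded linear functionals on a complex normed space with carrier \<open>X\<close>. They are normalised to
  be \<open>undefined\<close> outside \<open>X\<close>, so that equality of functionals is equality on \<open>X\<close>.
\<close>

definition bounded_functionals ::
  "'v set \<Rightarrow> ('v \<Rightarrow> 'v \<Rightarrow> 'v) \<Rightarrow> (complex \<Rightarrow> 'v \<Rightarrow> 'v) \<Rightarrow> ('v \<Rightarrow> real) \<Rightarrow> ('v \<Rightarrow> complex) set" where
  "bounded_functionals X vadd scal nrm = {\<phi> \<in> extensional X.
     (\<forall>x\<in>X. \<forall>y\<in>X. \<phi> (vadd x y) = \<phi> x + \<phi> y) \<and>
     (\<forall>c. \<forall>x\<in>X. \<phi> (scal c x) = c * \<phi> x) \<and>
     (\<exists>C. \<forall>x\<in>X. cmod (\<phi> x) \<le> C * nrm x)}"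

definition functional_norm :: "'v set \<Rightarrow> ('v \<Rightarrow> real) \<Rightarrow> ('v \<Rightarrow> complex) \<Rightarrow> real" where
  "functional_norm X nrm \<phi> = (SUP x\<in>{x \<in> X. nrm x \<le> 1}. cmod (\<phi> x))"

definition functional_add ::
  "'v set \<Rightarrow> ('v \<Rightarrow> complex) \<Rightarrow> ('v \<Rightarrow> complex) \<Rightarrow> ('v \<Rightarrow> complex)" where
  "functional_add X \<phi> \<psi> = (\<lambda>x\<in>X. \<phi> x + \<psi> x)"

definition functional_scale ::
  "'v set \<Rightarrow> complex \<Rightarrow> ('v \<Rightarrow> complex) \<Rightarrow> ('v \<Rightarrow> complex)" where
  "functional_scale X c \<phi> = (\<lambda>x\<in>X. c * \<phi> x)"

definition dual :: "('a, 'm) cstar_scheme \<Rightarrow> ('a \<Rightarrow> complex) set" where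
  "dual A = bounded_functionals (carrier A) (add A) (scale A) (cnorm A)"

definition dual_norm :: "('a, 'm) cstar_scheme \<Rightarrow> ('a \<Rightarrow> complex) \<Rightarrow> real" where
  "dual_norm A = functional_norm (carrier A) (cnorm A)"

text \<open>
  The (first) Arens product on the bidual: with \<open>(\<phi>\<cdot>a)(b) = \<phi>(ab)\<close> and \<open>(\<Psi>\<cdot>\<phi>)(a) = \<Psi>(\<phi>\<cdot>a)\<close>,
  it is \<open>(\<Phi>\<Psi>)(\<phi>) = \<Phi>(\<Psi>\<cdot>\<phi>)\<close>. The involution is
  \<open>\<Phi>\<^sup>\<star>(\<phi>) = cnj (\<Phi>(\<phi>\<^sup>\<star>))\<close>, where \<open>\<phi>\<^sup>\<star>(a) = cnj (\<phi>(a\<^sup>\<star>))\<close>.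
\<close>

definition dual_act ::
  "('a, 'm) cstar_scheme \<Rightarrow> ('a \<Rightarrow> complex) \<Rightarrow> 'a \<Rightarrow> ('a \<Rightarrow> complex)" where
  "dual_act A \<phi> a = (\<lambda>b\<in>carrier A. \<phi> (a \<otimes>\<^bsub>A\<^esub> b))"

definition bidual_act ::
  "('a, 'm) cstar_scheme \<Rightarrow> (('a \<Rightarrow> complex) \<Rightarrow> complex) \<Rightarrow> ('a \<Rightarrow> complex) \<Rightarrow> ('a \<Rightarrow> complex)" where
  "bidual_act A \<Psi> \<phi> = (\<lambda>a\<in>carrier A. \<Psi> (dual_act A \<phi> a))"

definition dual_star :: "('a, 'm) cstar_scheme \<Rightarrow> ('a \<Rightarrow> complex) \<Rightarrow> ('a \<Rightarrow> complex)" where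
  "dual_star A \<phi> = (\<lambda>a\<in>carrier A. cnj (\<phi> (star A a)))"

definition bidual :: "('a, 'm) cstar_scheme \<Rightarrow> (('a \<Rightarrow> complex) \<Rightarrow> complex) cstar" where
  "bidual A =
     \<lparr> carrier = bounded_functionals (dual A)
         (functional_add (carrier A)) (functional_scale (carrier A)) (dual_norm A),
       mult = (\<lambda>\<Phi> \<Psi>. \<lambda>\<phi>\<in>dual A. \<Phi> (bidual_act A \<Psi> \<phi>)),
       one = (\<lambda>\<phi>\<in>dual A. \<phi> \<one>\<^bsub>A\<^esub>),
       zero = (\<lambda>\<phi>\<in>dual A. 0),
       add = functional_add (dual A),
       scale = functional_scale (dual A),
       star = (\<lambda>\<Phi>. \<lambda>\<phi>\<in>dual A. cnj (\<Phi> (dual_star A \<phi>))),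
       cnorm = functional_norm (dual A) (dual_norm A) \<rparr>"

definition state :: "('a, 'm) cstar_scheme \<Rightarrow> ('a \<Rightarrow> complex) \<Rightarrow> bool" where
  "state A \<omega> \<longleftrightarrow> \<omega> \<in> dual A \<and>
     (\<forall>x\<in>carrier A. \<omega> (star A x \<otimes>\<^bsub>A\<^esub> x) \<in> \<real>\<^sub>\<ge>\<^sub>0) \<and> \<omega> \<one>\<^bsub>A\<^esub> = 1"

text \<open>
  The support of a state is the smallest projection of the bidual on which (the canonical
  extension \<open>\<Phi> \<mapsto> \<Phi> \<omega>\<close> of) the state takes the value 1. Projections are ordered by
  \<open>p \<le> q \<longleftrightarrow> p q = p\<close>.
\<close>

definition support :: "('a, 'm) cstar_scheme \<Rightarrow> ('a \<Rightarrow> complex) \<Rightarrow> (('a \<Rightarrow> complex) \<Rightarrow> complex)" where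
  "support A \<omega> = (THE p. projection (bidual A) p \<and> p \<omega> = 1 \<and>
     (\<forall>q. projection (bidual A) q \<and> q \<omega> = 1 \<longrightarrow> p \<otimes>\<^bsub>bidual A\<^esub> q = p))"


section \<open>Measures on the circle\<close>

definition circle_borel :: "complex measure" where
  "circle_borel = restrict_space borel (sphere 0 1)"

definition fourier_coeff :: "complex measure \<Rightarrow> int \<Rightarrow> complex" where
  "fourier_coeff \<mu> k = (LINT z|\<mu>. z powi k)"

text \<open>The \<open>j\<close>-th power of the rotation by the angle \<open>2 \<pi> \<alpha>\<close>, for \<open>j\<close> an integer.\<close>

definition rot :: "real \<Rightarrow> int \<Rightarrow> complex \<Rightarrow> complex" where
  "rot \<alpha> j z = exp (2 * of_real pi * \<i> * of_real \<alpha> * of_int j) * z"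

text \<open>
  The measure \<open>E \<mapsto> \<mu> (R\<^sup>j E)\<close>, as the push-forward of \<open>\<mu>\<close> under \<open>R\<^sup>-\<^sup>j\<close>: the
  preimage of \<open>E\<close> under \<open>R\<^sup>-\<^sup>j\<close> is \<open>R\<^sup>j E\<close>.
\<close>

definition rotated_measure :: "real \<Rightarrow> complex measure \<Rightarrow> int \<Rightarrow> complex measure" where
  "rotated_measure \<alpha> \<mu> j = distr \<mu> circle_borel (rot \<alpha> (- j))"

text \<open>The state \<open>\<omega>\<^sub>\<mu>\<close> is characterised by its values on the dense subalgebra of all \<open>W(f)\<close>.\<close>

definition is_state_of_measure ::
  "real \<Rightarrow> ('a, 'm) cstar_scheme \<Rightarrow> 'a \<Rightarrow> 'a \<Rightarrow> complex measure \<Rightarrow> ('a \<Rightarrow> complex) \<Rightarrow> bool" where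
  "is_state_of_measure \<alpha> A U V \<mu> \<omega> \<longleftrightarrow> state A \<omega> \<and>
     (\<forall>f :: int \<times> int \<Rightarrow> complex. finite {x. f x \<noteq> 0} \<longrightarrow>
        \<omega> (Wsum \<alpha> A U V f) = (\<Sum>k\<in>{k. f (k, 0) \<noteq> 0}. fourier_coeff \<mu> k * f (k, 0)))"

end

theory Submission
  imports Defs
begin

text \<open>
  The functionals in the norm closure \<open>N\<close> of \<open>\<omega> A\<close> form an \<open>A\<close>-bimodule: \<open>\<omega>\<close> commutes with
  \<open>U\<close>, and quasi-invariance lets one write \<open>\<omega> \<circ> Ad V\<^sup>\<plusminus>\<^sup>1\<close> as a norm limit of functionals
  \<open>\<omega>(h \<cdot>)\<close> with \<open>h\<close> in the algebra generated by \<open>U\<close>, approximating the square root of a Radon--Nikodym derivative by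
  trigonometric polynomials. A closed bimodule \<open>N\<close> is complemented in the dual by the functionals
  that are singular to it (a Lebesgue decomposition), and \<open>\<phi> \<mapsto> \<phi>\<^sub>N(1)\<close> is a central projection of the
  bidual; it is the support of \<open>\<omega>\<close>, because a projection on which \<open>\<omega>\<close> takes the value \<open>1\<close> acts as
  the unit on \<open>\<omega> A\<close>.

  The representation theory needed for this, including Arens regularity, rests on the fact that every
  bounded functional is dominated by a positive one. By a Hahn--Banach (Pietsch) argument
  this follows from
  \<open>\<parallel>\<Sum> c\<^sub>i x\<^sub>i\<parallel>\<^sup>2 \<le> \<Sum> \<bar>c\<^sub>i\<bar>\<^sup>2 \<parallel>\<Sum> x\<^sub>i\<^sup>\<star> x\<^sub>i\<parallel>\<close>. That inequality holds in every C*-algebra;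
  here it is read off from the trace of the rotation algebra, an average of \<open>\<omega> \<circ> Ad V\<^sup>n\<close>, whose
  representation is isometric.
\<close>

text \<open>No Hilbert space is ever built. A vector of the GNS space of \<psi> is represented by a
  sequence in the algebra that is Cauchy for the seminorm \<open>sn \<psi>\<close>, or by the
  functional that it induces; orthogonal projections become near-minimisers, and identities between
  operators become estimates with explicit rates. Centrality is then soft: the action of p on the
  dual has range N and p is the unit on N, so \<open>p x p = x p\<close> for every x because N is
  invariant, and adjoints give \<open>p x p = p x\<close>. Taking this adjoint is the obstacle,
  since the involution reverses the Arens product only if the product is regular; that is what the
  domination of functionals by positive ones is for. Irrationality enters through the trace: the
  averages over conjugations by powers of V kill monomials of nonzero degree k in U because
  \<open>q^k\<close> differs from 1. Quasi-invariance enters where N is shown to be invariant from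
  the left.\<close>

section \<open>Positive functionals\<close>

context cstar_algebra
begin

declare scale_closed [simp, intro] star_closed [simp, intro]
declare scale_one [simp] star_star [simp]

lemma scale_zero_left [simp]:
  assumes "x \<in> carrier A"
  shows "scale A 0 x = \<zero>"
proof -
  have "scale A 0 x \<oplus> scale A 0 x = scale A 0 x"
    using scale_add_left[of x 0 0] assms by simp
  then show ?thesis
    using assms by (metis add.l_cancel_one scale_closed)
qed

lemma scale_minus_one:
  assumes "x \<in> carrier A"
  shows "scale A (- 1) x = \<ominus> x"
proof -
  have "x \<oplus> scale A (- 1) x = \<zero>"
    using scale_add_left[of x 1 "- 1"] assms by simp
  then show ?thesis
    using assms by (metis a_comm minus_equality scale_closed)
qed

lemma minus_eq_scale:
  assumes "x \<in> carrier A" "y \<in> carrier A"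
  shows "x \<ominus> y = x \<oplus> scale A (- 1) y"
  using assms by (simp add: scale_minus_one a_minus_def)

lemma scale_zero_right [simp]: "scale A c \<zero> = \<zero>"
  using scale_scale[of \<zero> c 0] by simp

lemma star_zero [simp]: "star A \<zero> = \<zero>"
  using star_scale[of \<zero> 0] by simp

lemma star_one [simp]: "star A \<one> = \<one>"
  using star_mult[of "star A \<one>" \<one>] by simp

lemma star_diff:
  assumes "x \<in> carrier A" "y \<in> carrier A"
  shows "star A (x \<ominus> y) = star A x \<ominus> star A y"
  using assms by (simp add: minus_eq_scale star_add star_scale)

lemma cnorm_zero [simp]: "cnorm A \<zero> = 0"
  using cnorm_eq_zero by simp

lemma cnorm_star:
  assumes "x \<in> carrier A"
  shows "cnorm A (star A x) = cnorm A x"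
proof -
  have *: "cnorm A y \<le> cnorm A (star A y)" if "y \<in> carrier A" for y
  proof (cases "cnorm A y = 0")
    case False
    have "(cnorm A y)\<^sup>2 \<le> cnorm A (star A y) * cnorm A y"
      using cnorm_star_mult[of y] cnorm_mult[of "star A y" y] that by simp
    then show ?thesis
      using False cnorm_nonneg[OF that] by (simp add: power2_eq_square)
  qed (use that cnorm_nonneg in simp)
  show ?thesis using *[of x] *[of "star A x"] assms by simp
qed

text \<open>The C*-identity makes the norm of the unit a solution of t = t^2, hence 0 or 1; the
  value 0 occurs in the zero algebra, which the axioms allow.\<close>

lemma cnorm_one_le: "cnorm A \<one> \<le> 1"
  using cnorm_star_mult[of \<one>] by (auto simp: power2_eq_square)

lemma cnorm_diff_le:
  assumes "x \<in> carrier A" "y \<in> carrier A"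
  shows "cnorm A (x \<ominus> y) \<le> cnorm A x + cnorm A y"
  using cnorm_triangle[of x "scale A (- 1) y"] assms
  by (simp add: minus_eq_scale cnorm_scale)

lemma cnorm_diff_commute:
  assumes "x \<in> carrier A" "y \<in> carrier A"
  shows "cnorm A (x \<ominus> y) = cnorm A (y \<ominus> x)"
proof -
  have "x \<ominus> y = scale A (- 1) (y \<ominus> x)"
    using assms by (simp add: minus_eq_scale scale_add_right scale_scale a_comm)
  then show ?thesis using assms by (simp add: cnorm_scale)
qed

lemma diff_add_cancel:
  assumes "x \<in> carrier A" "y \<in> carrier A"
  shows "(x \<ominus> y) \<oplus> y = x"
  using assms by (simp add: a_minus_def a_assoc l_neg)

section \<open>Bounded functionals and their norm\<close>

lemma dual_add: "\<lbrakk>\<phi> \<in> dual A; x \<in> carrier A; y \<in> carrier A\<rbrakk> \<Longrightarrow> \<phi> (x \<oplus> y) = \<phi> x + \<phi> y"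
  and dual_scale: "\<lbrakk>\<phi> \<in> dual A; x \<in> carrier A\<rbrakk> \<Longrightarrow> \<phi> (scale A c x) = c * \<phi> x"
  and dual_extensional: "\<phi> \<in> dual A \<Longrightarrow> \<phi> \<in> extensional (carrier A)"
  by (auto simp: dual_def bounded_functionals_def)

lemma dual_zero [simp]: "\<phi> \<in> dual A \<Longrightarrow> \<phi> \<zero> = 0"
  using dual_scale[of \<phi> \<zero> 0] by simp

lemma dual_diff:
  "\<lbrakk>\<phi> \<in> dual A; x \<in> carrier A; y \<in> carrier A\<rbrakk> \<Longrightarrow> \<phi> (x \<ominus> y) = \<phi> x - \<phi> y"
  by (simp add: minus_eq_scale dual_add dual_scale)

lemma dual_eqI:
  "\<lbrakk>\<phi> \<in> dual A; \<psi> \<in> dual A; \<And>x. x \<in> carrier A \<Longrightarrow> \<phi> x = \<psi> x\<rbrakk> \<Longrightarrow> \<phi> = \<psi>"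
  using dual_extensional extensionalityI by blast

lemma dualI:
  assumes "\<phi> \<in> extensional (carrier A)"
    and "\<And>x y. \<lbrakk>x \<in> carrier A; y \<in> carrier A\<rbrakk> \<Longrightarrow> \<phi> (x \<oplus> y) = \<phi> x + \<phi> y"
    and "\<And>c x. x \<in> carrier A \<Longrightarrow> \<phi> (scale A c x) = c * \<phi> x"
    and "\<And>x. x \<in> carrier A \<Longrightarrow> cmod (\<phi> x) \<le> C * cnorm A x"
  shows "\<phi> \<in> dual A"
  using assms unfolding dual_def bounded_functionals_def by blast

text \<open>The supremum in \<open>functional_norm\<close> is meaningful only for a bounded set. The
  constant C from the definition of \<open>dual\<close> carries no sign, hence its absolute
  value.\<close>

lemma dual_bdd_above:
  assumes "\<phi> \<in> dual A"
  shows "bdd_above ((\<lambda>x. cmod (\<phi> x)) ` {x \<in> carrier A. cnorm A x \<le> 1})"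
proof -
  obtain C where C: "\<And>x. x \<in> carrier A \<Longrightarrow> cmod (\<phi> x) \<le> C * cnorm A x"
    using assms unfolding dual_def bounded_functionals_def by blast
  have "cmod (\<phi> x) \<le> \<bar>C\<bar>" if "x \<in> carrier A" "cnorm A x \<le> 1" for x
  proof -
    have "cmod (\<phi> x) \<le> \<bar>C\<bar> * cnorm A x"
      using C[OF that(1)] cnorm_nonneg[OF that(1)] by (meson abs_ge_self mult_right_mono order_trans)
    also have "\<dots> \<le> \<bar>C\<bar>"
      using that by (simp add: mult_left_le)
    finally show ?thesis .
  qed
  then show ?thesis by (auto intro!: bdd_aboveI)
qed

lemma dual_norm_nonneg:
  assumes "\<phi> \<in> dual A"
  shows "0 \<le> dual_norm A \<phi>"
  unfolding dual_norm_def functional_norm_def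
  by (rule order_trans[OF _ cSUP_upper[OF _ dual_bdd_above[OF assms], of \<zero>]]) auto

lemma dual_norm_bound:
  assumes "\<phi> \<in> dual A" "x \<in> carrier A"
  shows "cmod (\<phi> x) \<le> dual_norm A \<phi> * cnorm A x"
proof (cases "cnorm A x = 0")
  case True
  then show ?thesis using assms cnorm_eq_zero by simp
next
  case False
  then have pos: "cnorm A x > 0" using cnorm_nonneg[OF assms(2)] by simp
  let ?y = "scale A (of_real (1 / cnorm A x)) x"
  have "cnorm A ?y \<le> 1" using pos assms by (simp add: cnorm_scale norm_divide)
  then have "cmod (\<phi> ?y) \<le> dual_norm A \<phi>"
    unfolding dual_norm_def functional_norm_def
    using assms by (intro cSUP_upper dual_bdd_above) auto
  then show ?thesis
    using assms pos by (simp add: dual_scale norm_divide divide_simps mult.commute)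
qed

lemma dual_norm_le:
  assumes "\<phi> \<in> dual A" "0 \<le> K" "\<And>x. x \<in> carrier A \<Longrightarrow> cmod (\<phi> x) \<le> K * cnorm A x"
  shows "dual_norm A \<phi> \<le> K"
  unfolding dual_norm_def functional_norm_def
proof (rule cSUP_least)
  show "{x \<in> carrier A. cnorm A x \<le> 1} \<noteq> {}"
    using cnorm_zero by (metis (mono_tags, lifting) empty_iff mem_Collect_eq zero_closed zero_le_one)
next
  fix x assume x: "x \<in> {x \<in> carrier A. cnorm A x \<le> 1}"
  then have "cmod (\<phi> x) \<le> K * cnorm A x" using assms(3) by simp
  also have "\<dots> \<le> K" using x assms(2) by (simp add: mult_left_le)
  finally show "cmod (\<phi> x) \<le> K" .
qed

section \<open>Positive functionals and the GNS form\<close>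

definition posf :: "('a \<Rightarrow> complex) \<Rightarrow> bool" where
  "posf \<psi> \<longleftrightarrow> \<psi> \<in> dual A \<and> (\<forall>x\<in>carrier A. \<psi> (star A x \<otimes> x) \<in> \<real>\<^sub>\<ge>\<^sub>0)"

text \<open>The GNS inner product of \<psi>, conjugate-linear in the first argument and possibly
  degenerate.\<close>

definition ip :: "('a \<Rightarrow> complex) \<Rightarrow> 'a \<Rightarrow> 'a \<Rightarrow> complex" where
  "ip \<psi> x y = \<psi> (star A x \<otimes> y)"

definition sn :: "('a \<Rightarrow> complex) \<Rightarrow> 'a \<Rightarrow> real" where
  "sn \<psi> x = sqrt (Re (ip \<psi> x x))"

lemma posf_dual: "posf \<psi> \<Longrightarrow> \<psi> \<in> dual A"
  by (simp add: posf_def)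

lemma ip_add:
  assumes "\<psi> \<in> dual A" "x \<in> carrier A" "y \<in> carrier A" "z \<in> carrier A"
  shows "ip \<psi> (x \<oplus> y) z = ip \<psi> x z + ip \<psi> y z"
    and "ip \<psi> x (y \<oplus> z) = ip \<psi> x y + ip \<psi> x z"
    and "ip \<psi> (x \<ominus> y) z = ip \<psi> x z - ip \<psi> y z"
    and "ip \<psi> x (y \<ominus> z) = ip \<psi> x y - ip \<psi> x z"
  using assms
  by (simp_all add: ip_def star_add l_distr r_distr dual_add dual_scale star_scale scale_mult_left
      scale_mult_right minus_eq_scale)

lemma ip_scale:
  assumes "\<psi> \<in> dual A" "x \<in> carrier A" "y \<in> carrier A"
  shows "ip \<psi> (scale A c x) y = cnj c * ip \<psi> x y"
    and "ip \<psi> x (scale A c y) = c * ip \<psi> x y"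
  using assms by (simp_all add: ip_def star_scale scale_mult_left scale_mult_right dual_scale)

lemmas ip_linear = ip_add ip_scale

lemma ip_mult:
  assumes "\<psi> \<in> dual A" "x \<in> carrier A" "y \<in> carrier A" "a \<in> carrier A"
  shows "ip \<psi> x (a \<otimes> y) = ip \<psi> (star A a \<otimes> x) y"
    and "ip \<psi> (a \<otimes> x) y = ip \<psi> x (star A a \<otimes> y)"
  using assms by (simp_all add: ip_def star_mult m_assoc)

lemma ip_one [simp]:
  assumes "x \<in> carrier A"
  shows "ip \<psi> \<one> x = \<psi> x" "ip \<psi> x \<one> = \<psi> (star A x)"
  using assms by (simp_all add: ip_def)

lemma ip_self:
  assumes "posf \<psi>" "x \<in> carrier A"
  shows "ip \<psi> x x = of_real ((sn \<psi> x)\<^sup>2)" "0 \<le> sn \<psi> x"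
proof -
  have "ip \<psi> x x \<in> \<real>\<^sub>\<ge>\<^sub>0" using assms by (simp add: posf_def ip_def)
  then have "0 \<le> Re (ip \<psi> x x)" "Im (ip \<psi> x x) = 0"
    by (auto simp: complex_nonneg_Reals_iff)
  then show "ip \<psi> x x = of_real ((sn \<psi> x)\<^sup>2)" "0 \<le> sn \<psi> x"
    by (simp_all add: sn_def complex_eq_iff)
qed

lemma sn_power2: "\<lbrakk>posf \<psi>; x \<in> carrier A\<rbrakk> \<Longrightarrow> (sn \<psi> x)\<^sup>2 = Re (ip \<psi> x x)"
  using ip_self by simp

text \<open>Hermitian symmetry follows from positivity by polarisation: the form is real at x + y
  and at x + iy, which determines the imaginary and the real part of the difference.\<close>

lemma ip_commute:
  assumes "posf \<psi>" "x \<in> carrier A" "y \<in> carrier A"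
  shows "ip \<psi> y x = cnj (ip \<psi> x y)"
proof -
  have d: "\<psi> \<in> dual A" using assms by (simp add: posf_dual)
  have im: "Im (ip \<psi> z z) = 0" if "z \<in> carrier A" for z
    using ip_self(1)[OF assms(1) that] by simp
  show ?thesis
    using im[of "x \<oplus> y"] im[of "x \<oplus> scale A \<i> y"] im[of x] im[of y] assms
    by (simp add: ip_linear[OF d] complex_eq_iff)
qed

lemma posf_star:
  assumes "posf \<psi>" "x \<in> carrier A"
  shows "\<psi> (star A x) = cnj (\<psi> x)"
  using ip_commute[OF assms(1), of \<one> x] assms by simp

lemma sn_scale:
  assumes "posf \<psi>" "x \<in> carrier A"
  shows "sn \<psi> (scale A c x) = cmod c * sn \<psi> x"
proof -
  have "ip \<psi> (scale A c x) (scale A c x) = of_real ((cmod c)\<^sup>2 * (sn \<psi> x)\<^sup>2)"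
    using assms ip_self[OF assms] complex_norm_square[of c]
    by (simp add: ip_linear posf_dual)
  then show ?thesis
    using ip_self(2)[OF assms] unfolding sn_def
    by (metis Re_complex_of_real norm_ge_zero power_mult_distrib real_sqrt_abs abs_of_nonneg
        mult_nonneg_nonneg sn_def)
qed

lemma sn_diff_power2:
  assumes "posf \<psi>" "x \<in> carrier A" "y \<in> carrier A"
  shows "(sn \<psi> (x \<ominus> y))\<^sup>2 = (sn \<psi> x)\<^sup>2 - 2 * Re (ip \<psi> x y) + (sn \<psi> y)\<^sup>2"
  using assms ip_commute[OF assms]
  by (simp add: sn_power2 ip_linear[OF posf_dual[OF assms(1)]])

lemma sn_add_power2:
  assumes "posf \<psi>" "x \<in> carrier A" "y \<in> carrier A"
  shows "(sn \<psi> (x \<oplus> y))\<^sup>2 = (sn \<psi> x)\<^sup>2 + 2 * Re (ip \<psi> x y) + (sn \<psi> y)\<^sup>2"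
  using assms ip_commute[OF assms]
  by (simp add: sn_power2 ip_linear[OF posf_dual[OF assms(1)]])

text \<open>The Cauchy-Schwarz argument with a, b, m standing for |x|^2, |y|^2 and the squared
  modulus of the inner product. The minimum is at s = 1/b; the form may be degenerate, so b = 0 has
  to force m = 0.\<close>

lemma quadratic_nonneg_imp:
  fixes a b m :: real
  assumes "\<And>s. 0 \<le> a - 2 * s * m + s\<^sup>2 * m * b" "0 \<le> a" "0 \<le> b" "0 \<le> m"
  shows "m \<le> a * b"
proof (cases "b = 0")
  case True
  have "m = 0"
  proof (rule ccontr)
    assume "m \<noteq> 0"
    then show False
      \<comment> \<open>With b = 0 this s gives the quadratic the value -1.\<close>
      using assms(1)[of "(a + 1) / (2 * m)"] True by simp
  qed
  then show ?thesis using assms by simp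
next
  case False
  then have "0 \<le> a - m / b"
    using assms(1)[of "1 / b"] by (simp add: power2_eq_square)
  then show ?thesis using False assms by (simp add: field_simps)
qed

lemma ip_le:
  assumes "posf \<psi>" "x \<in> carrier A" "y \<in> carrier A"
  shows "cmod (ip \<psi> x y) \<le> sn \<psi> x * sn \<psi> y"
proof -
  let ?u = "ip \<psi> x y"
  have "(cmod ?u)\<^sup>2 \<le> (sn \<psi> x)\<^sup>2 * (sn \<psi> y)\<^sup>2"
  proof (rule quadratic_nonneg_imp)
    fix s :: real
    \<comment> \<open>The factor \<open>cnj ?u\<close> cancels the phase of the cross term, whose
      real part becomes s times the squared modulus of \<open>?u\<close>.\<close>
    have "0 \<le> (sn \<psi> (x \<ominus> scale A (of_real s * cnj ?u) y))\<^sup>2" by simp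
    also have "\<dots> = (sn \<psi> x)\<^sup>2 - 2 * s * (cmod ?u)\<^sup>2 + s\<^sup>2 * (cmod ?u)\<^sup>2 * (sn \<psi> y)\<^sup>2"
    proof -
      have "Re (of_real s * cnj ?u * ?u) = s * (cmod ?u)\<^sup>2"
        by (simp add: mult.assoc mult.commute[of "cnj ?u"] complex_norm_square[symmetric]
          del: of_real_power)
      then show ?thesis
        using assms by (simp add: sn_diff_power2 ip_linear[OF posf_dual[OF assms(1)]] sn_scale
            norm_mult power_mult_distrib)
    qed
    finally show "0 \<le> (sn \<psi> x)\<^sup>2 - 2 * s * (cmod ?u)\<^sup>2 + s\<^sup>2 * (cmod ?u)\<^sup>2 * (sn \<psi> y)\<^sup>2" .
  qed auto
  then show ?thesis
    using ip_self(2) assms by (simp add: power_mult_distrib[symmetric] power2_le_iff_abs_le)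
qed

lemma Re_ip_le:
  assumes "posf \<psi>" "x \<in> carrier A" "y \<in> carrier A"
  shows "Re (ip \<psi> x y) \<le> sn \<psi> x * sn \<psi> y"
  by (rule order_trans[OF complex_Re_le_cmod ip_le[OF assms]])

lemma sn_triangle:
  assumes "posf \<psi>" "x \<in> carrier A" "y \<in> carrier A"
  shows "sn \<psi> (x \<oplus> y) \<le> sn \<psi> x + sn \<psi> y"
proof (rule power2_le_imp_le)
  show "(sn \<psi> (x \<oplus> y))\<^sup>2 \<le> (sn \<psi> x + sn \<psi> y)\<^sup>2"
    using assms Re_ip_le[OF assms] by (simp add: sn_add_power2 power2_sum)
qed (use ip_self(2) assms in simp)

lemma sn_triangle_diff:
  assumes "posf \<psi>" "x \<in> carrier A" "y \<in> carrier A"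
  shows "sn \<psi> (x \<ominus> y) \<le> sn \<psi> x + sn \<psi> y"
  using sn_triangle[of \<psi> x "scale A (- 1) y"] sn_scale[of \<psi> y "- 1"] assms
  by (simp add: minus_eq_scale)

lemma sn_le_diff:
  assumes "posf \<psi>" "x \<in> carrier A" "y \<in> carrier A"
  shows "sn \<psi> x \<le> sn \<psi> (x \<ominus> y) + sn \<psi> y"
  using sn_triangle[of \<psi> "x \<ominus> y" y] assms by (simp add: diff_add_cancel)

text \<open>Taking roots of order 2^k removes the constant C. In terms of q = L/r: if r > L then 1
  <= C q^(2^k) for all k, although the right side tends to 0.\<close>

lemma exponential_bound_imp_le:
  fixes r L C :: real
  assumes "0 \<le> L" "\<And>k. r ^ (2 ^ k) \<le> C * L ^ (2 ^ k)"
  shows "r \<le> L"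
proof (rule ccontr)
  assume "\<not> r \<le> L"
  then have r: "0 \<le> L" "L < r" "0 < r" using assms by auto
  define q where "q = L / r"
  have q: "0 \<le> q" "q < 1" using r by (auto simp: q_def)
  have "1 \<le> C * q ^ (2 ^ k)" for k
    using assms(2)[of k] r by (simp add: q_def power_divide field_simps)
  moreover have "(\<lambda>k. C * q ^ (2 ^ k)) \<longlonglongrightarrow> C * 0"
  proof (intro tendsto_mult tendsto_const)
    have "strict_mono (\<lambda>k::nat. (2::nat) ^ k)" by (simp add: strict_monoI)
    moreover have "(\<lambda>k. q ^ k) \<longlonglongrightarrow> 0" using q by (intro LIMSEQ_power_zero) auto
    ultimately show "(\<lambda>k. q ^ (2 ^ k)) \<longlonglongrightarrow> 0"
      using LIMSEQ_subseq_LIMSEQ by (fastforce simp: o_def)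
  qed
  ultimately have "1 \<le> C * 0"
    by (intro LIMSEQ_le_const) auto
  then show False by simp
qed

lemma cnorm_pow_le:
  assumes "h \<in> carrier A"
  shows "cnorm A (h [^] (n::nat)) \<le> cnorm A h ^ n"
proof (induction n)
  case 0
  then show ?case using cnorm_one_le by simp
next
  case (Suc n)
  have "cnorm A (h [^] Suc n) \<le> cnorm A (h [^] n) * cnorm A h"
    using cnorm_mult[of "h [^] n" h] assms by simp
  also have "\<dots> \<le> cnorm A h ^ n * cnorm A h"
    using Suc cnorm_nonneg assms by (intro mult_right_mono) auto
  finally show ?case by (simp add: mult.commute)
qed

lemma star_pow:
  assumes "h \<in> carrier A"
  shows "star A (h [^] (n::nat)) = star A h [^] n"
proof (induction n)
  case (Suc n)
  then show ?case using assms by (metis nat_pow_Suc nat_pow_Suc2 star_closed star_mult nat_pow_closed)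
qed simp

text \<open>A preliminary bound that starts the growth estimate in \<open>sn_mult_le\<close>; its
  constant disappears there in the limit, and the sharp form is \<open>sn_le\<close>.\<close>

lemma sn_le_crude:
  assumes "posf \<psi>" "x \<in> carrier A"
  shows "sn \<psi> x \<le> sqrt (dual_norm A \<psi>) * cnorm A x"
proof -
  have "Re (ip \<psi> x x) \<le> cmod (\<psi> (star A x \<otimes> x))"
    by (simp add: ip_def complex_Re_le_cmod)
  also have "\<dots> \<le> dual_norm A \<psi> * (cnorm A x)\<^sup>2"
    using dual_norm_bound[of \<psi> "star A x \<otimes> x"] assms by (simp add: posf_dual cnorm_star_mult)
  finally have "sn \<psi> x \<le> sqrt (dual_norm A \<psi> * (cnorm A x)\<^sup>2)"
    unfolding sn_def by (rule real_sqrt_le_mono)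
  then show ?thesis using cnorm_nonneg[OF assms(2)] by (simp add: real_sqrt_mult)
qed

text \<open>With \<open>s\<^sub>n\<close> the seminorm of \<open>h\<^sup>n x\<close> for \<open>h = a\<^sup>* a\<close>, Cauchy--Schwarz gives
  \<open>s\<^sub>n\<^sup>2 \<le> s\<^sub>0 s\<^sub>2\<^sub>n\<close>, so \<open>s\<^sub>1 / s\<^sub>0\<close> is at most the exponential growth rate of
  \<open>s\<^sub>n\<close>; this avoids the spectral theorem.\<close>

lemma sn_mult_le:
  assumes \<psi>: "posf \<psi>" and a: "a \<in> carrier A" and x: "x \<in> carrier A"
  shows "sn \<psi> (a \<otimes> x) \<le> cnorm A a * sn \<psi> x"
proof -
  have d: "\<psi> \<in> dual A" using \<psi> by (simp add: posf_dual)
  define h where "h = star A a \<otimes> a"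
  have h: "h \<in> carrier A" "star A h = h" using a by (auto simp: h_def star_mult)
  define s where "s n = sn \<psi> (h [^] (n::nat) \<otimes> x)" for n
  have s_nonneg: "0 \<le> s n" for n using \<psi> h x by (simp add: s_def ip_self)
  have s0: "s 0 = sn \<psi> x" using x by (simp add: s_def)
  have sq: "(s n)\<^sup>2 \<le> s 0 * s (2 * n)" for n
  proof -
    have "ip \<psi> (h [^] n \<otimes> x) (h [^] n \<otimes> x) = ip \<psi> x (h [^] (2 * n) \<otimes> x)"
      using h x by (simp add: ip_mult(2)[OF d] star_pow m_assoc[symmetric] nat_pow_mult mult_2)
    then have "(s n)\<^sup>2 = Re (ip \<psi> x (h [^] (2 * n) \<otimes> x))"
      using \<psi> h x by (simp add: s_def sn_power2)
    also have "\<dots> \<le> sn \<psi> x * sn \<psi> (h [^] (2 * n) \<otimes> x)"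
      using \<psi> h x by (intro Re_ip_le) auto
    finally show ?thesis using s0 by (simp add: s_def)
  qed
  have s1: "s 1 \<le> cnorm A h * s 0"
  proof (cases "s 0 = 0")
    case True
    then have "(s 1)\<^sup>2 \<le> 0" using sq[of 1] by simp
    then show ?thesis using True by simp
  next
    case False
    then have pos: "0 < s 0" using s_nonneg[of 0] by simp
    define r where "r = s 1 / s 0"
    have r: "0 \<le> r" using pos s_nonneg[of 1] by (simp add: r_def)
    have low: "s 0 * r ^ (2 ^ k) \<le> s (2 ^ k)" for k
    proof (induction k)
      case 0
      then show ?case using pos by (simp add: r_def)
    next
      case (Suc k)
      have "s 0 * (s 0 * r ^ (2 ^ Suc k)) = (s 0 * r ^ (2 ^ k))\<^sup>2"
        by (simp add: power_mult_distrib power_even_eq power2_eq_square)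
      also have "\<dots> \<le> (s (2 ^ k))\<^sup>2"
        using Suc pos r by (intro power_mono) auto
      also have "\<dots> \<le> s 0 * s (2 ^ Suc k)" using sq[of "2 ^ k"] by simp
      finally show ?case using pos by simp
    qed
    have up: "s n \<le> sqrt (dual_norm A \<psi>) * cnorm A x * cnorm A h ^ n" for n
    proof -
      have "cnorm A (h [^] n \<otimes> x) \<le> cnorm A h ^ n * cnorm A x"
        using cnorm_mult[of "h [^] n" x] cnorm_pow_le[OF h(1), of n] h x cnorm_nonneg
        by (meson mult_right_mono nat_pow_closed order_trans)
      then show ?thesis
        using sn_le_crude[OF \<psi>, of "h [^] n \<otimes> x"] h x dual_norm_nonneg[OF d]
          mult_left_mono[of "cnorm A (h [^] n \<otimes> x)" "cnorm A h ^ n * cnorm A x"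
            "sqrt (dual_norm A \<psi>)"]
        by (simp add: s_def mult.commute mult.left_commute)
    qed
    have "r \<le> cnorm A h"
    proof (rule exponential_bound_imp_le)
      show "0 \<le> cnorm A h" using h cnorm_nonneg by simp
      show "r ^ 2 ^ k
          \<le> (sqrt (dual_norm A \<psi>) * cnorm A x / s 0) * cnorm A h ^ 2 ^ k" for k
        using order_trans[OF low[of k] up] pos by (simp add: field_simps)
    qed
    then show ?thesis using pos by (simp add: r_def field_simps)
  qed
  \<comment> \<open>One more Cauchy-Schwarz passes from h to a. The norm of h is the square of that
    of a, so no factor is lost.\<close>
  have "ip \<psi> (a \<otimes> x) (a \<otimes> x) = ip \<psi> x (h \<otimes> x)"
    using a x by (simp add: ip_mult(2)[OF d] h_def m_assoc)
  then have "(sn \<psi> (a \<otimes> x))\<^sup>2 \<le> s 0 * s 1"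
    using \<psi> a x h Re_ip_le[OF \<psi>, of x "h \<otimes> x"]
    by (simp add: sn_power2 s_def)
  also have "\<dots> \<le> s 0 * (cnorm A h * s 0)"
    using s1 s_nonneg by (intro mult_left_mono) auto
  also have "\<dots> = (cnorm A a * sn \<psi> x)\<^sup>2"
    using a by (simp add: h_def cnorm_star_mult s0 power2_eq_square)
  finally show ?thesis
    by (rule power2_le_imp_le) (use cnorm_nonneg[OF a] ip_self(2)[OF \<psi> x] in simp)
qed

lemma sn_one: "posf \<psi> \<Longrightarrow> (sn \<psi> \<one>)\<^sup>2 = Re (\<psi> \<one>)"
  by (simp add: sn_power2)

lemma sn_le:
  assumes "posf \<psi>" "x \<in> carrier A"
  shows "sn \<psi> x \<le> cnorm A x * sn \<psi> \<one>"
  using sn_mult_le[of \<psi> x \<one>] assms by simp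

end

section \<open>Hahn--Banach and domination by positive functionals\<close>

text \<open>The bound is optimal at t = e/s; for s = 0 the value t = e^2/d contradicts d >
  0.\<close>

lemma quadratic_bound_imp_le:
  fixes d e s :: real
  assumes "\<And>t. 0 < t \<Longrightarrow> 2 * t * d \<le> t\<^sup>2 * s\<^sup>2 + e\<^sup>2" "0 < e" "0 \<le> s"
  shows "d \<le> e * s"
proof (cases "s = 0")
  case True
  have "d \<le> 0"
  proof (rule ccontr)
    assume "\<not> d \<le> 0"
    then show False
      using assms(1)[of "e\<^sup>2 / d"] True assms(2) by simp
  qed
  then show ?thesis using True by simp
next
  case False
  then have "2 * (e / s) * d \<le> (e / s)\<^sup>2 * s\<^sup>2 + e\<^sup>2"
    using assms by (intro assms(1)) auto
  also have "\<dots> = 2 * e * e" using False by (simp add: power_divide power2_eq_square)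
  finally show ?thesis using False assms by (simp add: field_simps)
qed

section \<open>Functionals dominated by a GNS seminorm, and the Hahn-Banach theorem\<close>

context cstar_algebra
begin

text \<open>Domination by \<open>sn \<psi>\<close> says that \<xi> is the inner product with a
  vector of norm at most C in the GNS space of \<psi>; functionals of this kind stand for the
  vectors of that space.\<close>

definition dominated :: "('a \<Rightarrow> complex) \<Rightarrow> real \<Rightarrow> ('a \<Rightarrow> complex) \<Rightarrow> bool" where
  "dominated \<psi> C \<xi> \<longleftrightarrow> \<xi> \<in> dual A \<and> 0 \<le> C \<and> (\<forall>x\<in>carrier A. cmod (\<xi> x) \<le> C * sn \<psi> x)"

text \<open>The functional J is the squared distance to the Riesz vector of \<xi>, up to an additive
  constant. A near-minimiser inside the algebra satisfies the Riesz identity up to e, so the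
  argument stays within the algebra.\<close>

lemma riesz_approx:
  assumes \<psi>: "posf \<psi>" and \<xi>: "dominated \<psi> C \<xi>" and e: "0 < e"
  obtains a where "a \<in> carrier A" "\<And>x. x \<in> carrier A \<Longrightarrow> cmod (\<xi> x - ip \<psi> a x) \<le> e * sn \<psi> x"
proof -
  have d: "\<psi> \<in> dual A" "\<xi> \<in> dual A" using \<psi> \<xi> by (auto simp: posf_def dominated_def)
  define J where "J a = (sn \<psi> a)\<^sup>2 - 2 * Re (\<xi> a)" for a
  have J_low: "- C\<^sup>2 \<le> J a" if "a \<in> carrier A" for a
  proof -
    have "Re (\<xi> a) \<le> C * sn \<psi> a"
      using \<xi> that complex_Re_le_cmod order_trans unfolding dominated_def by blast
    moreover have "0 \<le> (sn \<psi> a - C)\<^sup>2" by simp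
    ultimately show ?thesis by (simp add: J_def power2_diff mult_ac)
  qed
  have bdd: "bdd_below (J ` carrier A)" using J_low by (auto intro!: bdd_belowI)
  \<comment> \<open>The slack e^2 is turned into the factor e by the optimisation over t
    below.\<close>
  have "\<exists>a\<in>carrier A. J a < (INF a\<in>carrier A. J a) + e\<^sup>2"
  proof (rule ccontr)
    assume "\<not> ?thesis"
    then have "(INF a\<in>carrier A. J a) + e\<^sup>2 \<le> (INF a\<in>carrier A. J a)"
      by (intro cINF_greatest) (auto simp: not_less)
    then show False using e by simp
  qed
  then obtain a where a: "a \<in> carrier A" "J a < (INF a\<in>carrier A. J a) + e\<^sup>2" by blast
  define D where "D x = \<xi> x - ip \<psi> a x" for x
  have min: "2 * Re (D x) \<le> (sn \<psi> x)\<^sup>2 + e\<^sup>2" if "x \<in> carrier A" for x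
  proof -
    have "(INF a\<in>carrier A. J a) \<le> J (a \<oplus> x)"
      using a that by (intro cINF_lower bdd) auto
    then have "J a \<le> J (a \<oplus> x) + e\<^sup>2" using a by linarith
    then show ?thesis
      using \<psi> a that by (simp add: J_def D_def sn_add_power2 dual_add[OF d(2)])
  qed
  have "cmod (D x) \<le> e * sn \<psi> x" if x: "x \<in> carrier A" for x
  proof (cases "D x = 0")
    case True
    then show ?thesis using e ip_self(2)[OF \<psi> x] by simp
  next
    case False
    show ?thesis
    proof (rule quadratic_bound_imp_le)
      fix t :: real assume t: "0 < t"
      \<comment> \<open>c has modulus t and cancels the phase of \<open>D x\<close>.\<close>
      define c where "c = of_real (t / cmod (D x)) * cnj (D x)"
      have "c * D x = of_real (t * cmod (D x))"
        using False by (simp add: c_def mult.assoc mult.commute[of "cnj (D x)"]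
            complex_norm_square[symmetric] power2_eq_square)
      moreover have "D (scale A c x) = c * D x"
        using a x d by (simp add: D_def dual_scale ip_linear right_diff_distrib)
      moreover have "cmod c = t" using False t by (simp add: c_def norm_mult norm_divide)
      ultimately show "2 * t * cmod (D x) \<le> t\<^sup>2 * (sn \<psi> x)\<^sup>2 + e\<^sup>2"
        using min[of "scale A c x"] x \<psi> by (simp add: sn_scale power_mult_distrib)
    qed (use e ip_self(2)[OF \<psi> x] in auto)
  qed
  then show ?thesis using that a unfolding D_def by blast
qed

text \<open>Evaluating the approximation at a itself bounds the square of \<open>sn \<psi> a\<close>
  by (C + e) times \<open>sn \<psi> a\<close>.\<close>

lemma sn_approximant_le:
  assumes \<psi>: "posf \<psi>" and \<xi>: "dominated \<psi> C \<xi>" and e: "0 \<le> e" and a: "a \<in> carrier A"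
    and approx: "\<And>x. x \<in> carrier A \<Longrightarrow> cmod (\<xi> x - ip \<psi> a x) \<le> e * sn \<psi> x"
  shows "sn \<psi> a \<le> C + e"
proof -
  have "cmod (ip \<psi> a a) \<le> cmod (\<xi> a) + cmod (\<xi> a - ip \<psi> a a)"
    using norm_triangle_ineq4[of "\<xi> a" "\<xi> a - ip \<psi> a a"] by simp
  also have "\<dots> \<le> C * sn \<psi> a + e * sn \<psi> a"
    using \<xi> a approx[OF a] by (intro add_mono) (auto simp: dominated_def)
  finally have "sn \<psi> a * sn \<psi> a \<le> (C + e) * sn \<psi> a"
    using ip_self[OF \<psi> a] by (simp add: norm_power power2_eq_square algebra_simps norm_mult)
  then show ?thesis
    using ip_self(2)[OF \<psi> a] \<xi> e by (cases "sn \<psi> a = 0") (auto simp: dominated_def)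
qed

text \<open>Zorn's lemma yields a minimal sublinear functional below q, and a minimal sublinear
  functional is linear; there is no extension from subspaces.\<close>

lemma hahn_banach:
  assumes q_add: "\<And>x y. \<lbrakk>x \<in> carrier A; y \<in> carrier A\<rbrakk> \<Longrightarrow> q (x \<oplus> y) \<le> q x + q y"
    and q_scale: "\<And>t x. \<lbrakk>0 < t; x \<in> carrier A\<rbrakk> \<Longrightarrow> q (scale A (of_real t) x) = t * q x"
  obtains f :: "'a \<Rightarrow> real" where
    "\<And>x y. \<lbrakk>x \<in> carrier A; y \<in> carrier A\<rbrakk> \<Longrightarrow> f (x \<oplus> y) = f x + f y"
    "\<And>t x. x \<in> carrier A \<Longrightarrow> f (scale A (of_real t) x) = t * f x"
    "\<And>x. x \<in> carrier A \<Longrightarrow> f x \<le> q x"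
proof -
  define sub where "sub g \<longleftrightarrow> (\<forall>x\<in>carrier A. \<forall>y\<in>carrier A. g (x \<oplus> y) \<le> g x + g y) \<and>
     (\<forall>t>0. \<forall>x\<in>carrier A. g (scale A (of_real t) x) = t * g x)" for g :: "'a \<Rightarrow> real"
  \<comment> \<open>Extensionality makes the pointwise comparison antisymmetric on Q.\<close>
  define Q where "Q = {g \<in> extensional (carrier A). sub g \<and> (\<forall>x\<in>carrier A. g x \<le> q x)}"
  define P where "P g h \<longleftrightarrow> (\<forall>x\<in>carrier A. h x \<le> g x)" for g h :: "'a \<Rightarrow> real"
  have sub_zero: "g \<zero> = 0" if "sub g" for g
    using that[unfolded sub_def] by (auto dest!: spec[of _ 2] bspec[of _ _ \<zero>])
  have sub_low: "- g (scale A (- 1) x) \<le> g x" if "sub g" "x \<in> carrier A" for g x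
  proof -
    have "g (x \<oplus> scale A (- 1) x) \<le> g x + g (scale A (- 1) x)"
      using that by (simp add: sub_def)
    then show ?thesis
      using sub_zero[OF that(1)] that by (simp add: scale_minus_one r_neg)
  qed
  \<comment> \<open>One inequality for all t is enough: the other is the same one for 1/t.\<close>
  have scaleI: "g (scale A (of_real t) x) = t * g x"
    if le: "\<And>t x. \<lbrakk>0 < t; x \<in> carrier A\<rbrakk> \<Longrightarrow> g (scale A (of_real t) x) \<le> t * g x"
      and "0 < t" "x \<in> carrier A" for g :: "'a \<Rightarrow> real" and t x
  proof -
    have "g (scale A (of_real (1 / t)) (scale A (of_real t) x))
        \<le> 1 / t * g (scale A (of_real t) x)"
      using that by (intro le) auto
    then have "t * g x \<le> g (scale A (of_real t) x)"
      using that by (simp add: scale_scale field_simps)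
    then show ?thesis using le[OF that(2,3)] by simp
  qed
  \<comment> \<open>\<open>P m a\<close> says that a lies below m, so an element maximal for P is a
    minimal functional.\<close>
  have "\<exists>m\<in>Q. \<forall>a\<in>Q. P m a \<longrightarrow> a = m"
  proof (rule predicate_Zorn)
    show "partial_order_on Q (relation_of P Q)"
      by (auto simp: partial_order_on_def preorder_on_def refl_on_def trans_def antisym_def
          relation_of_def P_def Q_def intro: order_trans
          intro!: extensionalityI[of _ "carrier A"] order.antisym[of "_ :: real"])
  next
    fix C assume C: "C \<in> Chains (relation_of P Q)"
    then have CQ: "C \<subseteq> Q" by (auto simp: Chains_def relation_of_def)
    have comparable: "P g h \<or> P h g" if "g \<in> C" "h \<in> C" for g h
      using C that by (auto simp: Chains_def relation_of_def)
    show "\<exists>u\<in>Q. \<forall>a\<in>C. P a u"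
    proof (cases "C = {}")
      case True
      have "restrict q (carrier A) \<in> Q"
        using q_add q_scale by (simp add: Q_def sub_def)
      then show ?thesis using True by blast
    next
      case False
      \<comment> \<open>The bound of a chain is its pointwise infimum. It is finite because a
        sublinear g below q satisfies g(x) >= -g(-x) >= -q(-x).\<close>
      define u where "u = (\<lambda>x\<in>carrier A. INF g\<in>C. g x)"
      have bdd: "bdd_below ((\<lambda>g. g x) ` C)" if "x \<in> carrier A" for x
      proof -
        have "- q (scale A (- 1) x) \<le> g x" if g: "g \<in> C" for g
        proof -
          have "sub g" "g (scale A (- 1) x) \<le> q (scale A (- 1) x)"
            using g CQ \<open>x \<in> carrier A\<close> by (auto simp: Q_def)
          then show ?thesis using sub_low[of g x] \<open>x \<in> carrier A\<close> by simp
        qed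
        then show ?thesis by (auto intro!: bdd_belowI)
      qed
      have u_le: "u x \<le> g x" if "g \<in> C" "x \<in> carrier A" for g x
        using cINF_lower[OF bdd that(1)] that by (simp add: u_def)
      have u_ge: "b \<le> u x" if "x \<in> carrier A" "\<And>g. g \<in> C \<Longrightarrow> b \<le> g x" for b x
        using that False by (simp add: u_def cINF_greatest)
      have "u (x \<oplus> y) \<le> u x + u y" if xy: "x \<in> carrier A" "y \<in> carrier A" for x y
      proof -
        have *: "u (x \<oplus> y) \<le> g x + h y" if gh: "g \<in> C" "h \<in> C" for g h
        proof -
          \<comment> \<open>Members of a chain are comparable, so the smaller of g and h serves both
            arguments; this is what makes the infimum subadditive.\<close>
          obtain k where k: "k \<in> C" "k x \<le> g x" "k y \<le> h y"
            using comparable[OF gh] gh xy unfolding P_def by blast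
          have "u (x \<oplus> y) \<le> k (x \<oplus> y)" using u_le k xy by simp
          also have "\<dots> \<le> k x + k y" using k CQ xy by (auto simp: Q_def sub_def)
          finally show ?thesis using k by simp
        qed
        have "u (x \<oplus> y) - h y \<le> u x" if "h \<in> C" for h
          using *[OF _ that] xy by (intro u_ge) (auto simp: diff_le_eq)
        then have "u (x \<oplus> y) - u x \<le> u y"
          using xy by (intro u_ge) (auto simp: diff_le_eq add.commute)
        then show ?thesis by simp
      qed
      moreover have "u (scale A (of_real t) x) = t * u x" if tx: "0 < t" "x \<in> carrier A" for t x
      proof (rule scaleI[OF _ tx])
        fix t :: real and x assume tx: "0 < t" "x \<in> carrier A"
        have "u (scale A (of_real t) x) / t \<le> u x"
        proof (rule u_ge[OF tx(2)])
          fix g assume g: "g \<in> C"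
          then have "u (scale A (of_real t) x) \<le> t * g x"
            using u_le[OF g, of "scale A (of_real t) x"] CQ tx by (auto simp: Q_def sub_def)
          then show "u (scale A (of_real t) x) / t \<le> g x" using tx by (simp add: field_simps)
        qed
        then show "u (scale A (of_real t) x) \<le> t * u x" using tx by (simp add: field_simps)
      qed
      moreover have "u x \<le> q x" if "x \<in> carrier A" for x
      proof -
        obtain g where "g \<in> C" using False by blast
        then show ?thesis using u_le[of g x] that CQ by (fastforce simp: Q_def)
      qed
      ultimately have "u \<in> Q" by (auto simp: Q_def sub_def u_def)
      then show ?thesis using u_le by (auto simp: P_def)
    qed
  qed
  then obtain m where m: "m \<in> Q" and minimal: "\<And>g. \<lbrakk>g \<in> Q; P m g\<rbrakk> \<Longrightarrow> g = m" by blast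
  have m_add: "m (x \<oplus> y) \<le> m x + m y" if "x \<in> carrier A" "y \<in> carrier A" for x y
    using m that by (simp add: Q_def sub_def)
  have m_scale: "m (scale A (of_real t) x) = t * m x" if "0 \<le> t" "x \<in> carrier A" for t x
    using m that sub_zero[of m] by (cases "t = 0") (auto simp: Q_def sub_def)
  have m_low: "m z \<le> m (x \<oplus> z) + m (scale A (- 1) x)"
    if "x \<in> carrier A" "z \<in> carrier A" for x z
  proof -
    have "z = (x \<oplus> z) \<oplus> scale A (- 1) x"
      using that by (metis a_assoc a_comm a_inv_closed l_zero r_neg scale_minus_one)
    then show ?thesis using m_add[of "x \<oplus> z" "scale A (- 1) x"] that by simp
  qed
  have additive: "m (x \<oplus> h) = m x + m h" if x: "x \<in> carrier A" and h: "h \<in> carrier A" for x h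
  proof -
    \<comment> \<open>The competitor g is sublinear and lies below m, hence equals m by minimality;
      its bound at t = 1 is the missing half of additivity.\<close>
    define F where "F x t = m (x \<oplus> scale A (of_real t) h) - t * m h" for x t
    define g where "g = (\<lambda>x\<in>carrier A. INF t\<in>{0..}. F x t)"
    have bdd: "bdd_below (F x ` {0..})" if "x \<in> carrier A" for x
    proof -
      have "- m (scale A (- 1) x) \<le> F x t" if "0 \<le> t" for t
        using m_low[of x "scale A (of_real t) h"] m_scale[of t h] that h \<open>x \<in> carrier A\<close>
        by (simp add: F_def)
      then show ?thesis by (auto intro!: bdd_belowI)
    qed
    have g_le: "g x \<le> F x t" if "0 \<le> t" "x \<in> carrier A" for x t
      using cINF_lower[OF bdd[OF that(2)], of t] that by (simp add: g_def)
    have g_ge: "b \<le> g x" if "x \<in> carrier A" "\<And>t. 0 \<le> t \<Longrightarrow> b \<le> F x t" for b x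
      using that by (auto simp: g_def intro!: cINF_greatest)
    have "g (x \<oplus> y) \<le> g x + g y" if xy: "x \<in> carrier A" "y \<in> carrier A" for x y
    proof -
      have *: "g (x \<oplus> y) \<le> F x s + F y t" if st: "0 \<le> s" "0 \<le> t" for s t
      proof -
        have "g (x \<oplus> y) \<le> F (x \<oplus> y) (s + t)" using g_le st xy by simp
        also have "(x \<oplus> y) \<oplus> scale A (of_real (s + t)) h
            = (x \<oplus> scale A (of_real s) h) \<oplus> (y \<oplus> scale A (of_real t) h)"
          using xy h by (simp add: scale_add_left a_ac)
        then have "F (x \<oplus> y) (s + t) \<le> F x s + F y t"
          using m_add[of "x \<oplus> scale A (of_real s) h" "y \<oplus> scale A (of_real t) h"] xy h
          by (simp add: F_def algebra_simps)
        finally show ?thesis .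
      qed
      have "g (x \<oplus> y) - F y t \<le> g x" if "0 \<le> t" for t
        using *[OF _ that] xy by (intro g_ge) (auto simp: diff_le_eq)
      then have "g (x \<oplus> y) - g x \<le> g y"
        using xy by (intro g_ge) (auto simp: diff_le_eq add.commute)
      then show ?thesis by simp
    qed
    moreover have "g (scale A (of_real r) x) = r * g x" if rx: "0 < r" "x \<in> carrier A" for r x
    proof (rule scaleI[OF _ rx])
      fix r :: real and x assume rx: "0 < r" "x \<in> carrier A"
      have "g (scale A (of_real r) x) / r \<le> g x"
      proof (rule g_ge[OF rx(2)])
        fix t :: real assume t: "0 \<le> t"
        have "g (scale A (of_real r) x) \<le> F (scale A (of_real r) x) (r * t)"
          using g_le t rx by simp
        also have "\<dots> = r * F x t"
          using m_scale[of r "x \<oplus> scale A (of_real t) h"] rx h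
          by (simp add: F_def scale_add_right scale_scale right_diff_distrib mult.assoc)
        finally show "g (scale A (of_real r) x) / r \<le> F x t" using rx by (simp add: field_simps)
      qed
      then show "g (scale A (of_real r) x) \<le> r * g x" using rx by (simp add: field_simps)
    qed
    moreover have g_m: "g x \<le> m x" if "x \<in> carrier A" for x
      using g_le[of 0 x] that h by (simp add: F_def)
    moreover have "g x \<le> q x" if "x \<in> carrier A" for x
      using m g_m[OF that] that by (auto simp: Q_def intro: order_trans)
    moreover have "g \<in> extensional (carrier A)" by (simp add: g_def)
    ultimately have "g \<in> Q" by (simp add: Q_def sub_def)
    then have "g = m" using g_m by (intro minimal) (auto simp: P_def)
    then have "m x \<le> m (x \<oplus> h) - m h" using g_le[of 1 x] x h by (simp add: F_def)
    then show ?thesis using m_add[OF x h] by simp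
  qed
  have minus: "m (scale A (- 1) x) = - m x" if "x \<in> carrier A" for x
    using additive[of x "scale A (- 1) x"] sub_zero[of m] m that
    by (simp add: Q_def scale_minus_one r_neg)
  have "m (scale A (of_real t) x) = t * m x" if "x \<in> carrier A" for t x
  proof (cases "0 \<le> t")
    case False
    then have "m (scale A (of_real (- t)) (scale A (- 1) x)) = - t * m (scale A (- 1) x)"
      using that by (intro m_scale) auto
    then show ?thesis using that by (simp add: scale_scale minus)
  qed (use m_scale that in simp)
  then show ?thesis
    using that[of m] additive m by (auto simp: Q_def)
qed

section \<open>Sums of squares, and domination by a positive functional\<close>

primrec sqsum :: "'a list \<Rightarrow> 'a" where
  "sqsum [] = \<zero>"
| "sqsum (x # xs) = star A x \<otimes> x \<oplus> sqsum xs"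

text \<open>Coefficients are attached to elements rather than to positions; this suffices because
  they will be the values \<open>cnj (\<phi> x)\<close>.\<close>

primrec lincomb :: "('a \<Rightarrow> complex) \<Rightarrow> 'a list \<Rightarrow> 'a" where
  "lincomb c [] = \<zero>"
| "lincomb c (x # xs) = scale A (c x) x \<oplus> lincomb c xs"

lemma sqsum_closed [simp]: "set xs \<subseteq> carrier A \<Longrightarrow> sqsum xs \<in> carrier A"
  by (induction xs) auto

lemma lincomb_closed [simp]: "set xs \<subseteq> carrier A \<Longrightarrow> lincomb c xs \<in> carrier A"
  by (induction xs) auto

lemma sqsum_append:
  "\<lbrakk>set xs \<subseteq> carrier A; set ys \<subseteq> carrier A\<rbrakk> \<Longrightarrow> sqsum (xs @ ys) = sqsum xs \<oplus> sqsum ys"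
  by (induction xs) (auto simp: a_assoc)

lemma sqsum_map_scale:
  assumes "set xs \<subseteq> carrier A" "0 \<le> t"
  shows "sqsum (map (scale A (of_real (sqrt t))) xs) = scale A (of_real t) (sqsum xs)"
  using assms(1)
proof (induction xs)
  case (Cons x xs)
  then show ?case
    using assms(2)
    by (simp add: star_scale scale_mult_left scale_mult_right scale_scale scale_add_right
        of_real_mult[symmetric] del: of_real_mult)
qed simp

lemma dual_lincomb:
  "\<lbrakk>\<phi> \<in> dual A; set xs \<subseteq> carrier A\<rbrakk> \<Longrightarrow> \<phi> (lincomb c xs) = (\<Sum>x\<leftarrow>xs. c x * \<phi> x)"
  by (induction xs) (auto simp: dual_add dual_scale)

end

text \<open>A row of scalars applied to a column of elements: the norm of the column is the square
  root of that of \<open>sqsum xs\<close>. Isolating the inequality keeps the theory of the bidual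
  independent of the concrete algebra.\<close>

locale column_cstar_algebra = cstar_algebra +
  assumes column: "set xs \<subseteq> carrier A \<Longrightarrow>
    (cnorm A (lincomb c xs))\<^sup>2 \<le> (\<Sum>x\<leftarrow>xs. (cmod (c x))\<^sup>2) * cnorm A (sqsum xs)"
begin

text \<open>With coefficients \<open>cnj (\<phi> x)\<close> the combination y satisfies \<phi>(y) =
  S. Hence S is at most the norm of \<phi> times that of y; squaring, inserting the column
  inequality and cancelling S gives the claim.\<close>

lemma pietsch_inequality:
  assumes \<phi>: "\<phi> \<in> dual A" and xs: "set xs \<subseteq> carrier A"
  shows "(\<Sum>x\<leftarrow>xs. (cmod (\<phi> x))\<^sup>2) \<le> (dual_norm A \<phi>)\<^sup>2 * cnorm A (sqsum xs)"
proof -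
  define S where "S = (\<Sum>x\<leftarrow>xs. (cmod (\<phi> x))\<^sup>2)"
  define y where "y = lincomb (\<lambda>x. cnj (\<phi> x)) xs"
  have y: "y \<in> carrier A" using xs by (simp add: y_def)
  have S_nonneg: "0 \<le> S" unfolding S_def by (induction xs) auto
  have "(\<Sum>x\<leftarrow>ys. cnj (\<phi> x) * \<phi> x) = of_real (\<Sum>x\<leftarrow>ys. (cmod (\<phi> x))\<^sup>2)" for ys
    by (induction ys) (auto simp: mult.commute[of "cnj _"] complex_norm_square[symmetric])
  then have "\<phi> y = of_real S"
    using \<phi> xs by (simp add: y_def S_def dual_lincomb)
  then have "S \<le> dual_norm A \<phi> * cnorm A y"
    using dual_norm_bound[OF \<phi> y] S_nonneg by simp
  then have "S\<^sup>2 \<le> (dual_norm A \<phi> * cnorm A y)\<^sup>2"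
    using S_nonneg by (intro power_mono)
  also have "\<dots> \<le> (dual_norm A \<phi>)\<^sup>2 * (S * cnorm A (sqsum xs))"
    using column[OF xs, of "\<lambda>x. cnj (\<phi> x)"]
    by (simp add: power_mult_distrib y_def S_def mult_left_mono)
  finally have "S * S \<le> S * ((dual_norm A \<phi>)\<^sup>2 * cnorm A (sqsum xs))"
    by (simp add: power2_eq_square mult_ac)
  then have "S \<le> (dual_norm A \<phi>)\<^sup>2 * cnorm A (sqsum xs)"
    using S_nonneg cnorm_nonneg[of "sqsum xs"] xs by (cases "S = 0") auto
  then show ?thesis by (simp add: S_def)
qed

text \<open>Apply Hahn-Banach to q(h), the infimum of \<open>F h xs\<close> over finite lists. The
  empty list bounds f by K times the norm; the list \<open>[x]\<close> at the negative of
  \<open>star A x \<otimes> x\<close> gives f at least the squared modulus of \<phi>(x) on that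
  square.\<close>

lemma dominated_by_positive:
  assumes \<phi>: "\<phi> \<in> dual A"
  obtains \<psi> where "posf \<psi>" "dominated \<psi> 1 \<phi>" "Re (\<psi> \<one>) \<le> (dual_norm A \<phi>)\<^sup>2"
proof -
  define K where "K = (dual_norm A \<phi>)\<^sup>2"
  have K: "0 \<le> K" by (simp add: K_def)
  define S where "S xs = (\<Sum>x\<leftarrow>xs. (cmod (\<phi> x))\<^sup>2)" for xs
  define F where "F h xs = K * cnorm A (h \<oplus> sqsum xs) - S xs" for h xs
  define q where "q h = (INF xs\<in>lists (carrier A). F h xs)" for h
  have bdd: "bdd_below (F h ` lists (carrier A))" if h: "h \<in> carrier A" for h
  proof -
    \<comment> \<open>Pietsch's inequality is exactly what keeps the infimum defining q
      finite.\<close>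
    have "- K * cnorm A h \<le> F h xs" if "xs \<in> lists (carrier A)" for xs
    proof -
      have xs: "set xs \<subseteq> carrier A" using that by auto
      have "(h \<oplus> sqsum xs) \<ominus> h = sqsum xs"
        using h xs by (simp add: a_minus_def a_ac r_neg r_neg1 r_neg2)
      then have "cnorm A (sqsum xs) \<le> cnorm A (h \<oplus> sqsum xs) + cnorm A h"
        using cnorm_diff_le[of "h \<oplus> sqsum xs" h] h xs by simp
      then have "K * cnorm A (sqsum xs) \<le> K * (cnorm A (h \<oplus> sqsum xs) + cnorm A h)"
        using K by (intro mult_left_mono)
      then show ?thesis
        using pietsch_inequality[OF \<phi> xs] by (simp add: F_def S_def K_def algebra_simps)
    qed
    then show ?thesis by (auto intro!: bdd_belowI)
  qed
  have q_le: "q h \<le> F h xs" if "h \<in> carrier A" "set xs \<subseteq> carrier A" for h xs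
    using cINF_lower[OF bdd[OF that(1)], of xs] that by (auto simp: q_def)
  have q_ge: "b \<le> q h" if "\<And>xs. set xs \<subseteq> carrier A \<Longrightarrow> b \<le> F h xs" for b h
    unfolding q_def using that by (intro cINF_greatest) auto
  have q_add: "q (x \<oplus> y) \<le> q x + q y" if xy: "x \<in> carrier A" "y \<in> carrier A" for x y
  proof -
    have *: "q (x \<oplus> y) \<le> F x xs + F y ys"
      if s: "set xs \<subseteq> carrier A" "set ys \<subseteq> carrier A" for xs ys
    proof -
      have "(x \<oplus> y) \<oplus> sqsum (xs @ ys) = (x \<oplus> sqsum xs) \<oplus> (y \<oplus> sqsum ys)"
        using xy s by (simp add: sqsum_append a_ac)
      then have "K * cnorm A ((x \<oplus> y) \<oplus> sqsum (xs @ ys))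
          \<le> K * (cnorm A (x \<oplus> sqsum xs) + cnorm A (y \<oplus> sqsum ys))"
        using cnorm_triangle[of "x \<oplus> sqsum xs" "y \<oplus> sqsum ys"] xy s K
        by (intro mult_left_mono) auto
      then have "F (x \<oplus> y) (xs @ ys) \<le> F x xs + F y ys"
        by (simp add: F_def S_def algebra_simps)
      moreover have "q (x \<oplus> y) \<le> F (x \<oplus> y) (xs @ ys)" using xy s by (intro q_le) auto
      ultimately show ?thesis by simp
    qed
    have "q (x \<oplus> y) - F y ys \<le> q x" if "set ys \<subseteq> carrier A" for ys
      using *[OF _ that] by (intro q_ge) (auto simp: diff_le_eq)
    then have "q (x \<oplus> y) - q x \<le> q y"
      by (intro q_ge) (auto simp: diff_le_eq add.commute)
    then show ?thesis by simp
  qed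
  have q_scale_le: "q (scale A (of_real t) x) \<le> t * q x" if tx: "0 < t" "x \<in> carrier A" for t x
  proof -
    have "q (scale A (of_real t) x) / t \<le> q x"
    proof (rule q_ge)
      fix xs assume xs: "set xs \<subseteq> carrier A"
      \<comment> \<open>Scaling the list by the square root of t scales both terms of F by
        t.\<close>
      let ?ys = "map (scale A (of_real (sqrt t))) xs"
      have "S ?ys = t * S xs"
        using xs tx \<phi> unfolding S_def
        by (induction xs) (auto simp: dual_scale norm_mult power_mult_distrib algebra_simps)
      moreover have "scale A (of_real t) x \<oplus> sqsum ?ys = scale A (of_real t) (x \<oplus> sqsum xs)"
        using xs tx by (subst sqsum_map_scale) (auto simp: scale_add_right)
      ultimately have "F (scale A (of_real t) x) ?ys = t * F x xs"
        using xs tx by (simp add: F_def cnorm_scale algebra_simps)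
      moreover have "q (scale A (of_real t) x) \<le> F (scale A (of_real t) x) ?ys"
        using xs tx by (intro q_le) auto
      ultimately show "q (scale A (of_real t) x) / t \<le> F x xs" using tx by (simp add: field_simps)
    qed
    then show ?thesis using tx by (simp add: field_simps)
  qed
  have q_scale: "q (scale A (of_real t) x) = t * q x" if tx: "0 < t" "x \<in> carrier A" for t x
  proof -
    have "q (scale A (of_real (1 / t)) (scale A (of_real t) x)) \<le> 1 / t * q (scale A (of_real t) x)"
      using tx by (intro q_scale_le) auto
    then have "t * q x \<le> q (scale A (of_real t) x)"
      using tx by (simp add: scale_scale field_simps)
    then show ?thesis using q_scale_le[OF tx] by simp
  qed
  obtain f where f_add: "\<And>x y. \<lbrakk>x \<in> carrier A; y \<in> carrier A\<rbrakk> \<Longrightarrow> f (x \<oplus> y) = f x + f y"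
    and f_scale: "\<And>t x. x \<in> carrier A \<Longrightarrow> f (scale A (of_real t) x) = t * f x"
    and f_le: "\<And>x. x \<in> carrier A \<Longrightarrow> f x \<le> q x"
    using hahn_banach[of q, OF q_add q_scale] by blast
  have f_minus: "f (scale A (- 1) x) = - f x" if "x \<in> carrier A" for x
    using f_scale[OF that, of "- 1"] by simp
  have f_bound: "\<bar>f x\<bar> \<le> K * cnorm A x" if "x \<in> carrier A" for x
  proof -
    have *: "f y \<le> K * cnorm A y" if "y \<in> carrier A" for y
      using f_le[OF that] q_le[of y "[]"] that by (simp add: F_def S_def)
    show ?thesis
      using *[of x] *[of "scale A (- 1) x"] that by (simp add: f_minus cnorm_scale abs_le_iff)
  qed
  have f_square: "(cmod (\<phi> x))\<^sup>2 \<le> f (star A x \<otimes> x)" if x: "x \<in> carrier A" for x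
  proof -
    let ?z = "star A x \<otimes> x"
    \<comment> \<open>For this list the norm term in F vanishes.\<close>
    have "f (scale A (- 1) ?z) \<le> F (scale A (- 1) ?z) [x]"
      using f_le[of "scale A (- 1) ?z"] q_le[of "scale A (- 1) ?z" "[x]"] x by simp
    also have "\<dots> = - (cmod (\<phi> x))\<^sup>2"
      using x by (simp add: F_def S_def scale_minus_one l_neg)
    finally show ?thesis using f_minus[of ?z] x by simp
  qed
  \<comment> \<open>f is only real-linear. Averaging with the adjoint keeps its values on
    self-adjoint elements and makes the imaginary part of \<psi> vanish there.\<close>
  define g where "g x = (f x + f (star A x)) / 2" for x
  have g_add: "g (x \<oplus> y) = g x + g y" if "x \<in> carrier A" "y \<in> carrier A" for x y
    using that by (simp add: g_def f_add star_add field_simps)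
  have g_scale: "g (scale A (of_real t) x) = t * g x" if "x \<in> carrier A" for t x
    using that by (simp add: g_def f_scale star_scale field_simps)
  have g_bound: "\<bar>g x\<bar> \<le> K * cnorm A x" if "x \<in> carrier A" for x
    using f_bound[of x] f_bound[of "star A x"] that by (simp add: g_def cnorm_star)
  \<comment> \<open>The complex-linear functional with real part g.\<close>
  define \<psi> where "\<psi> = (\<lambda>x\<in>carrier A. Complex (g x) (- g (scale A \<i> x)))"
  have psi_add: "\<psi> (x \<oplus> y) = \<psi> x + \<psi> y" if "x \<in> carrier A" "y \<in> carrier A" for x y
    using that by (simp add: \<psi>_def g_add scale_add_right complex_eq_iff)
  have psi_scale: "\<psi> (scale A c x) = c * \<psi> x" if x: "x \<in> carrier A" for c x
  proof -
    have *: "g (scale A d x) = Re d * g x + Im d * g (scale A \<i> x)" for d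
    proof -
      have "d = of_real (Re d) + of_real (Im d) * \<i>" by (simp add: complex_eq_iff)
      then have "scale A d x = scale A (of_real (Re d)) x
          \<oplus> scale A (of_real (Im d)) (scale A \<i> x)"
        using x scale_add_left[of x "of_real (Re d)" "of_real (Im d) * \<i>"]
        by (simp add: scale_scale)
      then show ?thesis using x by (simp add: g_add g_scale)
    qed
    show ?thesis
      using x *[of c] *[of "\<i> * c"] by (simp add: \<psi>_def scale_scale complex_eq_iff)
  qed
  have psi_sq: "\<psi> (star A x \<otimes> x) = of_real (f (star A x \<otimes> x))" if x: "x \<in> carrier A" for x
  proof -
    let ?z = "star A x \<otimes> x"
    have "star A ?z = ?z" using x by (simp add: star_mult)
    moreover have "f (scale A (- \<i>) ?z) = - f (scale A \<i> ?z)"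
      using f_minus[of "scale A \<i> ?z"] x by (simp add: scale_scale)
    ultimately show ?thesis
      using x by (simp add: \<psi>_def g_def star_scale complex_eq_iff)
  qed
  have "\<psi> \<in> dual A"
  proof (rule dualI[OF _ psi_add psi_scale])
    show "\<psi> \<in> extensional (carrier A)" by (simp add: \<psi>_def)
    show "cmod (\<psi> x) \<le> (2 * K) * cnorm A x" if x: "x \<in> carrier A" for x
      using cmod_le[of "\<psi> x"] g_bound[OF x] g_bound[of "scale A \<i> x"] x
      by (simp add: \<psi>_def cnorm_scale)
  qed auto
  moreover have "\<psi> (star A x \<otimes> x) \<in> \<real>\<^sub>\<ge>\<^sub>0" if x: "x \<in> carrier A" for x
    using psi_sq[OF x] f_square[OF x] by (auto intro: order_trans[OF zero_le_power2])
  ultimately have pos: "posf \<psi>" by (simp add: posf_def)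
  moreover have "dominated \<psi> 1 \<phi>"
    unfolding dominated_def
  proof (intro conjI ballI)
    fix x assume x: "x \<in> carrier A"
    then have "(cmod (\<phi> x))\<^sup>2 \<le> (sn \<psi> x)\<^sup>2"
      using psi_sq[OF x] f_square[OF x] pos by (simp add: sn_power2 ip_def)
    then show "cmod (\<phi> x) \<le> 1 * sn \<psi> x"
      using ip_self(2)[OF pos x] power2_le_imp_le by simp
  qed (use \<phi> in auto)
  moreover have "Re (\<psi> \<one>) \<le> (dual_norm A \<phi>)\<^sup>2"
    using psi_sq[of \<one>] f_bound[of \<one>] mult_left_le[OF cnorm_one_le K] by (simp add: K_def)
  ultimately show ?thesis using that by blast
qed

end

section \<open>Arens regularity\<close>

lemma le_if_le_add_mult:
  fixes x y M :: real
  assumes "\<And>d. 0 < d \<Longrightarrow> x \<le> y + d * M"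
  shows "x \<le> y"
proof (rule field_le_epsilon)
  fix e :: real assume e: "0 < e"
  have "x \<le> y + e / (\<bar>M\<bar> + 1) * M" using e by (intro assms) simp
  also have "e / (\<bar>M\<bar> + 1) * M \<le> e / (\<bar>M\<bar> + 1) * (\<bar>M\<bar> + 1)"
    using e by (intro mult_left_mono) auto
  finally show "x \<le> y + e" by simp
qed

context cstar_algebra
begin

section \<open>Module structure of the dual\<close>

abbreviation fadd :: "('a \<Rightarrow> complex) \<Rightarrow> ('a \<Rightarrow> complex) \<Rightarrow> ('a \<Rightarrow> complex)" where
  "fadd \<equiv> functional_add (carrier A)"

abbreviation fscale :: "complex \<Rightarrow> ('a \<Rightarrow> complex) \<Rightarrow> ('a \<Rightarrow> complex)" where
  "fscale \<equiv> functional_scale (carrier A)"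

text \<open>The left module action of the algebra on its dual, companion of the right action
  \<open>dual_act\<close>.\<close>

definition lact :: "'a \<Rightarrow> ('a \<Rightarrow> complex) \<Rightarrow> ('a \<Rightarrow> complex)" where
  "lact a \<phi> = (\<lambda>x\<in>carrier A. \<phi> (x \<otimes> a))"

lemma functional_apply [simp]:
  assumes "x \<in> carrier A"
  shows "fadd \<phi> \<psi> x = \<phi> x + \<psi> x" "fscale c \<phi> x = c * \<phi> x"
    "dual_act A \<phi> a x = \<phi> (a \<otimes> x)" "lact a \<phi> x = \<phi> (x \<otimes> a)"
    "bidual_act A \<Psi> \<phi> x = \<Psi> (dual_act A \<phi> x)"
    "dual_star A \<phi> x = cnj (\<phi> (star A x))"
  using assms
  by (simp_all add: functional_add_def functional_scale_def dual_act_def lact_def bidual_act_def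
      dual_star_def)

lemma functional_extensional [simp]:
  "fadd \<phi> \<psi> \<in> extensional (carrier A)" "fscale c \<phi> \<in> extensional (carrier A)"
  "dual_act A \<phi> a \<in> extensional (carrier A)" "lact a \<phi> \<in> extensional (carrier A)"
  "bidual_act A \<Psi> \<phi> \<in> extensional (carrier A)" "dual_star A \<phi> \<in> extensional (carrier A)"
  by (simp_all add: functional_add_def functional_scale_def dual_act_def lact_def bidual_act_def
      dual_star_def)

lemma fadd_dual [simp, intro]:
  assumes "\<phi> \<in> dual A" "\<psi> \<in> dual A"
  shows "fadd \<phi> \<psi> \<in> dual A"
proof (rule dualI)
  show "cmod (fadd \<phi> \<psi> x) \<le> (dual_norm A \<phi> + dual_norm A \<psi>) * cnorm A x"
    if "x \<in> carrier A" for x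
    using norm_triangle_ineq[of "\<phi> x" "\<psi> x"] dual_norm_bound[OF assms(1) that]
      dual_norm_bound[OF assms(2) that] that by (simp add: distrib_right)
qed (use assms in \<open>auto simp: dual_add dual_scale algebra_simps\<close>)

lemma fscale_dual [simp, intro]:
  assumes "\<phi> \<in> dual A"
  shows "fscale c \<phi> \<in> dual A"
proof (rule dualI)
  show "cmod (fscale c \<phi> x) \<le> (cmod c * dual_norm A \<phi>) * cnorm A x"
    if "x \<in> carrier A" for x
    using dual_norm_bound[OF assms(1) that] that
    by (simp add: norm_mult mult.assoc mult_left_mono)
qed (use assms in \<open>auto simp: dual_add dual_scale algebra_simps\<close>)

lemma norm_dual_act_le:
  assumes "\<phi> \<in> dual A" "a \<in> carrier A" "x \<in> carrier A"
  shows "cmod (\<phi> (a \<otimes> x)) \<le> dual_norm A \<phi> * cnorm A a * cnorm A x"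
    and "cmod (\<phi> (x \<otimes> a)) \<le> dual_norm A \<phi> * cnorm A a * cnorm A x"
  using order_trans[OF dual_norm_bound[of \<phi> "a \<otimes> x"]
      mult_left_mono[OF cnorm_mult[of a x] dual_norm_nonneg[of \<phi>]]]
    order_trans[OF dual_norm_bound[of \<phi> "x \<otimes> a"]
      mult_left_mono[OF cnorm_mult[of x a] dual_norm_nonneg[of \<phi>]]] assms
  by (simp_all add: mult_ac)

lemma dual_act_dual [simp, intro]:
  assumes "\<phi> \<in> dual A" "a \<in> carrier A"
  shows "dual_act A \<phi> a \<in> dual A"
  by (rule dualI[where C = "dual_norm A \<phi> * cnorm A a"])
    (use assms norm_dual_act_le in
      \<open>auto simp: dual_add dual_scale r_distr scale_mult_right\<close>)

lemma lact_dual [simp, intro]: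
  assumes "\<phi> \<in> dual A" "a \<in> carrier A"
  shows "lact a \<phi> \<in> dual A"
  by (rule dualI[where C = "dual_norm A \<phi> * cnorm A a"])
    (use assms norm_dual_act_le in
      \<open>auto simp: dual_add dual_scale l_distr scale_mult_left\<close>)

lemma norm_dual_star_le:
  assumes "\<phi> \<in> dual A" "x \<in> carrier A"
  shows "cmod (\<phi> (star A x)) \<le> dual_norm A \<phi> * cnorm A x"
  using dual_norm_bound[OF assms(1), of "star A x"] assms by (simp add: cnorm_star)

lemma dual_star_dual [simp, intro]:
  assumes "\<phi> \<in> dual A"
  shows "dual_star A \<phi> \<in> dual A"
  by (rule dualI[where C = "dual_norm A \<phi>"])
    (use assms norm_dual_star_le in \<open>auto simp: dual_add dual_scale star_add star_scale\<close>)

lemma dual_star_star [simp]: "\<phi> \<in> dual A \<Longrightarrow> dual_star A (dual_star A \<phi>) = \<phi>"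
  by (rule dual_eqI) auto

lemma dual_norm_dual_act_le:
  assumes "\<phi> \<in> dual A" "a \<in> carrier A"
  shows "dual_norm A (dual_act A \<phi> a) \<le> dual_norm A \<phi> * cnorm A a"
  by (rule dual_norm_le)
    (use assms norm_dual_act_le dual_norm_nonneg cnorm_nonneg in auto)

lemma dual_norm_dual_star_le:
  assumes "\<phi> \<in> dual A"
  shows "dual_norm A (dual_star A \<phi>) \<le> dual_norm A \<phi>"
  by (rule dual_norm_le)
    (use assms norm_dual_star_le dual_norm_nonneg in auto)

section \<open>The bidual as an algebra with involution\<close>

abbreviation bd :: "(('a \<Rightarrow> complex) \<Rightarrow> complex) set" where
  "bd \<equiv> carrier (bidual A)"

lemma bidual_eqs:
  "bd = bounded_functionals (dual A) fadd fscale (dual_norm A)"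
  "\<Phi> \<otimes>\<^bsub>bidual A\<^esub> \<Psi> = (\<lambda>\<phi>\<in>dual A. \<Phi> (bidual_act A \<Psi> \<phi>))"
  "\<one>\<^bsub>bidual A\<^esub> = (\<lambda>\<phi>\<in>dual A. \<phi> \<one>)"
  "star (bidual A) \<Phi> = (\<lambda>\<phi>\<in>dual A. cnj (\<Phi> (dual_star A \<phi>)))"
  by (simp_all add: bidual_def)

lemma bidual_add: "\<lbrakk>\<Psi> \<in> bd; \<phi> \<in> dual A; \<psi> \<in> dual A\<rbrakk> \<Longrightarrow> \<Psi> (fadd \<phi> \<psi>) = \<Psi> \<phi> + \<Psi> \<psi>"
  and bidual_scale: "\<lbrakk>\<Psi> \<in> bd; \<phi> \<in> dual A\<rbrakk> \<Longrightarrow> \<Psi> (fscale c \<phi>) = c * \<Psi> \<phi>"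
  and bidual_extensional: "\<Psi> \<in> bd \<Longrightarrow> \<Psi> \<in> extensional (dual A)"
  unfolding bidual_eqs(1) bounded_functionals_def by auto

lemma bidualI:
  assumes "\<Psi> \<in> extensional (dual A)"
    and "\<And>\<phi> \<psi>. \<lbrakk>\<phi> \<in> dual A; \<psi> \<in> dual A\<rbrakk> \<Longrightarrow> \<Psi> (fadd \<phi> \<psi>) = \<Psi> \<phi> + \<Psi> \<psi>"
    and "\<And>c \<phi>. \<phi> \<in> dual A \<Longrightarrow> \<Psi> (fscale c \<phi>) = c * \<Psi> \<phi>"
    and "\<And>\<phi>. \<phi> \<in> dual A \<Longrightarrow> cmod (\<Psi> \<phi>) \<le> C * dual_norm A \<phi>"
  shows "\<Psi> \<in> bd"
  using assms unfolding bidual_eqs(1) bounded_functionals_def by blast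

lemma bidual_bound:
  assumes "\<Psi> \<in> bd"
  obtains K where "0 \<le> K" "\<And>\<phi>. \<phi> \<in> dual A \<Longrightarrow> cmod (\<Psi> \<phi>) \<le> K * dual_norm A \<phi>"
proof -
  obtain C where C: "\<And>\<phi>. \<phi> \<in> dual A \<Longrightarrow> cmod (\<Psi> \<phi>) \<le> C * dual_norm A \<phi>"
    using assms unfolding bidual_eqs(1) bounded_functionals_def by blast
  have "cmod (\<Psi> \<phi>) \<le> \<bar>C\<bar> * dual_norm A \<phi>" if "\<phi> \<in> dual A" for \<phi>
    using C[OF that] dual_norm_nonneg[OF that] by (meson abs_ge_self mult_right_mono order_trans)
  then show ?thesis using that[of "\<bar>C\<bar>"] by simp
qed

text \<open>Later estimates are pointwise on the algebra; in this form they pass through \<Psi>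
  without any dual norm being computed.\<close>

lemma bidual_bound_pointwise:
  assumes "\<Psi> \<in> bd"
  obtains K where "0 \<le> K" "\<And>\<phi> \<theta> e. \<lbrakk>\<phi> \<in> dual A; \<theta> \<in> dual A; 0 \<le> e;
      \<And>x. x \<in> carrier A \<Longrightarrow> cmod (\<phi> x - \<theta> x) \<le> e * cnorm A x\<rbrakk> \<Longrightarrow> cmod (\<Psi> \<phi> - \<Psi> \<theta>) \<le> K * e"
    "\<And>\<phi> e. \<lbrakk>\<phi> \<in> dual A; 0 \<le> e;
      \<And>x. x \<in> carrier A \<Longrightarrow> cmod (\<phi> x) \<le> e * cnorm A x\<rbrakk> \<Longrightarrow> cmod (\<Psi> \<phi>) \<le> K * e"
proof -
  obtain K where K: "0 \<le> K" "\<And>\<phi>. \<phi> \<in> dual A \<Longrightarrow> cmod (\<Psi> \<phi>) \<le> K * dual_norm A \<phi>"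
    using bidual_bound[OF assms] by blast
  have 1: "cmod (\<Psi> \<phi>) \<le> K * e"
    if "\<phi> \<in> dual A" "0 \<le> e" "\<And>x. x \<in> carrier A \<Longrightarrow> cmod (\<phi> x) \<le> e * cnorm A x" for \<phi> e
    by (rule order_trans[OF K(2)[OF that(1)] mult_left_mono[OF dual_norm_le[OF that] K(1)]])
  have 2: "cmod (\<Psi> \<phi> - \<Psi> \<theta>) \<le> K * e"
    if "\<phi> \<in> dual A" "\<theta> \<in> dual A" "0 \<le> e"
      "\<And>x. x \<in> carrier A \<Longrightarrow> cmod (\<phi> x - \<theta> x) \<le> e * cnorm A x" for \<phi> \<theta> e
    using 1[of "fadd \<phi> (fscale (- 1) \<theta>)" e] that assms by (simp add: bidual_add bidual_scale)
  show ?thesis using that[OF K(1) 2 1] by blast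
qed

lemma dual_act_add:
  assumes "\<phi> \<in> dual A" "\<psi> \<in> dual A" "a \<in> carrier A" "b \<in> carrier A"
  shows "dual_act A \<phi> (a \<oplus> b) = fadd (dual_act A \<phi> a) (dual_act A \<phi> b)"
    and "dual_act A \<phi> (scale A c a) = fscale c (dual_act A \<phi> a)"
    and "dual_act A (fadd \<phi> \<psi>) a = fadd (dual_act A \<phi> a) (dual_act A \<psi> a)"
    and "dual_act A (fscale c \<phi>) a = fscale c (dual_act A \<phi> a)"
    and "dual_act A (dual_act A \<phi> a) b = dual_act A \<phi> (a \<otimes> b)"
  by (rule dual_eqI; use assms in
      \<open>simp add: l_distr scale_mult_left dual_add dual_scale m_assoc\<close>)+

lemma bidual_act_dual [simp, intro]:
  assumes "\<Psi> \<in> bd" "\<phi> \<in> dual A"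
  shows "bidual_act A \<Psi> \<phi> \<in> dual A"
proof -
  obtain K where K: "0 \<le> K" "\<And>\<phi>. \<phi> \<in> dual A \<Longrightarrow> cmod (\<Psi> \<phi>) \<le> K * dual_norm A \<phi>"
    using bidual_bound[OF assms(1)] by blast
  show ?thesis
  proof (rule dualI)
    show "cmod (bidual_act A \<Psi> \<phi> a) \<le> (K * dual_norm A \<phi>) * cnorm A a" if "a \<in> carrier A" for a
      using order_trans[OF K(2) mult_left_mono[OF dual_norm_dual_act_le K(1)]] assms that
      by (simp add: mult.assoc)
  qed (use assms in \<open>auto simp: dual_act_add bidual_add bidual_scale\<close>)
qed

lemma dual_norm_bidual_act_le:
  assumes "\<Psi> \<in> bd"
  obtains K where "0 \<le> K" "\<And>\<phi>. \<phi> \<in> dual A \<Longrightarrow> dual_norm A (bidual_act A \<Psi> \<phi>) \<le> K * dual_norm A \<phi>"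
proof -
  obtain K where K: "0 \<le> K" "\<And>\<phi>. \<phi> \<in> dual A \<Longrightarrow> cmod (\<Psi> \<phi>) \<le> K * dual_norm A \<phi>"
    using bidual_bound[OF assms(1)] by blast
  have "dual_norm A (bidual_act A \<Psi> \<phi>) \<le> K * dual_norm A \<phi>" if \<phi>: "\<phi> \<in> dual A" for \<phi>
  proof (rule dual_norm_le)
    show "cmod (bidual_act A \<Psi> \<phi> a) \<le> (K * dual_norm A \<phi>) * cnorm A a" if "a \<in> carrier A" for a
      using order_trans[OF K(2) mult_left_mono[OF dual_norm_dual_act_le K(1)]] \<phi> that
      by (simp add: mult.assoc)
  qed (use K \<phi> assms dual_norm_nonneg in auto)
  then show ?thesis using that K(1) by blast
qed

lemma bidual_act_linear:
  assumes "\<Psi> \<in> bd" "\<phi> \<in> dual A" "\<psi> \<in> dual A"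
  shows "bidual_act A \<Psi> (fadd \<phi> \<psi>) = fadd (bidual_act A \<Psi> \<phi>) (bidual_act A \<Psi> \<psi>)"
    and "bidual_act A \<Psi> (fscale c \<phi>) = fscale c (bidual_act A \<Psi> \<phi>)"
  by (rule dual_eqI; use assms in \<open>simp add: dual_act_add bidual_add bidual_scale\<close>)+

lemma bidual_mult_closed [simp, intro]:
  assumes "\<Phi> \<in> bd" "\<Psi> \<in> bd"
  shows "\<Phi> \<otimes>\<^bsub>bidual A\<^esub> \<Psi> \<in> bd"
proof -
  obtain K where K: "0 \<le> K" "\<And>\<phi>. \<phi> \<in> dual A \<Longrightarrow> cmod (\<Phi> \<phi>) \<le> K * dual_norm A \<phi>"
    using bidual_bound[OF assms(1)] by blast
  obtain L where L: "0 \<le> L"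
      "\<And>\<phi>. \<phi> \<in> dual A \<Longrightarrow> dual_norm A (bidual_act A \<Psi> \<phi>) \<le> L * dual_norm A \<phi>"
    using dual_norm_bidual_act_le[OF assms(2)] by blast
  show ?thesis
  proof (rule bidualI)
    show "cmod ((\<Phi> \<otimes>\<^bsub>bidual A\<^esub> \<Psi>) \<phi>) \<le> (K * L) * dual_norm A \<phi>" if "\<phi> \<in> dual A" for \<phi>
      using order_trans[OF K(2) mult_left_mono[OF L(2) K(1)]] assms that
      by (simp add: bidual_eqs mult.assoc)
  qed (use assms in \<open>auto simp: bidual_eqs(2) bidual_act_linear bidual_add bidual_scale\<close>)
qed

lemma dual_star_linear:
  assumes "\<phi> \<in> dual A" "\<psi> \<in> dual A"
  shows "dual_star A (fadd \<phi> \<psi>) = fadd (dual_star A \<phi>) (dual_star A \<psi>)"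
    and "dual_star A (fscale c \<phi>) = fscale (cnj c) (dual_star A \<phi>)"
  by (rule dual_eqI; use assms in simp)+

lemma bidual_star_closed [simp, intro]:
  assumes "\<Phi> \<in> bd"
  shows "star (bidual A) \<Phi> \<in> bd"
proof -
  obtain K where K: "0 \<le> K" "\<And>\<phi>. \<phi> \<in> dual A \<Longrightarrow> cmod (\<Phi> \<phi>) \<le> K * dual_norm A \<phi>"
    using bidual_bound[OF assms(1)] by blast
  show ?thesis
  proof (rule bidualI)
    show "cmod (star (bidual A) \<Phi> \<phi>) \<le> K * dual_norm A \<phi>" if "\<phi> \<in> dual A" for \<phi>
      using order_trans[OF K(2) mult_left_mono[OF dual_norm_dual_star_le K(1)]] that
      by (simp add: bidual_eqs)
  qed (use assms in \<open>auto simp: bidual_eqs(4) dual_star_linear bidual_add bidual_scale\<close>)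
qed

lemma bidual_one_closed [simp, intro]: "\<one>\<^bsub>bidual A\<^esub> \<in> bd"
proof (rule bidualI)
  show "cmod (\<one>\<^bsub>bidual A\<^esub> \<phi>) \<le> cnorm A \<one> * dual_norm A \<phi>" if "\<phi> \<in> dual A" for \<phi>
    using dual_norm_bound[OF that, of \<one>] that by (simp add: bidual_eqs mult.commute)
qed (auto simp: bidual_eqs)

lemma bidual_eqI:
  "\<lbrakk>\<Phi> \<in> bd; \<Psi> \<in> bd; \<And>\<phi>. \<phi> \<in> dual A \<Longrightarrow> \<Phi> \<phi> = \<Psi> \<phi>\<rbrakk> \<Longrightarrow> \<Phi> = \<Psi>"
  using bidual_extensional extensionalityI by blast

text \<open>The action of \<Omega> commutes with the right action of the algebra. Therefore acting
  on the dual by \<Omega> and then by \<Psi> is acting by their product.\<close>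

lemma bidual_mult_assoc:
  assumes "\<Phi> \<in> bd" "\<Psi> \<in> bd" "\<Omega> \<in> bd"
  shows "(\<Phi> \<otimes>\<^bsub>bidual A\<^esub> \<Psi>) \<otimes>\<^bsub>bidual A\<^esub> \<Omega> = \<Phi> \<otimes>\<^bsub>bidual A\<^esub> (\<Psi> \<otimes>\<^bsub>bidual A\<^esub> \<Omega>)"
proof (rule bidual_eqI)
  fix \<phi> assume \<phi>: "\<phi> \<in> dual A"
  have "dual_act A (bidual_act A \<Omega> \<phi>) a = bidual_act A \<Omega> (dual_act A \<phi> a)"
    if "a \<in> carrier A" for a
    by (rule dual_eqI) (use assms \<phi> that in \<open>auto simp: dual_act_add\<close>)
  then have "bidual_act A \<Psi> (bidual_act A \<Omega> \<phi>) = bidual_act A (\<Psi> \<otimes>\<^bsub>bidual A\<^esub> \<Omega>) \<phi>"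
    using assms \<phi> by (intro dual_eqI bidual_act_dual bidual_mult_closed) (auto simp: bidual_eqs(2))
  then show "((\<Phi> \<otimes>\<^bsub>bidual A\<^esub> \<Psi>) \<otimes>\<^bsub>bidual A\<^esub> \<Omega>) \<phi>
      = (\<Phi> \<otimes>\<^bsub>bidual A\<^esub> (\<Psi> \<otimes>\<^bsub>bidual A\<^esub> \<Omega>)) \<phi>"
    using assms \<phi> by (simp add: bidual_eqs(2))
qed (use assms in auto)

section \<open>Elements of the bidual on dominated functionals\<close>

definition vec :: "('a \<Rightarrow> complex) \<Rightarrow> 'a \<Rightarrow> ('a \<Rightarrow> complex)" where
  "vec \<psi> a = dual_act A \<psi> (star A a)"

lemma vec_apply [simp]: "x \<in> carrier A \<Longrightarrow> vec \<psi> a x = ip \<psi> a x"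
  by (simp add: vec_def ip_def)

lemma dominated_vec: "\<lbrakk>posf \<psi>; a \<in> carrier A\<rbrakk> \<Longrightarrow> dominated \<psi> (sn \<psi> a) (vec \<psi> a)"
  using ip_le ip_self(2) by (auto simp: dominated_def posf_dual vec_def ip_def)

lemma dominated_dual: "dominated \<psi> C \<xi> \<Longrightarrow> \<xi> \<in> dual A"
  by (simp add: dominated_def)

lemma dominated_pointwise:
  assumes "posf \<psi>" "dominated \<psi> C \<xi>" "x \<in> carrier A"
  shows "cmod (\<xi> x) \<le> (C * sn \<psi> \<one>) * cnorm A x"
proof -
  have "cmod (\<xi> x) \<le> C * sn \<psi> x" "0 \<le> C" using assms by (auto simp: dominated_def)
  moreover have "C * sn \<psi> x \<le> C * (cnorm A x * sn \<psi> \<one>)"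
    using sn_le[OF assms(1,3)] \<open>0 \<le> C\<close> by (intro mult_left_mono)
  ultimately show ?thesis by (simp add: mult_ac)
qed

text \<open>In the GNS space of \<psi>, \<Psi> moves the cyclic vector to a vector that some c of
  the algebra approximates. So \<Psi> acts on all functionals dominated by \<psi> nearly as
  evaluation at c, with an error proportional to C. The c comes from \<open>riesz_approx\<close> for
  the functional f, which is itself dominated.\<close>

lemma bidual_riesz:
  assumes \<Psi>: "\<Psi> \<in> bd" and \<psi>: "posf \<psi>" and e: "0 < e"
  obtains c where "c \<in> carrier A" "\<And>C \<xi>. dominated \<psi> C \<xi> \<Longrightarrow> cmod (\<Psi> \<xi> - \<xi> c) \<le> e * C"
proof -
  have d: "\<psi> \<in> dual A" using \<psi> by (rule posf_dual)
  obtain K where K: "0 \<le> K" "\<And>\<phi> \<theta> e. \<lbrakk>\<phi> \<in> dual A; \<theta> \<in> dual A; 0 \<le> e;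
      \<And>x. x \<in> carrier A \<Longrightarrow> cmod (\<phi> x - \<theta> x) \<le> e * cnorm A x\<rbrakk> \<Longrightarrow> cmod (\<Psi> \<phi> - \<Psi> \<theta>) \<le> K * e"
    "\<And>\<phi> e. \<lbrakk>\<phi> \<in> dual A; 0 \<le> e;
      \<And>x. x \<in> carrier A \<Longrightarrow> cmod (\<phi> x) \<le> e * cnorm A x\<rbrakk> \<Longrightarrow> cmod (\<Psi> \<phi>) \<le> K * e"
    using bidual_bound_pointwise[OF \<Psi>] by blast
  have s1: "0 \<le> sn \<psi> \<one>" using ip_self(2)[OF \<psi>] by simp
  \<comment> \<open>\<open>vec \<psi> a\<close> is conjugate-linear in a; the conjugation makes f
    linear.\<close>
  define f where "f = (\<lambda>a\<in>carrier A. cnj (\<Psi> (vec \<psi> a)))"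
  have f_bound: "cmod (f a) \<le> (K * sn \<psi> \<one>) * sn \<psi> a" if a: "a \<in> carrier A" for a
    using K(3)[OF _ _ dominated_pointwise[OF \<psi> dominated_vec[OF \<psi> a]]] s1 ip_self(2)[OF \<psi> a] a d
    by (simp add: f_def vec_def mult_ac)
  have "f \<in> dual A"
  proof (rule dualI[where C = "K * sn \<psi> \<one> * sn \<psi> \<one>"])
    show "f \<in> extensional (carrier A)" by (simp add: f_def)
    show "f (x \<oplus> y) = f x + f y" if "x \<in> carrier A" "y \<in> carrier A" for x y
      using that d \<Psi> by (simp add: f_def vec_def star_add dual_act_add bidual_add)
    show "f (scale A c x) = c * f x" if "x \<in> carrier A" for c x
      using that d \<Psi> by (simp add: f_def vec_def star_scale dual_act_add bidual_scale)
    show "cmod (f x) \<le> K * sn \<psi> \<one> * sn \<psi> \<one> * cnorm A x" if x: "x \<in> carrier A" for x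
      using order_trans[OF f_bound[OF x] mult_left_mono[OF sn_le[OF \<psi> x]]] K(1) s1
      by (simp add: mult_ac)
  qed
  then have "dominated \<psi> (K * sn \<psi> \<one>) f"
    using f_bound K(1) s1 by (simp add: dominated_def)
  then obtain c where c: "c \<in> carrier A"
    and approx: "\<And>x. x \<in> carrier A \<Longrightarrow> cmod (f x - ip \<psi> c x) \<le> e * sn \<psi> x"
    using riesz_approx[OF \<psi> _ e] by blast
  have vec_approx: "cmod (\<Psi> (vec \<psi> a) - ip \<psi> a c) \<le> e * sn \<psi> a" if a: "a \<in> carrier A" for a
  proof -
    have "f a - ip \<psi> c a = cnj (\<Psi> (vec \<psi> a) - ip \<psi> a c)"
      using a c ip_commute[OF \<psi> a c] by (simp add: f_def)
    then show ?thesis using approx[OF a] by (metis complex_mod_cnj)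
  qed
  have "cmod (\<Psi> \<xi> - \<xi> c) \<le> e * C" if \<xi>: "dominated \<psi> C \<xi>" for C \<xi>
  proof (rule le_if_le_add_mult)
    \<comment> \<open>A general dominated \<xi> is replaced by some \<open>vec \<psi> a\<close> up
      to \<delta>, which tends to 0 while c and e stay fixed.\<close>
    fix \<delta> :: real assume \<delta>: "0 < \<delta>"
    obtain a where a: "a \<in> carrier A"
      and xi_approx: "\<And>x. x \<in> carrier A \<Longrightarrow> cmod (\<xi> x - ip \<psi> a x) \<le> \<delta> * sn \<psi> x"
      using riesz_approx[OF \<psi> \<xi> \<delta>] by blast
    have sa: "sn \<psi> a \<le> C + \<delta>"
      using sn_approximant_le[OF \<psi> \<xi> _ a xi_approx] \<delta> by simp
    have "cmod (\<Psi> \<xi> - \<Psi> (vec \<psi> a)) \<le> K * (\<delta> * sn \<psi> \<one>)"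
    proof (rule K(2))
      fix x assume x: "x \<in> carrier A"
      show "cmod (\<xi> x - vec \<psi> a x) \<le> \<delta> * sn \<psi> \<one> * cnorm A x"
        using order_trans[OF xi_approx[OF x] mult_left_mono[OF sn_le[OF \<psi> x]]] \<delta> x
        by (simp add: mult_ac)
    qed (use \<xi> a d \<delta> s1 in \<open>auto simp: vec_def dominated_dual\<close>)
    moreover have "cmod (\<Psi> (vec \<psi> a) - ip \<psi> a c) \<le> e * (C + \<delta>)"
      using order_trans[OF vec_approx[OF a] mult_left_mono[OF sa]] e by simp
    moreover have "cmod (ip \<psi> a c - \<xi> c) \<le> \<delta> * sn \<psi> c"
      using xi_approx[OF c] by (simp add: norm_minus_commute)
    moreover have "cmod (\<Psi> \<xi> - \<xi> c) \<le> cmod (\<Psi> \<xi> - \<Psi> (vec \<psi> a))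
        + cmod (\<Psi> (vec \<psi> a) - ip \<psi> a c) + cmod (ip \<psi> a c - \<xi> c)"
      using norm_triangle_ineq[of "\<Psi> \<xi> - \<Psi> (vec \<psi> a)" "\<Psi> (vec \<psi> a) - \<xi> c"]
        norm_triangle_ineq[of "\<Psi> (vec \<psi> a) - ip \<psi> a c" "ip \<psi> a c - \<xi> c"] by simp
    ultimately show "cmod (\<Psi> \<xi> - \<xi> c) \<le> e * C + \<delta> * (K * sn \<psi> \<one> + e + sn \<psi> c)"
      by (simp add: algebra_simps)
  qed
  then show ?thesis using that c by blast
qed

lemma dominated_dual_act:
  assumes \<psi>: "posf \<psi>" and \<xi>: "dominated \<psi> C \<xi>" and a: "a \<in> carrier A"
  shows "dominated \<psi> (C * cnorm A a) (dual_act A \<xi> a)"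
  unfolding dominated_def
proof (intro conjI ballI)
  fix x assume x: "x \<in> carrier A"
  have C: "0 \<le> C" "cmod (\<xi> (a \<otimes> x)) \<le> C * sn \<psi> (a \<otimes> x)"
    using \<xi> a x by (auto simp: dominated_def)
  then show "cmod (dual_act A \<xi> a x) \<le> C * cnorm A a * sn \<psi> x"
    using order_trans[OF C(2) mult_left_mono[OF sn_mult_le[OF \<psi> a x] C(1)]] x
    by (simp add: mult_ac)
qed (use assms cnorm_nonneg in \<open>auto simp: dominated_def\<close>)

text \<open>The mirror image of \<open>bidual_act\<close>: the action from which the second Arens
  product is formed.\<close>

definition ract_bidual ::
  "('a \<Rightarrow> complex) \<Rightarrow> (('a \<Rightarrow> complex) \<Rightarrow> complex) \<Rightarrow> ('a \<Rightarrow> complex)" where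
  "ract_bidual \<theta> \<Phi> = (\<lambda>a\<in>carrier A. \<Phi> (lact a \<theta>))"

lemma lact_linear:
  assumes "\<phi> \<in> dual A" "a \<in> carrier A" "b \<in> carrier A"
  shows "lact (a \<oplus> b) \<phi> = fadd (lact a \<phi>) (lact b \<phi>)"
    and "lact (scale A c a) \<phi> = fscale c (lact a \<phi>)"
  by (rule dual_eqI; use assms in
      \<open>simp add: r_distr scale_mult_right dual_add dual_scale\<close>)+

text \<open>The same \<psi> still dominates: by \<open>sn_mult_le\<close> the left translate of
  \<theta> by a has norm at most C times \<open>sn \<psi> a\<close>, and \<Phi> is bounded.\<close>

lemma dominated_ract_bidual:
  assumes \<psi>: "posf \<psi>" and \<theta>: "dominated \<psi> C \<theta>" and \<Phi>: "\<Phi> \<in> bd"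
  obtains K where "0 \<le> K" "dominated \<psi> K (ract_bidual \<theta> \<Phi>)"
proof -
  have d: "\<theta> \<in> dual A" "0 \<le> C" using \<theta> by (auto simp: dominated_def)
  obtain K where K: "0 \<le> K" "\<And>\<phi> \<theta> e. \<lbrakk>\<phi> \<in> dual A; \<theta> \<in> dual A; 0 \<le> e;
      \<And>x. x \<in> carrier A \<Longrightarrow> cmod (\<phi> x - \<theta> x) \<le> e * cnorm A x\<rbrakk> \<Longrightarrow> cmod (\<Phi> \<phi> - \<Phi> \<theta>) \<le> K * e"
    "\<And>\<phi> e. \<lbrakk>\<phi> \<in> dual A; 0 \<le> e;
      \<And>x. x \<in> carrier A \<Longrightarrow> cmod (\<phi> x) \<le> e * cnorm A x\<rbrakk> \<Longrightarrow> cmod (\<Phi> \<phi>) \<le> K * e"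
    using bidual_bound_pointwise[OF \<Phi>] by blast
  have bound: "cmod (ract_bidual \<theta> \<Phi> a) \<le> (K * C) * sn \<psi> a" if a: "a \<in> carrier A" for a
  proof -
    have "cmod (\<Phi> (lact a \<theta>)) \<le> K * (C * sn \<psi> a)"
    proof (rule K(3))
      fix x assume x: "x \<in> carrier A"
      have "cmod (\<theta> (x \<otimes> a)) \<le> C * sn \<psi> (x \<otimes> a)"
        using \<theta> x a by (simp add: dominated_def)
      also have "\<dots> \<le> C * (cnorm A x * sn \<psi> a)"
        using sn_mult_le[OF \<psi> x a] d by (intro mult_left_mono)
      finally show "cmod (lact a \<theta> x) \<le> C * sn \<psi> a * cnorm A x"
        using x by (simp add: mult_ac)
    qed (use d a ip_self(2)[OF \<psi> a] in auto)
    then show ?thesis using a by (simp add: ract_bidual_def mult_ac)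
  qed
  have "ract_bidual \<theta> \<Phi> \<in> dual A"
  proof (rule dualI[where C = "K * C * sn \<psi> \<one>"])
    show "cmod (ract_bidual \<theta> \<Phi> x) \<le> K * C * sn \<psi> \<one> * cnorm A x" if x: "x \<in> carrier A" for x
      using order_trans[OF bound[OF x] mult_left_mono[OF sn_le[OF \<psi> x]]] K(1) d
      by (simp add: mult_ac)
  qed (use d \<Phi> in \<open>auto simp: ract_bidual_def lact_linear bidual_add bidual_scale\<close>)
  then show ?thesis using that[of "K * C"] bound K(1) d by (simp add: dominated_def)
qed

end

section \<open>Regularity of the Arens product\<close>

context column_cstar_algebra
begin

text \<open>Consequently a norm-closed subspace of the dual that is invariant under
  \<open>lact\<close> is invariant under the whole bidual.\<close>

lemma bidual_act_approx:
  assumes \<Psi>: "\<Psi> \<in> bd" and \<theta>: "\<theta> \<in> dual A" and e: "0 < e"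
  obtains c where "c \<in> carrier A"
    "\<And>x. x \<in> carrier A \<Longrightarrow> cmod (bidual_act A \<Psi> \<theta> x - lact c \<theta> x) \<le> e * cnorm A x"
proof -
  obtain \<psi> where \<psi>: "posf \<psi>" "dominated \<psi> 1 \<theta>" using dominated_by_positive[OF \<theta>] by blast
  obtain c where c: "c \<in> carrier A"
    "\<And>C \<xi>. dominated \<psi> C \<xi> \<Longrightarrow> cmod (\<Psi> \<xi> - \<xi> c) \<le> e * C"
    using bidual_riesz[OF \<Psi> \<psi>(1) e] by blast
  show ?thesis
  proof (rule that[OF c(1)])
    fix x assume x: "x \<in> carrier A"
    show "cmod (bidual_act A \<Psi> \<theta> x - lact c \<theta> x) \<le> e * cnorm A x"
      using c(2)[OF dominated_dual_act[OF \<psi> x]] x c(1) by simp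
  qed
qed

lemma ract_bidual_dual:
  assumes "\<Phi> \<in> bd" "\<theta> \<in> dual A"
  shows "ract_bidual \<theta> \<Phi> \<in> dual A"
proof -
  obtain \<psi> where \<psi>: "posf \<psi>" "dominated \<psi> 1 \<theta>"
    using dominated_by_positive[OF assms(2)] by blast
  then obtain K where "dominated \<psi> K (ract_bidual \<theta> \<Phi>)"
    using dominated_ract_bidual[OF \<psi> assms(1)] by blast
  then show ?thesis by (rule dominated_dual)
qed

text \<open>With c approximating \<Psi> on functionals dominated by \<psi>, both sides are within a
  multiple of e of \<open>\<Phi> (lact c \<theta>)\<close>. Domination makes the replacement
  uniform, so the two limits may be interchanged.\<close>

lemma arens_regular:
  assumes \<Phi>: "\<Phi> \<in> bd" and \<Psi>: "\<Psi> \<in> bd" and \<theta>: "\<theta> \<in> dual A"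
  shows "\<Phi> (bidual_act A \<Psi> \<theta>) = \<Psi> (ract_bidual \<theta> \<Phi>)"
proof -
  obtain \<psi> where \<psi>: "posf \<psi>" "dominated \<psi> 1 \<theta>" using dominated_by_positive[OF \<theta>] by blast
  obtain L where L: "0 \<le> L" "dominated \<psi> L (ract_bidual \<theta> \<Phi>)"
    using dominated_ract_bidual[OF \<psi> \<Phi>] by blast
  obtain K where K: "0 \<le> K" "\<And>\<phi> \<theta> e. \<lbrakk>\<phi> \<in> dual A; \<theta> \<in> dual A; 0 \<le> e;
      \<And>x. x \<in> carrier A \<Longrightarrow> cmod (\<phi> x - \<theta> x) \<le> e * cnorm A x\<rbrakk> \<Longrightarrow> cmod (\<Phi> \<phi> - \<Phi> \<theta>) \<le> K * e"
    "\<And>\<phi> e. \<lbrakk>\<phi> \<in> dual A; 0 \<le> e;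
      \<And>x. x \<in> carrier A \<Longrightarrow> cmod (\<phi> x) \<le> e * cnorm A x\<rbrakk> \<Longrightarrow> cmod (\<Phi> \<phi>) \<le> K * e"
    using bidual_bound_pointwise[OF \<Phi>] by blast
  have "cmod (\<Phi> (bidual_act A \<Psi> \<theta>) - \<Psi> (ract_bidual \<theta> \<Phi>)) \<le> 0"
  proof (rule le_if_le_add_mult)
    fix e :: real assume e: "0 < e"
    obtain c where c: "c \<in> carrier A"
      "\<And>C \<xi>. dominated \<psi> C \<xi> \<Longrightarrow> cmod (\<Psi> \<xi> - \<xi> c) \<le> e * C"
      using bidual_riesz[OF \<Psi> \<psi>(1) e] by blast
    have "cmod (\<Phi> (bidual_act A \<Psi> \<theta>) - \<Phi> (lact c \<theta>)) \<le> K * e"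
      using c(2)[OF dominated_dual_act[OF \<psi>]] \<Psi> \<theta> c(1) e by (intro K(2)) auto
    moreover have "cmod (\<Psi> (ract_bidual \<theta> \<Phi>) - \<Phi> (lact c \<theta>)) \<le> e * L"
      using c(2)[OF L(2)] c(1) by (simp add: ract_bidual_def)
    ultimately show "cmod (\<Phi> (bidual_act A \<Psi> \<theta>) - \<Psi> (ract_bidual \<theta> \<Phi>)) \<le> 0 + e * (K + L)"
      using norm_triangle_ineq4[of "\<Phi> (bidual_act A \<Psi> \<theta>) - \<Phi> (lact c \<theta>)"
          "\<Psi> (ract_bidual \<theta> \<Phi>) - \<Phi> (lact c \<theta>)"] by (simp add: algebra_simps)
  qed
  then show ?thesis by simp
qed

text \<open>The adjoint turns a first Arens product into a second Arens product of the adjoints in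
  reverse order; regularity identifies the two products.\<close>

lemma bidual_star_mult:
  assumes \<Phi>: "\<Phi> \<in> bd" and \<Psi>: "\<Psi> \<in> bd"
  shows "star (bidual A) (\<Phi> \<otimes>\<^bsub>bidual A\<^esub> \<Psi>)
    = star (bidual A) \<Psi> \<otimes>\<^bsub>bidual A\<^esub> star (bidual A) \<Phi>"
proof (rule bidual_eqI)
  fix \<phi> assume \<phi>: "\<phi> \<in> dual A"
  let ?\<xi> = "bidual_act A (star (bidual A) \<Phi>) \<phi>"
  have \<xi>: "?\<xi> \<in> dual A" using \<phi> \<Phi> by auto
  have *: "dual_star A (dual_act A \<phi> (star A a)) = lact a (dual_star A \<phi>)"
    if "a \<in> carrier A" for a
    by (rule dual_eqI) (use \<phi> that in \<open>auto simp: star_mult\<close>)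
  have "dual_star A ?\<xi> = ract_bidual (dual_star A \<phi>) \<Phi>"
  proof (rule dual_eqI)
    show "ract_bidual (dual_star A \<phi>) \<Phi> \<in> dual A"
      using \<phi> \<Phi> by (intro ract_bidual_dual) auto
    show "dual_star A ?\<xi> a = ract_bidual (dual_star A \<phi>) \<Phi> a" if "a \<in> carrier A" for a
      using * \<phi> that by (simp add: ract_bidual_def bidual_eqs(4))
  qed (use \<xi> in auto)
  then have "(star (bidual A) \<Psi> \<otimes>\<^bsub>bidual A\<^esub> star (bidual A) \<Phi>) \<phi>
      = cnj (\<Psi> (ract_bidual (dual_star A \<phi>) \<Phi>))"
    using \<phi> \<xi> by (simp add: bidual_eqs(2) bidual_eqs(4)[of \<Psi>])
  also have "\<dots> = cnj (\<Phi> (bidual_act A \<Psi> (dual_star A \<phi>)))"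
    using arens_regular[OF \<Phi> \<Psi> dual_star_dual[OF \<phi>]] by simp
  also have "\<dots> = star (bidual A) (\<Phi> \<otimes>\<^bsub>bidual A\<^esub> \<Psi>) \<phi>"
    using \<phi> by (simp add: bidual_eqs(4)[of "\<Phi> \<otimes>\<^bsub>bidual A\<^esub> \<Psi>"]) (simp add: bidual_eqs(2))
  finally show "star (bidual A) (\<Phi> \<otimes>\<^bsub>bidual A\<^esub> \<Psi>) \<phi>
    = (star (bidual A) \<Psi> \<otimes>\<^bsub>bidual A\<^esub> star (bidual A) \<Phi>) \<phi>" ..
qed (use assms in auto)

end

section \<open>Projections onto invariant subspaces of the dual\<close>

lemma inverse_Suc_tendsto: "(\<lambda>n. c / (real n + 1)) \<longlonglongrightarrow> 0"
proof -
  have "(\<lambda>n. c * inverse (real (Suc n))) \<longlonglongrightarrow> c * 0"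
    by (intro tendsto_intros LIMSEQ_inverse_real_of_nat)
  then show ?thesis by (simp add: divide_inverse add.commute)
qed

section \<open>Cauchy sequences in place of GNS vectors\<close>

context cstar_algebra
begin

text \<open>The parallelogram law for x - y and x - z; it makes near-minimisers of a distance close
  to each other.\<close>

lemma sn_midpoint:
  assumes \<psi>: "posf \<psi>" and xyz: "x \<in> carrier A" "y \<in> carrier A" "z \<in> carrier A"
  shows "(sn \<psi> (y \<ominus> z))\<^sup>2 = 2 * (sn \<psi> (x \<ominus> y))\<^sup>2 + 2 * (sn \<psi> (x \<ominus> z))\<^sup>2
    - 4 * (sn \<psi> (x \<ominus> scale A (1 / 2) (y \<oplus> z)))\<^sup>2"
  using assms
  by (simp add: sn_diff_power2 sn_scale sn_add_power2 ip_linear posf_dual power_mult_distrib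
      power_divide norm_divide algebra_simps)

text \<open>Testing two approximations of \<xi> on the difference of their vectors bounds its
  seminorm by the sum of the two tolerances, hence the 2.\<close>

lemma riesz_sequence:
  assumes \<psi>: "posf \<psi>" and \<xi>: "dominated \<psi> C \<xi>"
  obtains a where "\<And>n::nat. a n \<in> carrier A"
    "\<And>n x. x \<in> carrier A \<Longrightarrow> cmod (\<xi> x - ip \<psi> (a n) x) \<le> 1 / (real n + 1) * sn \<psi> x"
    "\<And>n. sn \<psi> (a n) \<le> C + 1"
    "\<And>m n. n \<le> m \<Longrightarrow> sn \<psi> (a m \<ominus> a n) \<le> 2 / (real n + 1)"
proof -
  have "\<exists>a\<in>carrier A. \<forall>x\<in>carrier A. cmod (\<xi> x - ip \<psi> a x) \<le> 1 / (real n + 1) * sn \<psi> x" for n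
    by (rule riesz_approx[OF \<psi> \<xi>, of "1 / (real n + 1)"]) (simp, blast)
  then obtain a where a: "\<And>n. a n \<in> carrier A"
    and approx: "\<And>n x. x \<in> carrier A \<Longrightarrow> cmod (\<xi> x - ip \<psi> (a n) x) \<le> 1 / (real n + 1) * sn \<psi> x"
    by metis
  have bound: "sn \<psi> (a n) \<le> C + 1" for n
  proof -
    have "sn \<psi> (a n) \<le> C + 1 / (real n + 1)"
      using sn_approximant_le[OF \<psi> \<xi> _ a approx] by simp
    then show ?thesis by (rule order_trans) simp
  qed
  have cauchy: "sn \<psi> (a m \<ominus> a n) \<le> 2 / (real n + 1)" if nm: "n \<le> m" for m n
  proof -
    define z where "z = a m \<ominus> a n"
    have z: "z \<in> carrier A" using a by (simp add: z_def)
    have "ip \<psi> z z = (\<xi> z - ip \<psi> (a n) z) - (\<xi> z - ip \<psi> (a m) z)"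
      using a z by (simp add: z_def ip_linear posf_dual[OF \<psi>])
    then have "cmod (ip \<psi> z z) \<le> cmod (\<xi> z - ip \<psi> (a n) z) + cmod (\<xi> z - ip \<psi> (a m) z)"
      by (simp only: norm_triangle_ineq4)
    also have "\<dots> \<le> 1 / (real n + 1) * sn \<psi> z + 1 / (real m + 1) * sn \<psi> z"
      using approx[OF z] by (intro add_mono)
    also have "\<dots> \<le> 1 / (real n + 1) * sn \<psi> z + 1 / (real n + 1) * sn \<psi> z"
      using nm ip_self(2)[OF \<psi> z] by (intro add_mono mult_right_mono) (auto simp: frac_le)
    finally have "sn \<psi> z * sn \<psi> z \<le> 2 / (real n + 1) * sn \<psi> z"
      using ip_self[OF \<psi> z] by (simp add: norm_mult power2_eq_square)
    then show ?thesis
      using ip_self(2)[OF \<psi> z] mult_right_le_imp_le[of "sn \<psi> z" "sn \<psi> z" "2 / (real n + 1)"]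
      unfolding z_def[symmetric] by (cases "sn \<psi> z = 0") auto
  qed
  show ?thesis using that[OF a approx bound cauchy] .
qed

text \<open>Converse to \<open>riesz_sequence\<close>: a Cauchy sequence of vectors has a limit in
  the form of a dominated functional, with the same rate \<eta>. Together they let functionals play
  the part of the completion.\<close>

lemma limit_functional:
  assumes \<psi>: "posf \<psi>" and a: "\<And>n::nat. a n \<in> carrier A"
    and cauchy: "\<And>m n. n \<le> m \<Longrightarrow> sn \<psi> (a m \<ominus> a n) \<le> \<eta> n" and \<eta>: "\<eta> \<longlonglongrightarrow> 0"
  shows "\<exists>\<xi> C. dominated \<psi> C \<xi> \<and> (\<forall>x\<in>carrier A. (\<lambda>n. ip \<psi> (a n) x) \<longlonglongrightarrow> \<xi> x)
    \<and> (\<forall>n. \<forall>x\<in>carrier A. cmod (\<xi> x - ip \<psi> (a n) x) \<le> \<eta> n * sn \<psi> x)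
    \<and> (\<forall>n. sn \<psi> (a n) \<le> C)"
proof -
  have d: "\<psi> \<in> dual A" using \<psi> by (rule posf_dual)
  have \<eta>_nonneg: "0 \<le> \<eta> n" for n
    using order_trans[OF ip_self(2)[OF \<psi>, of "a n \<ominus> a n"] cauchy[of n n]] a by simp
  have diff: "cmod (ip \<psi> (a m) x - ip \<psi> (a n) x) \<le> \<eta> n * sn \<psi> x"
    if "n \<le> m" "x \<in> carrier A" for m n x
  proof -
    have "cmod (ip \<psi> (a m) x - ip \<psi> (a n) x) \<le> sn \<psi> (a m \<ominus> a n) * sn \<psi> x"
      using ip_le[OF \<psi>, of "a m \<ominus> a n" x] a that d by (simp add: ip_linear)
    also have "\<dots> \<le> \<eta> n * sn \<psi> x"
      using cauchy[OF that(1)] ip_self(2)[OF \<psi> that(2)] by (rule mult_right_mono)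
    finally show ?thesis .
  qed
  have conv: "convergent (\<lambda>n. ip \<psi> (a n) x)" if x: "x \<in> carrier A" for x
  proof -
    have "(\<lambda>n. \<eta> n * sn \<psi> x) \<longlonglongrightarrow> 0" using tendsto_mult_right[OF \<eta>, of "sn \<psi> x"] by simp
    have "Cauchy (\<lambda>n. ip \<psi> (a n) x)"
    proof (rule metric_CauchyI)
      fix e :: real assume e: "0 < e"
      obtain N where N: "\<eta> N * sn \<psi> x < e / 2"
        using order_tendstoD(2)[OF \<open>(\<lambda>n. \<eta> n * sn \<psi> x) \<longlonglongrightarrow> 0\<close>, of "e / 2"] e
          eventually_happens' by force
      have "dist (ip \<psi> (a m) x) (ip \<psi> (a n) x) < e" if "N \<le> m" "N \<le> n" for m n
        using diff[OF that(1) x] diff[OF that(2) x] N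
          norm_triangle_ineq4[of "ip \<psi> (a m) x - ip \<psi> (a N) x" "ip \<psi> (a n) x - ip \<psi> (a N) x"]
        by (simp add: dist_norm)
      then show "\<exists>M. \<forall>m\<ge>M. \<forall>n\<ge>M. dist (ip \<psi> (a m) x) (ip \<psi> (a n) x) < e" by blast
    qed
    then show ?thesis by (simp add: Cauchy_convergent_iff)
  qed
  define \<xi> where "\<xi> = (\<lambda>x\<in>carrier A. lim (\<lambda>n. ip \<psi> (a n) x))"
  have lim: "(\<lambda>n. ip \<psi> (a n) x) \<longlonglongrightarrow> \<xi> x" if "x \<in> carrier A" for x
    using conv[OF that] that by (simp add: \<xi>_def convergent_LIMSEQ_iff)
  have approx: "cmod (\<xi> x - ip \<psi> (a n) x) \<le> \<eta> n * sn \<psi> x" if x: "x \<in> carrier A" for n x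
  proof (rule LIMSEQ_le_const2)
    show "(\<lambda>m. cmod (ip \<psi> (a m) x - ip \<psi> (a n) x)) \<longlonglongrightarrow> cmod (\<xi> x - ip \<psi> (a n) x)"
      by (intro tendsto_intros lim x)
    show "\<exists>N. \<forall>m\<ge>N. cmod (ip \<psi> (a m) x - ip \<psi> (a n) x) \<le> \<eta> n * sn \<psi> x"
      using diff x by blast
  qed
  define C where "C = sn \<psi> (a 0) + \<eta> 0"
  have C: "0 \<le> C" using ip_self(2)[OF \<psi> a] \<eta>_nonneg by (simp add: C_def)
  have bound: "cmod (\<xi> x) \<le> C * sn \<psi> x" if x: "x \<in> carrier A" for x
    using norm_triangle_ineq[of "\<xi> x - ip \<psi> (a 0) x" "ip \<psi> (a 0) x"]
      approx[OF x, of 0] ip_le[OF \<psi> a[of 0] x] by (simp add: C_def algebra_simps)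
  have "\<xi> \<in> dual A"
  proof (rule dualI[where C = "C * sn \<psi> \<one>"])
    show "\<xi> \<in> extensional (carrier A)" by (simp add: \<xi>_def)
    show "\<xi> (x \<oplus> y) = \<xi> x + \<xi> y" if xy: "x \<in> carrier A" "y \<in> carrier A" for x y
    proof (rule LIMSEQ_unique)
      show "(\<lambda>n. ip \<psi> (a n) (x \<oplus> y)) \<longlonglongrightarrow> \<xi> (x \<oplus> y)" using xy by (intro lim) auto
      show "(\<lambda>n. ip \<psi> (a n) (x \<oplus> y)) \<longlonglongrightarrow> \<xi> x + \<xi> y"
        using tendsto_add[OF lim[OF xy(1)] lim[OF xy(2)]] xy a by (simp add: ip_linear[OF d])
    qed
    show "\<xi> (scale A c x) = c * \<xi> x" if x: "x \<in> carrier A" for c x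
    proof (rule LIMSEQ_unique)
      show "(\<lambda>n. ip \<psi> (a n) (scale A c x)) \<longlonglongrightarrow> \<xi> (scale A c x)" using x by (intro lim) auto
      show "(\<lambda>n. ip \<psi> (a n) (scale A c x)) \<longlonglongrightarrow> c * \<xi> x"
        using tendsto_mult_left[OF lim[OF x], of c] x a by (simp add: ip_linear[OF d])
    qed
    show "cmod (\<xi> x) \<le> C * sn \<psi> \<one> * cnorm A x" if x: "x \<in> carrier A" for x
      using order_trans[OF bound[OF x] mult_left_mono[OF sn_le[OF \<psi> x] C]] by (simp add: mult_ac)
  qed
  then have "dominated \<psi> C \<xi>" using bound C by (simp add: dominated_def)
  moreover have "sn \<psi> (a n) \<le> C" for n
    using sn_le_diff[OF \<psi>, of "a n" "a 0"] cauchy[of 0 n] a by (simp add: C_def)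
  ultimately show ?thesis using lim approx by blast
qed

end

text \<open>A norm-closed self-adjoint sub-bimodule of the dual. Closedness is phrased pointwise on
  the algebra, which amounts to closedness for the dual norm.\<close>

locale invariant_subspace = column_cstar_algebra +
  fixes N :: "('a \<Rightarrow> complex) set"
  assumes N_dual: "N \<subseteq> dual A"
    and N_nonempty: "N \<noteq> {}"
    and N_add: "\<lbrakk>\<nu> \<in> N; \<nu>' \<in> N\<rbrakk> \<Longrightarrow> fadd \<nu> \<nu>' \<in> N"
    and N_scale: "\<nu> \<in> N \<Longrightarrow> fscale c \<nu> \<in> N"
    and N_closed: "\<lbrakk>\<phi> \<in> dual A; \<And>e. 0 < e \<Longrightarrow>
        \<exists>\<nu>\<in>N. \<forall>x\<in>carrier A. cmod (\<phi> x - \<nu> x) \<le> e * cnorm A x\<rbrakk> \<Longrightarrow> \<phi> \<in> N"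
    and N_right: "\<lbrakk>\<nu> \<in> N; a \<in> carrier A\<rbrakk> \<Longrightarrow> dual_act A \<nu> a \<in> N"
    and N_left: "\<lbrakk>\<nu> \<in> N; a \<in> carrier A\<rbrakk> \<Longrightarrow> lact a \<nu> \<in> N"
    and N_star: "\<nu> \<in> N \<Longrightarrow> dual_star A \<nu> \<in> N"
begin

text \<open>The analogue of mutual singularity: in the GNS space of \<psi>, only the zero vector
  induces a functional of N.\<close>

definition sing :: "('a \<Rightarrow> complex) \<Rightarrow> bool" where
  "sing \<psi> \<longleftrightarrow> posf \<psi> \<and> (\<forall>\<nu>\<in>N. \<forall>C. dominated \<psi> C \<nu> \<longrightarrow> (\<forall>x\<in>carrier A. \<nu> x = 0))"

text \<open>In the GNS space of \<psi>, the vector of a has distance at most e from some vector that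
  induces a functional of N.\<close>

definition near :: "('a \<Rightarrow> complex) \<Rightarrow> real \<Rightarrow> 'a \<Rightarrow> bool" where
  "near \<psi> e a \<longleftrightarrow> a \<in> carrier A \<and>
    (\<exists>\<nu>\<in>N. \<forall>x\<in>carrier A. cmod (\<nu> x - ip \<psi> a x) \<le> e * sn \<psi> x)"

lemma N_in_dual: "\<nu> \<in> N \<Longrightarrow> \<nu> \<in> dual A"
  using N_dual by blast

lemma near_add:
  assumes \<psi>: "posf \<psi>" and "near \<psi> e a" "near \<psi> f b"
  shows "near \<psi> (e + f) (a \<oplus> b)"
proof -
  obtain \<nu> \<nu>' where n: "\<nu> \<in> N" "\<nu>' \<in> N" "a \<in> carrier A" "b \<in> carrier A"
    "\<And>x. x \<in> carrier A \<Longrightarrow> cmod (\<nu> x - ip \<psi> a x) \<le> e * sn \<psi> x"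
    "\<And>x. x \<in> carrier A \<Longrightarrow> cmod (\<nu>' x - ip \<psi> b x) \<le> f * sn \<psi> x"
    using assms unfolding near_def by blast
  have "cmod (fadd \<nu> \<nu>' x - ip \<psi> (a \<oplus> b) x) \<le> (e + f) * sn \<psi> x" if x: "x \<in> carrier A" for x
    using n(5,6)[OF x] norm_triangle_ineq[of "\<nu> x - ip \<psi> a x" "\<nu>' x - ip \<psi> b x"] n(3,4) x
    by (simp add: ip_linear posf_dual[OF \<psi>] algebra_simps)
  then show ?thesis using n N_add unfolding near_def by blast
qed

lemma near_scale:
  assumes \<psi>: "posf \<psi>" and "near \<psi> e a"
  shows "near \<psi> (cmod c * e) (scale A c a)"
proof -
  obtain \<nu> where n: "\<nu> \<in> N" "a \<in> carrier A"
    "\<And>x. x \<in> carrier A \<Longrightarrow> cmod (\<nu> x - ip \<psi> a x) \<le> e * sn \<psi> x"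
    using assms unfolding near_def by blast
  \<comment> \<open>The scalar is conjugated because the passage from vectors to functionals is
    conjugate-linear.\<close>
  have "cmod (fscale (cnj c) \<nu> x - ip \<psi> (scale A c a) x) \<le> cmod c * e * sn \<psi> x"
    if x: "x \<in> carrier A" for x
  proof -
    have "fscale (cnj c) \<nu> x - ip \<psi> (scale A c a) x = cnj c * (\<nu> x - ip \<psi> a x)"
      using x n by (simp add: ip_linear posf_dual[OF \<psi>] algebra_simps)
    then show ?thesis
      using mult_left_mono[OF n(3)[OF x], of "cmod c"] by (simp add: norm_mult mult.assoc)
  qed
  then show ?thesis using n N_scale unfolding near_def by blast
qed

lemma near_mono: "\<lbrakk>posf \<psi>; near \<psi> e a; e \<le> f\<rbrakk> \<Longrightarrow> near \<psi> f a"
  unfolding near_def by (meson ip_self(2) mult_right_mono order_trans)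

lemma near_zero:
  assumes \<psi>: "posf \<psi>" "0 \<le> e"
  shows "near \<psi> e \<zero>"
proof -
  obtain \<nu> where "\<nu> \<in> N" using N_nonempty by blast
  then have "fscale 0 \<nu> \<in> N" by (rule N_scale)
  moreover have "cmod (fscale 0 \<nu> x - ip \<psi> \<zero> x) \<le> e * sn \<psi> x" if "x \<in> carrier A" for x
    using that assms ip_self(2)[OF \<psi>(1) that] by (simp add: ip_def posf_dual)
  ultimately show ?thesis unfolding near_def by blast
qed

text \<open>In terms of the GNS representation of \<open>\<psi>\<close>, the functionals in \<open>N\<close> dominated by \<open>\<psi>\<close>
  correspond to an invariant closed subspace, and \<open>a n\<close> applied to the cyclic vector converges to
  the orthogonal projection of the cyclic vector onto that subspace.\<close>

lemma projection_sequence: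
  assumes \<psi>: "posf \<psi>"
  obtains a \<eta> where "\<And>n::nat. a n \<in> carrier A" "\<And>n. near \<psi> (1 / (real n + 1)) (a n)"
    "\<And>m n. n \<le> m \<Longrightarrow> sn \<psi> (a m \<ominus> a n) \<le> \<eta> n" "\<eta> \<longlonglongrightarrow> 0"
    "\<And>\<nu> C. \<lbrakk>\<nu> \<in> N; dominated \<psi> C \<nu>\<rbrakk> \<Longrightarrow> (\<lambda>n. \<nu> (a n)) \<longlonglongrightarrow> \<nu> \<one>"
proof -
  have d: "\<psi> \<in> dual A" using \<psi> by (rule posf_dual)
  \<comment> \<open>G is the squared distance to the cyclic vector; its infimum \<open>D e\<close>
    over the e-near elements grows as e shrinks.\<close>
  define G where "G a = (sn \<psi> (\<one> \<ominus> a))\<^sup>2" for a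
  define D where "D e = (INF a\<in>{a. near \<psi> e a}. G a)" for e
  have ne: "{a. near \<psi> e a} \<noteq> {}" if "0 \<le> e" for e using near_zero[OF \<psi> that] by blast
  have bdd: "bdd_below (G ` X)" for X by (auto simp: G_def intro!: bdd_belowI[of _ 0])
  have D_le: "D e \<le> G a" if "near \<psi> e a" for e a
    unfolding D_def using that bdd by (intro cINF_lower) auto
  have D_mono: "D f \<le> D e" if "0 \<le> e" "e \<le> f" for e f
    unfolding D_def using that ne bdd near_mono[OF \<psi>] by (intro cINF_superset_mono) auto
  define d where "d n = D (1 / (real n + 1))" for n
  have "incseq d"
    unfolding d_def by (intro incseq_SucI D_mono) (auto simp: frac_le)
  moreover have "d n \<le> G \<zero>" for n unfolding d_def using near_zero[OF \<psi>] by (intro D_le) auto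
  ultimately obtain L where L: "d \<longlonglongrightarrow> L" "\<And>n. d n \<le> L"
    using incseq_convergent[of d "G \<zero>"] by blast
  \<comment> \<open>Half of the tolerance is held back for the perturbation by b below. The halved
    tolerance is the one of index 2n + 1, so its infimum is still at most L.\<close>
  have "\<exists>a. near \<psi> (1 / (2 * (real n + 1))) a \<and> G a < L + 1 / (real n + 1)" for n
  proof (rule ccontr)
    assume none: "\<not> ?thesis"
    have "L + 1 / (real n + 1) \<le> D (1 / (2 * (real n + 1)))"
      unfolding D_def using none ne[of "1 / (2 * (real n + 1))"]
      by (intro cINF_greatest) (auto simp: not_less)
    also have "\<dots> = d (2 * n + 1)" by (simp add: d_def algebra_simps)
    also have "\<dots> \<le> L" by (rule L)
    finally show False by (simp add: field_simps)
  qed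
  then obtain a where a_near: "\<And>n. near \<psi> (1 / (2 * (real n + 1))) (a n)"
    and a_less: "\<And>n. G (a n) < L + 1 / (real n + 1)" by metis
  have a: "a n \<in> carrier A" for n using a_near by (simp add: near_def)
  \<comment> \<open>The midpoint of two near elements is near, so its squared distance is at least
    \<open>d n\<close>; by the parallelogram law the excess \<eta> bounds the difference of the two
    by 2 sqrt(\<eta>).\<close>
  define \<eta> where "\<eta> n = L - d n + 1 / (real n + 1)" for n
  have inv: "(\<lambda>n. 1 / (real n + 1)) \<longlonglongrightarrow> 0" by (rule inverse_Suc_tendsto)
  have \<eta>: "\<eta> \<longlonglongrightarrow> 0"
    unfolding \<eta>_def using tendsto_add[OF tendsto_diff[OF tendsto_const L(1)] inv, of L] by simp
  have a_near': "near \<psi> (1 / (real n + 1)) (a n)" for n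
    by (rule near_mono[OF \<psi> a_near]) (simp add: field_simps)
  have cauchy: "sn \<psi> (a m \<ominus> a n) \<le> 2 * sqrt (\<eta> n)" if nm: "n \<le> m" for m n
  proof -
    let ?c = "scale A (1 / 2) (a m \<oplus> a n)"
    have am: "near \<psi> (1 / (real n + 1)) (a m)"
      by (rule near_mono[OF \<psi> a_near']) (use nm in \<open>simp add: frac_le\<close>)
    have "near \<psi> (1 / (real n + 1)) ?c"
      using near_scale[OF \<psi> near_add[OF \<psi> am a_near'[of n]], of "1 / 2"]
      by (simp add: norm_divide)
    then have "d n \<le> G ?c" unfolding d_def by (rule D_le)
    moreover have "1 / (real m + 1) \<le> 1 / (real n + 1)" using nm by (simp add: frac_le)
    then have "G (a m) < L + 1 / (real n + 1)" using a_less[of m] by linarith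
    ultimately have "(sn \<psi> (a m \<ominus> a n))\<^sup>2 \<le> 4 * \<eta> n"
      using sn_midpoint[OF \<psi>, of \<one> "a m" "a n"] a a_less[of n] by (simp add: G_def \<eta>_def)
    then have "sn \<psi> (a m \<ominus> a n) \<le> sqrt (4 * \<eta> n)" by (rule real_le_rsqrt)
    then show ?thesis by (simp add: real_sqrt_mult)
  qed
  have sq\<eta>: "(\<lambda>n. 2 * sqrt (\<eta> n)) \<longlonglongrightarrow> 0"
    using tendsto_mult[OF tendsto_const tendsto_real_sqrt[OF \<eta>], of 2] by simp
  have orth: "(\<lambda>n. \<nu> (a n)) \<longlonglongrightarrow> \<nu> \<one>" if \<nu>: "\<nu> \<in> N" and dom: "dominated \<psi> C \<nu>" for \<nu> C
  proof -
    have \<nu>_dual: "\<nu> \<in> dual A" using N_dual \<nu> by blast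
    have C: "0 \<le> C" using dom by (simp add: dominated_def)
    define y where "y n = \<one> \<ominus> a n" for n
    have y: "y n \<in> carrier A" for n using a by (simp add: y_def)
    define M where "M = sqrt (L + 1)"
    have yM: "sn \<psi> (y n) \<le> M" for n
    proof -
      have "(sn \<psi> (y n))\<^sup>2 \<le> L + 1 / (real n + 1)" using a_less[of n] by (simp add: G_def y_def)
      also have "\<dots> \<le> L + 1" by simp
      finally show ?thesis unfolding M_def by (rule real_le_rsqrt)
    qed
    \<comment> \<open>First-order condition: \<open>a n\<close> may be moved by t b, with b an
      approximate Riesz vector of \<nu>, without leaving the 1/(n+1)-near elements, so G cannot drop
      below \<open>d n\<close>.\<close>
    have est: "2 * s * cmod (\<nu> (y n)) \<le> \<eta> n + M / (real n + 1) + s\<^sup>2 * (C + 1)\<^sup>2"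
      if s: "0 < s" and n: "1 / s \<le> real n" for s n
    proof -
      \<comment> \<open>The product s e uses up exactly the half of the tolerance that was held
        back.\<close>
      define e where "e = 1 / (2 * (real n + 1) * s)"
      have e: "0 < e" using s by (simp add: e_def)
      have "1 \<le> 2 * (real n + 1) * s"
        using n s by (simp add: divide_simps algebra_simps)
      then have e1: "e \<le> 1" using s by (simp add: e_def divide_simps)
      have se: "s * e = 1 / (2 * (real n + 1))" using s by (simp add: e_def)
      have half: "1 / (2 * (real n + 1)) + 1 / (2 * (real n + 1)) = 1 / (real n + 1)"
        by (simp add: field_simps)
      obtain b where b: "b \<in> carrier A"
        and approx: "\<And>x. x \<in> carrier A \<Longrightarrow> cmod (\<nu> x - ip \<psi> b x) \<le> e * sn \<psi> x"
        using riesz_approx[OF \<psi> dom e] by blast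
      have sb: "sn \<psi> b \<le> C + 1"
        using sn_approximant_le[OF \<psi> dom _ b approx] e e1 by simp
      \<comment> \<open>t has modulus s and the phase of \<open>\<nu> (y n)\<close>, so that the
        first-order term is real and nonnegative.\<close>
      define t where "t = (if \<nu> (y n) = 0 then of_real s else of_real (s / cmod (\<nu> (y n))) * \<nu> (y n))"
      have t: "cmod t = s" using s by (simp add: t_def norm_mult norm_divide)
      have tn: "cnj t * \<nu> (y n) = of_real (s * cmod (\<nu> (y n)))"
      proof -
        have "cnj (\<nu> (y n)) * \<nu> (y n) = of_real (cmod (\<nu> (y n)) * cmod (\<nu> (y n)))"
          using complex_norm_square[of "\<nu> (y n)"]
          by (simp add: power2_eq_square mult.commute[of "cnj _"])
        then show ?thesis by (simp add: t_def mult.assoc)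
      qed
      have "near \<psi> e b" unfolding near_def using b approx \<nu> by blast
      then have "near \<psi> (1 / (2 * (real n + 1)) + s * e) (a n \<oplus> scale A t b)"
        using near_add[OF \<psi> a_near near_scale[OF \<psi>, of e b t]] t by simp
      then have "near \<psi> (1 / (real n + 1)) (a n \<oplus> scale A t b)"
        by (rule near_mono[OF \<psi>]) (simp only: se half order_refl)
      then have "d n \<le> G (a n \<oplus> scale A t b)" unfolding d_def by (rule D_le)
      also have "\<one> \<ominus> (a n \<oplus> scale A t b) = y n \<ominus> scale A t b"
        using a[of n] b by (simp add: y_def a_minus_def minus_add a_assoc)
      then have "G (a n \<oplus> scale A t b)
          = (sn \<psi> (y n))\<^sup>2 - 2 * Re (ip \<psi> (y n) (scale A t b)) + s\<^sup>2 * (sn \<psi> b)\<^sup>2"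
        using \<psi> y b t by (simp add: G_def sn_diff_power2 sn_scale power_mult_distrib)
      also have "Re (ip \<psi> (y n) (scale A t b)) = Re (cnj t * ip \<psi> b (y n))"
        using ip_commute[OF \<psi> b y[of n]] y b posf_dual[OF \<psi>] by (simp add: ip_linear)
      also have "\<dots> = s * cmod (\<nu> (y n)) - Re (cnj t * (\<nu> (y n) - ip \<psi> b (y n)))"
        using tn by (simp add: right_diff_distrib)
      finally have main: "2 * s * cmod (\<nu> (y n)) \<le> (sn \<psi> (y n))\<^sup>2 - d n
          + 2 * Re (cnj t * (\<nu> (y n) - ip \<psi> b (y n))) + s\<^sup>2 * (sn \<psi> b)\<^sup>2" by simp
      have "Re (cnj t * (\<nu> (y n) - ip \<psi> b (y n))) \<le> s * cmod (\<nu> (y n) - ip \<psi> b (y n))"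
        using complex_Re_le_cmod[of "cnj t * (\<nu> (y n) - ip \<psi> b (y n))"] t by (simp add: norm_mult)
      also have "\<dots> \<le> s * (e * M)"
        using approx[OF y[of n]] yM[of n] s e
        by (intro mult_left_mono order_trans[OF approx[OF y]]) auto
      also have "\<dots> = M / (2 * (real n + 1))" using se by (simp add: mult.assoc[symmetric])
      finally have "2 * Re (cnj t * (\<nu> (y n) - ip \<psi> b (y n))) \<le> M / (real n + 1)"
        by (simp add: field_simps)
      moreover have "s\<^sup>2 * (sn \<psi> b)\<^sup>2 \<le> s\<^sup>2 * (C + 1)\<^sup>2"
        using sb ip_self(2)[OF \<psi> b] by (intro mult_left_mono power_mono) auto
      moreover have "(sn \<psi> (y n))\<^sup>2 - d n \<le> \<eta> n"
        using a_less[of n] by (simp add: G_def y_def \<eta>_def)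
      ultimately show ?thesis using main by linarith
    qed
    have "(\<lambda>n. \<nu> (y n)) \<longlonglongrightarrow> 0"
    proof (rule LIMSEQ_I)
      fix r :: real assume r: "0 < r"
      \<comment> \<open>With this s the quadratic term in \<open>est\<close> is s r/2, half of what
        is allowed.\<close>
      define s where "s = r / (2 * (C + 1)\<^sup>2)"
      have s: "0 < s" using r C by (simp add: s_def)
      have "s * (C + 1)\<^sup>2 = r / 2" using C by (simp add: s_def)
      then have s2: "s\<^sup>2 * (C + 1)\<^sup>2 = s * (r / 2)"
        unfolding power2_eq_square[of s] by (simp only: mult.assoc)
      have "(\<lambda>n. \<eta> n + M * (1 / (real n + 1))) \<longlonglongrightarrow> 0 + M * 0"
        by (intro tendsto_intros \<eta> inv)
      then have "eventually (\<lambda>n. \<eta> n + M * (1 / (real n + 1)) < s * (r / 2)) sequentially"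
        using r s by (intro order_tendstoD(2)[where y = "0 + M * 0"]) auto
      moreover have "eventually (\<lambda>n. 1 / s \<le> real n) sequentially"
        using real_arch_simple[of "1 / s"] unfolding eventually_sequentially
        by (meson of_nat_le_iff order_trans)
      ultimately have "eventually (\<lambda>n. norm (\<nu> (y n) - 0) < r) sequentially"
      proof eventually_elim
        case (elim n)
        have "2 * s * cmod (\<nu> (y n)) < s * (r / 2) + s * (r / 2)"
          using est[OF s elim(2), unfolded s2] elim(1)
          by (simp only: times_divide_eq_right mult_1_right)
        also have "\<dots> = s * r" by (simp add: field_simps)
        finally have "2 * cmod (\<nu> (y n)) < r" using s by (simp add: mult.assoc mult.left_commute)
        then show ?case using norm_ge_zero[of "\<nu> (y n)"] r by simp
      qed
      then show "\<exists>no. \<forall>n\<ge>no. norm (\<nu> (y n) - 0) < r" by (simp add: eventually_sequentially)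
    qed
    then have "(\<lambda>n. \<nu> \<one> - \<nu> (y n)) \<longlonglongrightarrow> \<nu> \<one> - 0" by (intro tendsto_intros)
    moreover have "\<nu> \<one> - \<nu> (y n) = \<nu> (a n)" for n
      using a \<nu>_dual by (simp add: y_def dual_diff)
    ultimately show ?thesis by simp
  qed
  show ?thesis by (rule that[OF a a_near' cauchy sq\<eta> orth])
qed

end

section \<open>Lebesgue decomposition with respect to an invariant subspace\<close>

context cstar_algebra
begin

lemma posf_fadd:
  assumes "posf \<psi>" "posf \<psi>'"
  shows "posf (fadd \<psi> \<psi>')"
  using assms by (auto simp: posf_def intro: nonneg_Reals_add_I)

lemma sn_fadd_ge:
  assumes "posf \<psi>" "posf \<psi>'" "x \<in> carrier A"
  shows "sn \<psi> x \<le> sn (fadd \<psi> \<psi>') x" "sn \<psi>' x \<le> sn (fadd \<psi> \<psi>') x"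
proof -
  have "0 \<le> Re (ip \<psi> x x)" "0 \<le> Re (ip \<psi>' x x)"
    using sn_power2[of \<psi> x] sn_power2[of \<psi>' x] assms by (metis zero_le_power2)+
  moreover have "ip (fadd \<psi> \<psi>') x x = ip \<psi> x x + ip \<psi>' x x"
    using assms by (simp add: ip_def)
  ultimately show "sn \<psi> x \<le> sn (fadd \<psi> \<psi>') x" "sn \<psi>' x \<le> sn (fadd \<psi> \<psi>') x"
    unfolding sn_def by (auto intro!: real_sqrt_le_mono)
qed

lemma dominated_mono:
  assumes "dominated \<psi> C \<xi>" "\<And>x. x \<in> carrier A \<Longrightarrow> sn \<psi> x \<le> sn \<rho> x"
  shows "dominated \<rho> C \<xi>"
  using assms unfolding dominated_def by (meson mult_left_mono order_trans)

end

context invariant_subspace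
begin

lemma N_limit:
  assumes "\<phi> \<in> dual A" "\<And>n. \<nu> n \<in> N" "\<epsilon> \<longlonglongrightarrow> (0::real)"
    and "\<And>n x. x \<in> carrier A \<Longrightarrow> cmod (\<phi> x - \<nu> n x) \<le> \<epsilon> n * cnorm A x"
  shows "\<phi> \<in> N"
proof (rule N_closed[OF assms(1)])
  fix e :: real assume "0 < e"
  then obtain n where n: "\<epsilon> n < e"
    using order_tendstoD(2)[OF assms(3)] eventually_happens' by force
  have "cmod (\<phi> x - \<nu> n x) \<le> e * cnorm A x" if x: "x \<in> carrier A" for x
    using assms(4)[OF x, of n] n cnorm_nonneg[OF x] mult_right_mono[of "\<epsilon> n" e "cnorm A x"] by linarith
  then show "\<exists>\<nu>\<in>N. \<forall>x\<in>carrier A. cmod (\<phi> x - \<nu> x) \<le> e * cnorm A x"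
    using assms(2) by blast
qed

text \<open>Let v be the cyclic vector and P the projection approximated by \<open>a n\<close>. The
  parts are the vector functionals of Pv and of v - Pv; invariance of N makes P commute with the
  algebra, which gives positivity of both and singularity of the second.\<close>

lemma lebesgue_decomposition_positive:
  assumes \<psi>: "posf \<psi>"
  obtains \<psi>1 \<psi>2 where "posf \<psi>1" "\<psi>1 \<in> N" "sing \<psi>2" "\<psi> = fadd \<psi>1 \<psi>2"
proof (rule projection_sequence[OF \<psi>])
  have d: "\<psi> \<in> dual A" using \<psi> by (rule posf_dual)
  fix a :: "nat \<Rightarrow> _" and \<eta> assume a: "\<And>n. a n \<in> carrier A"
    and a_near: "\<And>n. near \<psi> (1 / (real n + 1)) (a n)"
    and cauchy: "\<And>m n. n \<le> m \<Longrightarrow> sn \<psi> (a m \<ominus> a n) \<le> \<eta> n" and \<eta>: "\<eta> \<longlonglongrightarrow> 0"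
    and orth: "\<And>\<nu> C. \<lbrakk>\<nu> \<in> N; dominated \<psi> C \<nu>\<rbrakk> \<Longrightarrow> (\<lambda>n. \<nu> (a n)) \<longlonglongrightarrow> \<nu> \<one>"
  obtain \<psi>1 B where dom1: "dominated \<psi> B \<psi>1"
    and lim: "\<And>x. x \<in> carrier A \<Longrightarrow> (\<lambda>n. ip \<psi> (a n) x) \<longlonglongrightarrow> \<psi>1 x"
    and approx: "\<And>n x. x \<in> carrier A \<Longrightarrow> cmod (\<psi>1 x - ip \<psi> (a n) x) \<le> \<eta> n * sn \<psi> x"
    and B: "\<And>n. sn \<psi> (a n) \<le> B"
    using limit_functional[OF \<psi> a cauchy \<eta>] by blast
  have d1: "\<psi>1 \<in> dual A" using dom1 by (rule dominated_dual)
  have s1: "0 \<le> sn \<psi> \<one>" using ip_self(2)[OF \<psi>] by simp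
  have "\<exists>\<nu>\<in>N. \<forall>x\<in>carrier A. cmod (\<nu> x - ip \<psi> (a n) x) \<le> 1 / (real n + 1) * sn \<psi> x" for n
    using a_near unfolding near_def by blast
  then obtain \<nu> where \<nu>: "\<And>n. \<nu> n \<in> N"
    "\<And>n x. x \<in> carrier A \<Longrightarrow> cmod (\<nu> n x - ip \<psi> (a n) x) \<le> 1 / (real n + 1) * sn \<psi> x"
    by metis
  have "\<psi>1 \<in> N"
  proof (rule N_limit[where \<nu> = \<nu>])
    show "(\<lambda>n. (\<eta> n + 1 / (real n + 1)) * sn \<psi> \<one>) \<longlonglongrightarrow> 0"
      using tendsto_mult_right[OF tendsto_add[OF \<eta> inverse_Suc_tendsto[of 1]], of "sn \<psi> \<one>"] by simp
    show "cmod (\<psi>1 x - \<nu> n x) \<le> (\<eta> n + 1 / (real n + 1)) * sn \<psi> \<one> * cnorm A x"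
      if x: "x \<in> carrier A" for n x
    proof -
      have "0 \<le> \<eta> n"
        using order_trans[OF ip_self(2)[OF \<psi>, of "a n \<ominus> a n"] cauchy[of n n]] a by simp
      have "cmod (\<psi>1 x - \<nu> n x) \<le> (\<eta> n + 1 / (real n + 1)) * sn \<psi> x"
        using approx[OF x, of n] \<nu>(2)[OF x, of n]
          norm_triangle_ineq4[of "\<psi>1 x - ip \<psi> (a n) x" "\<nu> n x - ip \<psi> (a n) x"]
        by (simp add: algebra_simps)
      also have "\<dots> \<le> (\<eta> n + 1 / (real n + 1)) * (cnorm A x * sn \<psi> \<one>)"
        using \<open>0 \<le> \<eta> n\<close> sn_le[OF \<psi> x] by (intro mult_left_mono) auto
      finally show ?thesis by (simp add: mult_ac)
    qed
  qed (use d1 \<nu> in auto)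
  \<comment> \<open>P commutes with y: orthogonality is applied to
    \<open>dual_act A \<nu> y\<close>, which lies in N again.\<close>
  have orth': "(\<lambda>n. \<nu> (y \<otimes> a n)) \<longlonglongrightarrow> \<nu> y"
    if "\<nu> \<in> N" "dominated \<psi> C \<nu>" "y \<in> carrier A" for \<nu> C y
    using orth[OF N_right[OF that(1,3)] dominated_dual_act[OF \<psi> that(2,3)]] a that(3) by simp
  \<comment> \<open>The squared norms of y Pv, from which positivity of \<psi>1 is read off.\<close>
  have sq_lim: "(\<lambda>n. ip \<psi> (y \<otimes> a n) (y \<otimes> a n)) \<longlonglongrightarrow> \<psi>1 (star A y \<otimes> y)"
    if y: "y \<in> carrier A" for y
  proof -
    let ?h = "star A y \<otimes> y"
    have h: "?h \<in> carrier A" using y by simp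
    have B0: "0 \<le> B" using dom1 by (simp add: dominated_def)
    have "(\<lambda>n. \<psi>1 (?h \<otimes> a n) - ip \<psi> (a n) (?h \<otimes> a n)) \<longlonglongrightarrow> 0"
    proof (rule Lim_null_comparison)
      show "(\<lambda>n. \<eta> n * (cnorm A ?h * B)) \<longlonglongrightarrow> 0"
        using tendsto_mult_right[OF \<eta>, of "cnorm A ?h * B"] by simp
      have "cmod (\<psi>1 (?h \<otimes> a n) - ip \<psi> (a n) (?h \<otimes> a n)) \<le> \<eta> n * (cnorm A ?h * B)" for n
      proof -
        have "0 \<le> \<eta> n"
          using order_trans[OF ip_self(2)[OF \<psi>, of "a n \<ominus> a n"] cauchy[of n n]] a by simp
        have "sn \<psi> (?h \<otimes> a n) \<le> cnorm A ?h * B"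
          using sn_mult_le[OF \<psi> h a[of n]] mult_left_mono[OF B[of n] cnorm_nonneg[OF h]] by linarith
        then have "\<eta> n * sn \<psi> (?h \<otimes> a n) \<le> \<eta> n * (cnorm A ?h * B)"
          using \<open>0 \<le> \<eta> n\<close> by (rule mult_left_mono)
        then show ?thesis using approx[of "?h \<otimes> a n" n] h a by (meson m_closed order_trans)
      qed
      then show "\<forall>\<^sub>F n in sequentially.
          norm (\<psi>1 (?h \<otimes> a n) - ip \<psi> (a n) (?h \<otimes> a n)) \<le> \<eta> n * (cnorm A ?h * B)" by simp
    qed
    from tendsto_diff[OF orth'[OF \<open>\<psi>1 \<in> N\<close> dom1 h] this]
    have "(\<lambda>n. ip \<psi> (a n) (?h \<otimes> a n)) \<longlonglongrightarrow> \<psi>1 ?h" by simp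
    moreover have "ip \<psi> (a n) (?h \<otimes> a n) = ip \<psi> (y \<otimes> a n) (y \<otimes> a n)" for n
      using a y by (simp add: ip_mult(2)[OF d] m_assoc)
    ultimately show ?thesis by simp
  qed
  have pos1: "posf \<psi>1"
    unfolding posf_def
  proof (intro conjI ballI d1)
    fix y assume y: "y \<in> carrier A"
    show "\<psi>1 (star A y \<otimes> y) \<in> \<real>\<^sub>\<ge>\<^sub>0"
    proof (rule Lim_in_closed_set[OF closed_nonneg_Reals_complex _ _ sq_lim[OF y]])
      show "\<forall>\<^sub>F n in sequentially. ip \<psi> (y \<otimes> a n) (y \<otimes> a n) \<in> \<real>\<^sub>\<ge>\<^sub>0"
        using \<psi> y a by (simp add: posf_def ip_def)
    qed simp
  qed
  define \<psi>2 where "\<psi>2 = fadd \<psi> (fscale (- 1) \<psi>1)"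
  have d2: "\<psi>2 \<in> dual A" using d d1 by (simp add: \<psi>2_def)
  have psi2: "\<psi>2 x = \<psi> x - \<psi>1 x" if "x \<in> carrier A" for x using that by (simp add: \<psi>2_def)
  have star_lim: "(\<lambda>n. ip \<psi> x (a n)) \<longlonglongrightarrow> \<psi>1 (star A x)" if x: "x \<in> carrier A" for x
    using tendsto_cnj[OF lim[OF x]] ip_commute[OF \<psi> a x] posf_star[OF pos1 x] by simp
  have pos2: "posf \<psi>2"
    unfolding posf_def
  proof (intro conjI ballI d2)
    fix y assume y: "y \<in> carrier A"
    let ?h = "star A y \<otimes> y"
    have h: "?h \<in> carrier A" "star A ?h = ?h" using y by (auto simp: star_mult)
    \<comment> \<open>The expansion of the squared seminorm of
      \<open>y \<otimes> (\<one> \<ominus> a n)\<close>; in the limit it leaves \<psi> -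
      \<psi>1.\<close>
    have "(\<lambda>n. \<psi> ?h - ip \<psi> ?h (a n) - ip \<psi> (a n) ?h + ip \<psi> (y \<otimes> a n) (y \<otimes> a n))
        \<longlonglongrightarrow> \<psi> ?h - \<psi>1 (star A ?h) - \<psi>1 ?h + \<psi>1 ?h"
      by (intro tendsto_intros star_lim lim sq_lim h y)
    moreover have "\<psi> ?h - ip \<psi> ?h (a n) - ip \<psi> (a n) ?h + ip \<psi> (y \<otimes> a n) (y \<otimes> a n)
        = ip \<psi> (y \<otimes> (\<one> \<ominus> a n)) (y \<otimes> (\<one> \<ominus> a n))" for n
    proof -
      have "y \<otimes> (\<one> \<ominus> a n) = y \<ominus> y \<otimes> a n"
        using y a by (simp add: a_minus_def r_distr r_minus)
      moreover have "ip \<psi> ?h (a n) = ip \<psi> y (y \<otimes> a n)" "ip \<psi> (a n) ?h = ip \<psi> (y \<otimes> a n) y"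
        using y a by (simp_all add: ip_def star_mult m_assoc)
      moreover have "\<psi> ?h = ip \<psi> y y" by (simp add: ip_def)
      ultimately show ?thesis using y a by (simp add: ip_linear[OF d])
    qed
    ultimately have "(\<lambda>n. ip \<psi> (y \<otimes> (\<one> \<ominus> a n)) (y \<otimes> (\<one> \<ominus> a n))) \<longlonglongrightarrow> \<psi>2 ?h"
      using h by (simp add: psi2)
    moreover have "ip \<psi> (y \<otimes> (\<one> \<ominus> a n)) (y \<otimes> (\<one> \<ominus> a n)) \<in> \<real>\<^sub>\<ge>\<^sub>0" for n
      using \<psi> y a by (simp add: posf_def ip_def)
    ultimately show "\<psi>2 ?h \<in> \<real>\<^sub>\<ge>\<^sub>0"
      by (intro Lim_in_closed_set[OF closed_nonneg_Reals_complex]) auto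
  qed
  have sum: "\<psi> = fadd \<psi>1 \<psi>2"
    by (rule dual_eqI) (use d d1 d2 psi2 in auto)
  have "sing \<psi>2"
    unfolding sing_def
  proof (intro conjI pos2 ballI allI impI)
    fix \<nu> C y
    assume \<nu>: "\<nu> \<in> N" and dom2: "dominated \<psi>2 C \<nu>" and y: "y \<in> carrier A"
    have "dominated \<psi> C \<nu>"
      using dom2 sn_fadd_ge(2)[OF pos1 pos2] unfolding sum by (rule dominated_mono)
    then have \<nu>_lim: "(\<lambda>n. \<nu> (y \<otimes> a n)) \<longlonglongrightarrow> \<nu> y" using orth'[OF \<nu> _ y] by blast
    \<comment> \<open>For \<psi>2 the sequence \<open>a n\<close> tends weakly to 0, while \<nu> in
      N forces \<nu>(y a n) to tend to \<nu>(y); this leaves no room for \<nu>.\<close>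
    have vanish: "(\<lambda>n. \<psi>2 (z \<otimes> a n)) \<longlonglongrightarrow> 0" if z: "z \<in> carrier A" for z
    proof -
      have "(\<lambda>n. ip \<psi> (star A z) (a n) - \<psi>1 (z \<otimes> a n)) \<longlonglongrightarrow> \<psi>1 (star A (star A z)) - \<psi>1 z"
        using z by (intro tendsto_diff star_lim orth'[OF \<open>\<psi>1 \<in> N\<close> dom1]) auto
      then show ?thesis using z a by (simp add: psi2 ip_def)
    qed
    have bound: "sn \<psi>2 (y \<otimes> a n) \<le> cnorm A y * B" for n
    proof -
      have "sn \<psi>2 (y \<otimes> a n) \<le> sn \<psi> (y \<otimes> a n)"
        using sn_fadd_ge(2)[OF pos1 pos2] y a sum by auto
      also have "\<dots> \<le> cnorm A y * B"
        using sn_mult_le[OF \<psi> y a[of n]] mult_left_mono[OF B[of n] cnorm_nonneg[OF y]] by linarith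
      finally show ?thesis .
    qed
    have "cmod (\<nu> y) \<le> 0"
    proof (rule le_if_le_add_mult)
      fix e :: real assume e: "0 < e"
      obtain b where b: "b \<in> carrier A"
        and ba: "\<And>x. x \<in> carrier A \<Longrightarrow> cmod (\<nu> x - ip \<psi>2 b x) \<le> e * sn \<psi>2 x"
        using riesz_approx[OF pos2 dom2 e] by blast
      have "ip \<psi>2 b (y \<otimes> a n) = \<psi>2 ((star A b \<otimes> y) \<otimes> a n)" for n
        using a b y by (simp add: ip_def m_assoc)
      then have "(\<lambda>n. ip \<psi>2 b (y \<otimes> a n)) \<longlonglongrightarrow> 0"
        using vanish[of "star A b \<otimes> y"] b y by simp
      from tendsto_diff[OF \<nu>_lim this]
      have "(\<lambda>n. cmod (\<nu> (y \<otimes> a n) - ip \<psi>2 b (y \<otimes> a n))) \<longlonglongrightarrow> cmod (\<nu> y)"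
        using tendsto_norm by fastforce
      moreover have "cmod (\<nu> (y \<otimes> a n) - ip \<psi>2 b (y \<otimes> a n)) \<le> e * (cnorm A y * B)" for n
        using order_trans[OF ba mult_left_mono[OF bound]] y a e by simp
      ultimately show "cmod (\<nu> y) \<le> 0 + e * (cnorm A y * B)"
        by (intro LIMSEQ_le_const2[where X = "\<lambda>n. cmod (\<nu> (y \<otimes> a n) - ip \<psi>2 b (y \<otimes> a n))"]) auto
    qed
    then show "\<nu> y = 0" by simp
  qed
  then show ?thesis using that[OF pos1 \<open>\<psi>1 \<in> N\<close> _ sum] by blast
qed

text \<open>\<psi> is approximated by \<open>ip \<rho> b\<close> for some b. So the vector
  functional of \<open>a n\<close> for \<psi> is nearly the one for \<rho> translated by b, and
  \<nu>1 is a norm limit of left translates \<open>lact b \<nu>\<close>, which N contains.\<close>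

lemma restrict_dominated:
  assumes \<psi>: "posf \<psi>" and \<rho>: "posf \<rho>" and le: "\<And>x. x \<in> carrier A \<Longrightarrow> sn \<psi> x \<le> sn \<rho> x"
    and a: "\<And>n::nat. a n \<in> carrier A" and \<eta>: "\<eta> \<longlonglongrightarrow> 0"
    and \<nu>: "\<nu> \<in> N" and \<nu>a: "\<And>n x. x \<in> carrier A \<Longrightarrow> cmod (\<nu> x - ip \<rho> (a n) x) \<le> \<eta> n * sn \<rho> x"
    and \<nu>1: "\<nu>1 \<in> dual A"
    and \<nu>1a: "\<And>n x. x \<in> carrier A \<Longrightarrow> cmod (\<nu>1 x - ip \<psi> (a n) x) \<le> \<eta> n * sn \<psi> x"
    and B: "\<And>n. sn \<rho> (a n) \<le> B"
  shows "\<nu>1 \<in> N"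
proof (rule N_closed[OF \<nu>1])
  fix e :: real assume e: "0 < e"
  have d: "\<psi> \<in> dual A" "\<rho> \<in> dual A" using \<psi> \<rho> by (auto simp: posf_dual)
  have B0: "0 \<le> B" using order_trans[OF ip_self(2)[OF \<rho> a] B] .
  \<comment> \<open>The error below is \<epsilon> times a \<rho>-seminorm of at most B times the
    norm of x; B + 1 excludes division by zero.\<close>
  define \<epsilon> where "\<epsilon> = e / (B + 1)"
  have \<epsilon>: "0 < \<epsilon>" "\<epsilon> * B \<le> e" using e B0 by (auto simp: \<epsilon>_def divide_simps)
  have "dominated \<rho> (sn \<psi> \<one>) \<psi>"
    unfolding dominated_def
  proof (intro conjI ballI d)
    show "0 \<le> sn \<psi> \<one>" using ip_self(2)[OF \<psi>] by simp
    then show "cmod (\<psi> x) \<le> sn \<psi> \<one> * sn \<rho> x" if "x \<in> carrier A" for x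
      using ip_le[OF \<psi>, of \<one> x] le[OF that] that mult_left_mono[OF le[OF that], of "sn \<psi> \<one>"]
      by simp
  qed
  then obtain b where b: "b \<in> carrier A"
    and ba: "\<And>x. x \<in> carrier A \<Longrightarrow> cmod (\<psi> x - ip \<rho> b x) \<le> \<epsilon> * sn \<rho> x"
    using riesz_approx[OF \<rho> _ \<epsilon>(1)] by blast
  have "cmod (\<nu>1 x - lact b \<nu> x) \<le> e * cnorm A x" if x: "x \<in> carrier A" for x
  proof -
    have near: "cmod (ip \<psi> (a n) x - ip \<rho> (a n) (x \<otimes> b)) \<le> e * cnorm A x" for n
    proof -
      let ?y = "star A x \<otimes> a n"
      have y: "?y \<in> carrier A" using x a by simp
      have "ip \<psi> (a n) x = cnj (\<psi> ?y)"
        using ip_commute[OF \<psi> x a[of n]] by (simp add: ip_def)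
      moreover have "ip \<rho> (a n) (x \<otimes> b) = cnj (ip \<rho> b ?y)"
        using ip_commute[OF \<rho> _ a[of n], of "x \<otimes> b"] x a b
        by (simp add: ip_def star_mult m_assoc)
      ultimately have "cmod (ip \<psi> (a n) x - ip \<rho> (a n) (x \<otimes> b)) = cmod (\<psi> ?y - ip \<rho> b ?y)"
        by (metis complex_cnj_diff complex_mod_cnj)
      also have "\<dots> \<le> \<epsilon> * sn \<rho> ?y" by (rule ba[OF y])
      also have "\<dots> \<le> \<epsilon> * (cnorm A x * B)"
        using sn_mult_le[OF \<rho> _ a[of n], of "star A x"] x \<epsilon>(1) B[of n]
          mult_left_mono[OF B[of n] cnorm_nonneg[OF x]]
        by (intro mult_left_mono) (auto simp: cnorm_star)
      also have "\<dots> \<le> e * cnorm A x"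
        using mult_right_mono[OF \<epsilon>(2) cnorm_nonneg[OF x]] by (simp add: mult_ac)
      finally show ?thesis .
    qed
    define r where "r = sn \<psi> x + sn \<rho> (x \<otimes> b)"
    have "cmod (\<nu>1 x - \<nu> (x \<otimes> b)) \<le> \<eta> n * r + e * cnorm A x" for n
    proof -
      have "cmod (\<nu>1 x - \<nu> (x \<otimes> b)) \<le> cmod (\<nu>1 x - ip \<psi> (a n) x)
          + cmod (ip \<psi> (a n) x - ip \<rho> (a n) (x \<otimes> b)) + cmod (\<nu> (x \<otimes> b) - ip \<rho> (a n) (x \<otimes> b))"
        using norm_triangle_ineq[of "\<nu>1 x - ip \<psi> (a n) x" "ip \<psi> (a n) x - ip \<rho> (a n) (x \<otimes> b)"]
          norm_triangle_ineq4[of "\<nu>1 x - ip \<rho> (a n) (x \<otimes> b)"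
            "\<nu> (x \<otimes> b) - ip \<rho> (a n) (x \<otimes> b)"] by simp
      then show ?thesis
        using \<nu>1a[OF x, of n] \<nu>a[of "x \<otimes> b" n] near[of n] x b
        by (simp add: r_def distrib_left)
    qed
    moreover have "(\<lambda>n. \<eta> n * r + e * cnorm A x) \<longlonglongrightarrow> 0 * r + e * cnorm A x"
      by (intro tendsto_intros \<eta>)
    ultimately have "cmod (\<nu>1 x - \<nu> (x \<otimes> b)) \<le> 0 * r + e * cnorm A x"
      by (intro LIMSEQ_le_const) auto
    then show ?thesis using x by simp
  qed
  then show "\<exists>\<nu>\<in>N. \<forall>x\<in>carrier A. cmod (\<nu>1 x - \<nu> x) \<le> e * cnorm A x"
    using N_left[OF \<nu> b] by blast
qed

text \<open>If \<nu> in N is dominated by the sum, a Riesz sequence of \<nu> converges also for each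
  summand. Both limits lie in N by \<open>restrict_dominated\<close>, hence vanish by singularity,
  and \<nu> is their sum.\<close>

lemma sing_fadd:
  assumes s: "sing \<psi>" "sing \<psi>'"
  shows "sing (fadd \<psi> \<psi>')"
  unfolding sing_def
proof (intro conjI ballI allI impI)
  have pos: "posf \<psi>" "posf \<psi>'" using s by (auto simp: sing_def)
  show \<rho>: "posf (fadd \<psi> \<psi>')" using posf_fadd[OF pos] .
  fix \<nu> C x
  assume \<nu>: "\<nu> \<in> N" and dom: "dominated (fadd \<psi> \<psi>') C \<nu>" and x: "x \<in> carrier A"
  obtain a where a: "\<And>n::nat. a n \<in> carrier A"
    and approx: "\<And>n x. x \<in> carrier A \<Longrightarrow>
      cmod (\<nu> x - ip (fadd \<psi> \<psi>') (a n) x) \<le> 1 / (real n + 1) * sn (fadd \<psi> \<psi>') x"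
    and B: "\<And>n. sn (fadd \<psi> \<psi>') (a n) \<le> C + 1"
    and cauchy: "\<And>m n. n \<le> m \<Longrightarrow> sn (fadd \<psi> \<psi>') (a m \<ominus> a n) \<le> 2 / (real n + 1)"
    using riesz_sequence[OF \<rho> dom] by blast
  have zero: "\<exists>\<nu>1. (\<lambda>n. ip \<theta> (a n) x) \<longlonglongrightarrow> \<nu>1 x \<and> \<nu>1 x = 0"
    if \<theta>: "sing \<theta>" and le: "\<And>x. x \<in> carrier A \<Longrightarrow> sn \<theta> x \<le> sn (fadd \<psi> \<psi>') x" for \<theta>
  proof -
    have \<theta>pos: "posf \<theta>" using \<theta> by (simp add: sing_def)
    have c: "sn \<theta> (a m \<ominus> a n) \<le> 2 / (real n + 1)" if "n \<le> m" for m n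
      using le[of "a m \<ominus> a n"] cauchy[OF that] a by (meson minus_closed order_trans)
    obtain \<nu>1 D where \<nu>1: "dominated \<theta> D \<nu>1"
      "\<And>x. x \<in> carrier A \<Longrightarrow> (\<lambda>n. ip \<theta> (a n) x) \<longlonglongrightarrow> \<nu>1 x"
      "\<And>n x. x \<in> carrier A \<Longrightarrow> cmod (\<nu>1 x - ip \<theta> (a n) x) \<le> 2 / (real n + 1) * sn \<theta> x"
      "\<And>n. sn \<theta> (a n) \<le> D"
      using limit_functional[OF \<theta>pos a c inverse_Suc_tendsto] by blast
    have "\<nu>1 \<in> N"
    proof (rule restrict_dominated[OF \<theta>pos \<rho> le a inverse_Suc_tendsto \<nu> _ dominated_dual[OF \<nu>1(1)] \<nu>1(3) B])
      show "cmod (\<nu> x - ip (fadd \<psi> \<psi>') (a n) x) \<le> 2 / (real n + 1) * sn (fadd \<psi> \<psi>') x"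
        if x: "x \<in> carrier A" for n x
      proof (rule order_trans[OF approx[OF x] mult_right_mono])
        show "1 / (real n + 1) \<le> 2 / (real n + 1)" by (simp add: divide_right_mono)
      qed (rule ip_self(2)[OF \<rho> x])
    qed
    then have "\<nu>1 x = 0" using \<theta> \<nu>1(1) x by (auto simp: sing_def)
    then show ?thesis using \<nu>1(2)[OF x] by blast
  qed
  have "(\<lambda>n. ip \<psi> (a n) x) \<longlonglongrightarrow> 0" "(\<lambda>n. ip \<psi>' (a n) x) \<longlonglongrightarrow> 0"
    using zero[OF s(1) sn_fadd_ge(1)[OF pos]] zero[OF s(2) sn_fadd_ge(2)[OF pos]] by auto
  then have "(\<lambda>n. ip \<psi> (a n) x + ip \<psi>' (a n) x) \<longlonglongrightarrow> 0 + 0" by (rule tendsto_add)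
  moreover have "ip \<psi> (a n) x + ip \<psi>' (a n) x = ip (fadd \<psi> \<psi>') (a n) x" for n
    using a x by (simp add: ip_def)
  moreover have "(\<lambda>n. \<nu> x - ip (fadd \<psi> \<psi>') (a n) x) \<longlonglongrightarrow> 0"
  proof (rule Lim_null_comparison)
    show "(\<lambda>n. 1 / (real n + 1) * sn (fadd \<psi> \<psi>') x) \<longlonglongrightarrow> 0"
      using tendsto_mult_right[OF inverse_Suc_tendsto[of 1], of "sn (fadd \<psi> \<psi>') x"] by simp
    show "\<forall>\<^sub>F n in sequentially. norm (\<nu> x - ip (fadd \<psi> \<psi>') (a n) x)
        \<le> 1 / (real n + 1) * sn (fadd \<psi> \<psi>') x" using approx[OF x] by simp
  qed
  ultimately have "(\<lambda>n. (\<nu> x - ip (fadd \<psi> \<psi>') (a n) x) + ip (fadd \<psi> \<psi>') (a n) x) \<longlonglongrightarrow> 0 + 0"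
    by (intro tendsto_add) auto
  then show "\<nu> x = 0" by (simp add: LIMSEQ_const_iff)
qed

section \<open>Decomposition of the dual into N and its singular complement\<close>

definition Sing :: "('a \<Rightarrow> complex) set" where
  "Sing = {\<phi>. \<exists>\<psi> C. sing \<psi> \<and> dominated \<psi> C \<phi>}"

lemma Sing_dual: "\<phi> \<in> Sing \<Longrightarrow> \<phi> \<in> dual A"
  by (auto simp: Sing_def dominated_dual)

lemma dominated_fadd:
  assumes "posf \<psi>" "dominated \<psi> C \<xi>" "dominated \<psi> D \<theta>"
  shows "dominated \<psi> (C + D) (fadd \<xi> \<theta>)"
  unfolding dominated_def
proof (intro conjI ballI)
  fix x assume x: "x \<in> carrier A"
  have "cmod (\<xi> x) \<le> C * sn \<psi> x" "cmod (\<theta> x) \<le> D * sn \<psi> x"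
    using assms x by (auto simp: dominated_def)
  then show "cmod (fadd \<xi> \<theta> x) \<le> (C + D) * sn \<psi> x"
    using norm_triangle_ineq[of "\<xi> x" "\<theta> x"] x by (simp add: distrib_right)
qed (use assms in \<open>auto simp: dominated_def\<close>)

lemma Sing_fadd:
  assumes "\<phi> \<in> Sing" "\<theta> \<in> Sing"
  shows "fadd \<phi> \<theta> \<in> Sing"
proof -
  obtain \<psi> C \<psi>' C' where *: "sing \<psi>" "dominated \<psi> C \<phi>" "sing \<psi>'" "dominated \<psi>' C' \<theta>"
    using assms unfolding Sing_def by blast
  then have pos: "posf \<psi>" "posf \<psi>'" by (auto simp: sing_def)
  have "dominated (fadd \<psi> \<psi>') (C + C') (fadd \<phi> \<theta>)"
    using dominated_fadd[OF posf_fadd[OF pos] dominated_mono[OF *(2) sn_fadd_ge(1)[OF pos]]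
        dominated_mono[OF *(4) sn_fadd_ge(2)[OF pos]]] .
  then show ?thesis using sing_fadd[OF *(1,3)] unfolding Sing_def by blast
qed

lemma Sing_fscale:
  assumes "\<phi> \<in> Sing"
  shows "fscale c \<phi> \<in> Sing"
proof -
  obtain \<psi> C where *: "sing \<psi>" "dominated \<psi> C \<phi>" using assms unfolding Sing_def by blast
  have "dominated \<psi> (cmod c * C) (fscale c \<phi>)"
    using *(2) unfolding dominated_def by (auto simp: norm_mult mult.assoc intro!: mult_left_mono)
  then show ?thesis using * unfolding Sing_def by blast
qed

lemma Sing_dual_act: "\<lbrakk>\<phi> \<in> Sing; a \<in> carrier A\<rbrakk> \<Longrightarrow> dual_act A \<phi> a \<in> Sing"
  using dominated_dual_act unfolding Sing_def sing_def by blast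

lemma N_Sing_zero: "\<lbrakk>\<nu> \<in> N; \<nu> \<in> Sing; x \<in> carrier A\<rbrakk> \<Longrightarrow> \<nu> x = 0"
  unfolding Sing_def sing_def by blast

text \<open>The dominating \<psi> is split, and one Riesz sequence of \<phi> is read in both
  summands. In the constant 4, one 2 is the error at index 0 and the other is the bound 1 + 1 on the
  vector \<open>a 0\<close>; its finiteness makes the N-part depend boundedly on \<phi>.\<close>

lemma lebesgue_decomposition:
  assumes \<phi>: "\<phi> \<in> dual A"
  obtains \<nu> \<theta> where "\<nu> \<in> N" "\<theta> \<in> Sing" "\<phi> = fadd \<nu> \<theta>"
    "\<And>x. x \<in> carrier A \<Longrightarrow> cmod (\<nu> x) \<le> 4 * dual_norm A \<phi> * cnorm A x"
proof -
  obtain \<psi> where \<psi>: "posf \<psi>" and dom: "dominated \<psi> 1 \<phi>" and norm: "Re (\<psi> \<one>) \<le> (dual_norm A \<phi>)\<^sup>2"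
    using dominated_by_positive[OF \<phi>] by blast
  have s1: "sn \<psi> \<one> \<le> dual_norm A \<phi>"
    using norm sn_one[OF \<psi>] dual_norm_nonneg[OF \<phi>] power2_le_imp_le by metis
  obtain \<psi>1 \<psi>2 where pos1: "posf \<psi>1" and \<psi>1N: "\<psi>1 \<in> N" and sing2: "sing \<psi>2"
    and sum: "\<psi> = fadd \<psi>1 \<psi>2"
    using lebesgue_decomposition_positive[OF \<psi>] by blast
  have pos2: "posf \<psi>2" using sing2 by (simp add: sing_def)
  obtain a where a: "\<And>n::nat. a n \<in> carrier A"
    and approx: "\<And>n x. x \<in> carrier A \<Longrightarrow> cmod (\<phi> x - ip \<psi> (a n) x) \<le> 1 / (real n + 1) * sn \<psi> x"
    and B: "\<And>n. sn \<psi> (a n) \<le> 1 + 1"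
    and cauchy: "\<And>m n. n \<le> m \<Longrightarrow> sn \<psi> (a m \<ominus> a n) \<le> 2 / (real n + 1)"
    using riesz_sequence[OF \<psi> dom] by blast
  have le1: "sn \<psi>1 x \<le> sn \<psi> x" and le2: "sn \<psi>2 x \<le> sn \<psi> x" if "x \<in> carrier A" for x
    using sn_fadd_ge[OF pos1 pos2 that] sum by auto
  have c1: "sn \<psi>1 (a m \<ominus> a n) \<le> 2 / (real n + 1)"
    and c2: "sn \<psi>2 (a m \<ominus> a n) \<le> 2 / (real n + 1)" if "n \<le> m" for m n
    using le1[of "a m \<ominus> a n"] le2[of "a m \<ominus> a n"] cauchy[OF that] a
    by (meson minus_closed order_trans)+
  obtain \<nu> D where dom1: "dominated \<psi>1 D \<nu>"
    and lim1: "\<And>x. x \<in> carrier A \<Longrightarrow> (\<lambda>n. ip \<psi>1 (a n) x) \<longlonglongrightarrow> \<nu> x"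
    and approx1: "\<And>n x. x \<in> carrier A \<Longrightarrow> cmod (\<nu> x - ip \<psi>1 (a n) x) \<le> 2 / (real n + 1) * sn \<psi>1 x"
    and "\<And>n. sn \<psi>1 (a n) \<le> D"
    using limit_functional[OF pos1 a c1 inverse_Suc_tendsto] by blast
  obtain \<theta> E where dom2: "dominated \<psi>2 E \<theta>"
    and lim2: "\<And>x. x \<in> carrier A \<Longrightarrow> (\<lambda>n. ip \<psi>2 (a n) x) \<longlonglongrightarrow> \<theta> x"
    and "\<And>n x. x \<in> carrier A \<Longrightarrow> cmod (\<theta> x - ip \<psi>2 (a n) x) \<le> 2 / (real n + 1) * sn \<psi>2 x"
    and "\<And>n. sn \<psi>2 (a n) \<le> E"
    using limit_functional[OF pos2 a c2 inverse_Suc_tendsto] by blast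
  have \<nu>d: "\<nu> \<in> dual A" "\<theta> \<in> dual A" using dom1 dom2 by (auto simp: dominated_dual)
  have "\<nu> \<in> N"
  \<comment> \<open>Each \<open>vec \<psi>1 (a n)\<close> is a right translate of \<psi>1, hence in
    N.\<close>
  proof (rule N_limit[where \<nu> = "\<lambda>n. vec \<psi>1 (a n)"])
    show "(\<lambda>n. (2 * sn \<psi>1 \<one>) / (real n + 1)) \<longlonglongrightarrow> 0" by (rule inverse_Suc_tendsto)
    show "cmod (\<nu> x - vec \<psi>1 (a n) x) \<le> (2 * sn \<psi>1 \<one>) / (real n + 1) * cnorm A x"
      if x: "x \<in> carrier A" for n x
      using order_trans[OF approx1[OF x] mult_left_mono[OF sn_le[OF pos1 x]]] x by (simp add: mult_ac)
  qed (use a \<psi>1N N_right \<nu>d in \<open>auto simp: vec_def\<close>)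
  moreover have "\<theta> \<in> Sing" using sing2 dom2 unfolding Sing_def by blast
  moreover have "\<phi> = fadd \<nu> \<theta>"
  proof (rule dual_eqI[OF \<phi>])
    fix x assume x: "x \<in> carrier A"
    have "(\<lambda>n. \<phi> x - ip \<psi> (a n) x) \<longlonglongrightarrow> 0"
    proof (rule Lim_null_comparison)
      show "(\<lambda>n. 1 / (real n + 1) * sn \<psi> x) \<longlonglongrightarrow> 0"
        using tendsto_mult_right[OF inverse_Suc_tendsto[of 1], of "sn \<psi> x"] by simp
    qed (use approx[OF x] in simp)
    moreover have "(\<lambda>n. ip \<psi>1 (a n) x + ip \<psi>2 (a n) x) \<longlonglongrightarrow> \<nu> x + \<theta> x"
      using lim1[OF x] lim2[OF x] by (rule tendsto_add)
    ultimately have "(\<lambda>n. (\<phi> x - ip \<psi> (a n) x) + (ip \<psi>1 (a n) x + ip \<psi>2 (a n) x)) \<longlonglongrightarrow> 0 + (\<nu> x + \<theta> x)"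
      by (rule tendsto_add)
    moreover have "ip \<psi> (a n) x = ip \<psi>1 (a n) x + ip \<psi>2 (a n) x" for n
      using a x by (simp add: sum ip_def)
    ultimately show "\<phi> x = fadd \<nu> \<theta> x" using x by (simp add: LIMSEQ_const_iff)
  qed (use \<nu>d in auto)
  moreover have "cmod (\<nu> x) \<le> 4 * dual_norm A \<phi> * cnorm A x" if x: "x \<in> carrier A" for x
  proof -
    have "cmod (\<nu> x) \<le> cmod (\<nu> x - ip \<psi>1 (a 0) x) + cmod (ip \<psi>1 (a 0) x)"
      using norm_triangle_ineq[of "\<nu> x - ip \<psi>1 (a 0) x" "ip \<psi>1 (a 0) x"] by simp
    also have "\<dots> \<le> 2 * sn \<psi>1 x + sn \<psi>1 (a 0) * sn \<psi>1 x"
      using approx1[OF x, of 0] ip_le[OF pos1 a[of 0] x] by simp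
    also have "\<dots> \<le> 2 * sn \<psi>1 x + 2 * sn \<psi>1 x"
      using le1[OF a[of 0]] B[of 0] ip_self(2)[OF pos1 x]
      by (intro add_left_mono mult_right_mono) auto
    also have "\<dots> \<le> 4 * (cnorm A x * dual_norm A \<phi>)"
      using le1[OF x] sn_le[OF \<psi> x] mult_left_mono[OF s1 cnorm_nonneg[OF x]] by linarith
    finally show ?thesis by (simp add: mult_ac)
  qed
  ultimately show ?thesis using that by blast
qed

lemma decomposition_unique:
  assumes "\<nu> \<in> N" "\<theta> \<in> Sing" "\<nu>' \<in> N" "\<theta>' \<in> Sing" "fadd \<nu> \<theta> = fadd \<nu>' \<theta>'"
  shows "\<nu> = \<nu>'"
proof (rule dual_eqI)
  show d: "\<nu> \<in> dual A" "\<nu>' \<in> dual A" using assms N_dual by auto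
  let ?d = "fadd \<nu> (fscale (- 1) \<nu>')"
  have eq: "\<nu> x + \<theta> x = \<nu>' x + \<theta>' x" if "x \<in> carrier A" for x
    using fun_cong[OF assms(5), of x] that by simp
  have "?d = fadd \<theta>' (fscale (- 1) \<theta>)"
    using d assms Sing_dual eq by (intro dual_eqI) (auto simp: algebra_simps)
  then have "?d \<in> Sing" using assms Sing_fadd Sing_fscale by simp
  moreover have "?d \<in> N" using assms N_add N_scale by simp
  ultimately show "\<nu> x = \<nu>' x" if "x \<in> carrier A" for x
    using N_Sing_zero[of ?d x] that by simp
qed

text \<open>p takes the N-part of \<phi> at the unit. Uniqueness of the decomposition makes the
  N-part linear and compatible with the right action, so acting by p on the dual is exactly taking
  the N-part.\<close>

lemma support_element:
  obtains p where "p \<in> bd" "\<And>\<phi>. \<phi> \<in> dual A \<Longrightarrow> bidual_act A p \<phi> \<in> N"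
    "\<And>\<nu>. \<nu> \<in> N \<Longrightarrow> p \<nu> = \<nu> \<one>"
proof -
  have "\<forall>\<phi>\<in>dual A. \<exists>\<nu>. \<nu> \<in> N \<and> (\<exists>\<theta>\<in>Sing. \<phi> = fadd \<nu> \<theta>)
      \<and> (\<forall>x\<in>carrier A. cmod (\<nu> x) \<le> 4 * dual_norm A \<phi> * cnorm A x)"
    using lebesgue_decomposition by metis
  then obtain P where P: "\<And>\<phi>. \<phi> \<in> dual A \<Longrightarrow> P \<phi> \<in> N"
    "\<And>\<phi>. \<phi> \<in> dual A \<Longrightarrow> \<exists>\<theta>\<in>Sing. \<phi> = fadd (P \<phi>) \<theta>"
    "\<And>\<phi> x. \<lbrakk>\<phi> \<in> dual A; x \<in> carrier A\<rbrakk> \<Longrightarrow> cmod (P \<phi> x) \<le> 4 * dual_norm A \<phi> * cnorm A x"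
    by metis
  have P_eq: "P \<phi> = \<nu>" if "\<nu> \<in> N" "\<theta> \<in> Sing" "\<phi> = fadd \<nu> \<theta>" for \<phi> \<nu> \<theta>
  proof -
    have "\<phi> \<in> dual A" using that N_in_dual Sing_dual by auto
    then show ?thesis using P[of \<phi>] decomposition_unique[of "P \<phi>" _ \<nu> \<theta>] that by metis
  qed
  have P_dual: "P \<phi> \<in> dual A" if "\<phi> \<in> dual A" for \<phi> using P(1)[OF that] N_dual by blast
  define p where "p = (\<lambda>\<phi>\<in>dual A. P \<phi> \<one>)"
  have "p \<in> bd"
  proof (rule bidualI[where C = "4 * cnorm A \<one>"])
    show "p \<in> extensional (dual A)" by (simp add: p_def)
    show "p (fadd \<phi> \<psi>) = p \<phi> + p \<psi>" if \<phi>\<psi>: "\<phi> \<in> dual A" "\<psi> \<in> dual A" for \<phi> \<psi>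
    proof -
      obtain \<theta> \<theta>' where t: "\<theta> \<in> Sing" "\<theta>' \<in> Sing" "\<phi> = fadd (P \<phi>) \<theta>" "\<psi> = fadd (P \<psi>) \<theta>'"
        using P(2) \<phi>\<psi> by metis
      have "P (fadd \<phi> \<psi>) = fadd (P \<phi>) (P \<psi>)"
      proof (rule P_eq[OF N_add[OF P(1) P(1)] Sing_fadd[OF t(1,2)]])
        show "fadd \<phi> \<psi> = fadd (fadd (P \<phi>) (P \<psi>)) (fadd \<theta> \<theta>')"
          using \<phi>\<psi> P_dual t(1,2) Sing_dual fun_cong[OF t(3)] fun_cong[OF t(4)]
          by (intro dual_eqI) auto
      qed (use \<phi>\<psi> in auto)
      then show ?thesis using \<phi>\<psi> by (simp add: p_def)
    qed
    show "p (fscale c \<phi>) = c * p \<phi>" if \<phi>: "\<phi> \<in> dual A" for c \<phi>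
    proof -
      obtain \<theta> where t: "\<theta> \<in> Sing" "\<phi> = fadd (P \<phi>) \<theta>" using P(2) \<phi> by metis
      have "P (fscale c \<phi>) = fscale c (P \<phi>)"
      proof (rule P_eq[OF N_scale[OF P(1)] Sing_fscale[OF t(1)]])
        show "fscale c \<phi> = fadd (fscale c (P \<phi>)) (fscale c \<theta>)"
          using \<phi> P_dual t(1) Sing_dual fun_cong[OF t(2)]
          by (intro dual_eqI) (auto simp: distrib_left[symmetric])
      qed (use \<phi> in auto)
      then show ?thesis using \<phi> by (simp add: p_def)
    qed
    show "cmod (p \<phi>) \<le> 4 * cnorm A \<one> * dual_norm A \<phi>" if "\<phi> \<in> dual A" for \<phi>
      using P(3)[OF that, of \<one>] that by (simp add: p_def mult_ac)
  qed
  moreover have "bidual_act A p \<phi> \<in> N" if \<phi>: "\<phi> \<in> dual A" for \<phi>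
  proof -
    obtain \<theta> where t: "\<theta> \<in> Sing" "\<phi> = fadd (P \<phi>) \<theta>" using P(2) \<phi> by metis
    have "bidual_act A p \<phi> = P \<phi>"
    proof (rule dual_eqI)
      fix a assume a: "a \<in> carrier A"
      have "P (dual_act A \<phi> a) = dual_act A (P \<phi>) a"
      proof (rule P_eq[OF N_right[OF P(1)] Sing_dual_act[OF t(1) a]])
        show "dual_act A \<phi> a = fadd (dual_act A (P \<phi>) a) (dual_act A \<theta> a)"
          using \<phi> P_dual t(1) Sing_dual a fun_cong[OF t(2)] by (intro dual_eqI) auto
      qed (use \<phi> a in auto)
      then show "bidual_act A p \<phi> a = P \<phi> a" using \<phi> a by (simp add: p_def)
    qed (use \<phi> P_dual \<open>p \<in> bd\<close> in auto)
    then show ?thesis using P(1)[OF \<phi>] by simp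
  qed
  moreover have "p \<nu> = \<nu> \<one>" if \<nu>: "\<nu> \<in> N" for \<nu>
  proof -
    obtain \<theta> where "\<theta> \<in> Sing" using P(2)[OF N_in_dual[OF \<nu>]] by blast
    then have z: "fscale 0 \<theta> \<in> Sing" by (rule Sing_fscale)
    have "P \<nu> = \<nu>"
    proof (rule P_eq[OF \<nu> z])
      show "\<nu> = fadd \<nu> (fscale 0 \<theta>)"
        using N_in_dual[OF \<nu>] Sing_dual[OF z] by (intro dual_eqI) auto
    qed
    then show ?thesis using N_in_dual[OF \<nu>] by (simp add: p_def)
  qed
  ultimately show ?thesis using that by blast
qed

text \<open>A product x p depends only on the restriction of x to N, and on N the elements p, its
  adjoint and the unit agree. The projection property and centrality are both read off from
  this.\<close>

lemma central_projection:
  obtains p where "projection (bidual A) p" "p \<in> centre (bidual A)"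
    "\<And>\<phi>. \<phi> \<in> dual A \<Longrightarrow> bidual_act A p \<phi> \<in> N"
    "\<And>\<nu>. \<nu> \<in> N \<Longrightarrow> p \<nu> = \<nu> \<one>"
proof -
  obtain p where p: "p \<in> bd" and range: "\<And>\<phi>. \<phi> \<in> dual A \<Longrightarrow> bidual_act A p \<phi> \<in> N"
    and p_N: "\<And>\<nu>. \<nu> \<in> N \<Longrightarrow> p \<nu> = \<nu> \<one>"
    using support_element by blast
  let ?m = "\<lambda>x y. x \<otimes>\<^bsub>bidual A\<^esub> y"
  let ?s = "star (bidual A)"
  have agree: "?m x p = ?m y p"
    if "x \<in> bd" "y \<in> bd" "\<And>\<nu>. \<nu> \<in> N \<Longrightarrow> x \<nu> = y \<nu>" for x y
    by (rule bidual_eqI[OF bidual_mult_closed bidual_mult_closed])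
      (use that p range in \<open>auto simp: bidual_eqs(2)\<close>)
  have one_p: "?m \<one>\<^bsub>bidual A\<^esub> p = p"
  proof (rule bidual_eqI)
    fix \<phi> assume \<phi>: "\<phi> \<in> dual A"
    have "dual_act A \<phi> \<one> = \<phi>" by (rule dual_eqI) (use \<phi> in auto)
    then show "?m \<one>\<^bsub>bidual A\<^esub> p \<phi> = p \<phi>"
      using p \<phi> bidual_act_dual[OF p \<phi>] by (simp add: bidual_eqs(2,3))
  qed (use p in auto)
  have one_N: "\<one>\<^bsub>bidual A\<^esub> \<nu> = \<nu> \<one>" if "\<nu> \<in> N" for \<nu>
    using N_in_dual[OF that] by (simp add: bidual_eqs(3))
  have star_star_bd: "?s (?s x) = x" if "x \<in> bd" for x
    by (rule bidual_eqI[OF bidual_star_closed[OF bidual_star_closed]])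
      (use that in \<open>auto simp: bidual_eqs(4)\<close>)
  have "?m (?s p) p = ?m \<one>\<^bsub>bidual A\<^esub> p"
  proof (rule agree)
    fix \<nu> assume \<nu>: "\<nu> \<in> N"
    show "?s p \<nu> = \<one>\<^bsub>bidual A\<^esub> \<nu>"
      using p_N[OF N_star[OF \<nu>]] N_in_dual[OF \<nu>] one_N[OF \<nu>] by (simp add: bidual_eqs(4))
  qed (use p in auto)
  then have sp: "?m (?s p) p = p" using one_p by simp
  then have p_star: "?s p = p"
    using bidual_star_mult[of "?s p" p] p star_star_bd[OF p] by simp
  then have p_idem: "?m p p = p" using sp by simp
  \<comment> \<open>For \<nu> in N the functional \<open>bidual_act A x \<nu>\<close> is in N too,
    by approximation from the algebra and closedness; so p x and x agree on N.\<close>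
  have px: "?m (?m p x) p = ?m x p" if x: "x \<in> bd" for x
  proof (rule agree)
    fix \<nu> assume \<nu>: "\<nu> \<in> N"
    have "bidual_act A x \<nu> \<in> N"
    proof (rule N_closed)
      fix e :: real assume e: "0 < e"
      obtain c where "c \<in> carrier A"
        "\<And>y. y \<in> carrier A \<Longrightarrow> cmod (bidual_act A x \<nu> y - lact c \<nu> y) \<le> e * cnorm A y"
        using bidual_act_approx[OF x N_in_dual[OF \<nu>] e] by blast
      then show "\<exists>\<nu>'\<in>N. \<forall>y\<in>carrier A. cmod (bidual_act A x \<nu> y - \<nu>' y) \<le> e * cnorm A y"
        using N_left[OF \<nu>] by blast
    qed (use x N_in_dual[OF \<nu>] in auto)
    then have "?m p x \<nu> = bidual_act A x \<nu> \<one>"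
      using p_N N_in_dual[OF \<nu>] by (simp add: bidual_eqs(2))
    moreover have "dual_act A \<nu> \<one> = \<nu>" by (rule dual_eqI) (use N_in_dual[OF \<nu>] in auto)
    ultimately show "?m p x \<nu> = x \<nu>" by simp
  qed (use p x in auto)
  \<comment> \<open>Apply \<open>px\<close> to the adjoint of x and take adjoints.\<close>
  have comm: "?m p x = ?m x p" if x: "x \<in> bd" for x
  proof -
    have "?s (?m (?m p (?s x)) p) = ?s (?m (?s x) p)"
      using px[OF bidual_star_closed[OF x]] by simp
    then have "?m p (?m x p) = ?m p x"
      using p x by (simp add: bidual_star_mult p_star star_star_bd)
    then show ?thesis using px[OF x] bidual_mult_assoc[OF p x p] by simp
  qed
  have "projection (bidual A) p" using p p_idem p_star by (simp add: projection_def)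
  moreover have "p \<in> centre (bidual A)" unfolding centre_def using p comm by blast
  ultimately show ?thesis using that range p_N by blast
qed

end

section \<open>Trigonometric polynomials in L2 of the circle\<close>

inductive trig_poly :: "(complex \<Rightarrow> complex) \<Rightarrow> bool" where
  monomial: "trig_poly (\<lambda>z. z powi k)"
| add: "\<lbrakk>trig_poly f; trig_poly g\<rbrakk> \<Longrightarrow> trig_poly (\<lambda>z. f z + g z)"
| scale: "trig_poly f \<Longrightarrow> trig_poly (\<lambda>z. c * f z)"

text \<open>Agreement is asked for on the circle only, where 1/z is the conjugate of z and the
  exponent law holds for all integers.\<close>

definition circle_trig :: "(complex \<Rightarrow> complex) \<Rightarrow> bool" where
  "circle_trig f \<longleftrightarrow> (\<exists>p. trig_poly p \<and> (\<forall>z\<in>sphere 0 1. f z = p z))"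

lemma circle_trig_monomial: "circle_trig (\<lambda>z. z powi k)"
  unfolding circle_trig_def using trig_poly.monomial by blast

lemma circle_trig_add:
  assumes "circle_trig f" "circle_trig g"
  shows "circle_trig (\<lambda>z. f z + g z)"
proof -
  obtain p r where "trig_poly p" "trig_poly r" "\<forall>z\<in>sphere 0 1. f z = p z" "\<forall>z\<in>sphere 0 1. g z = r z"
    using assms unfolding circle_trig_def by blast
  then show ?thesis
    unfolding circle_trig_def using trig_poly.add[of p r] by (intro exI[of _ "\<lambda>z. p z + r z"]) auto
qed

lemma circle_trig_scale:
  assumes "circle_trig f"
  shows "circle_trig (\<lambda>z. c * f z)"
proof -
  obtain p where "trig_poly p" "\<forall>z\<in>sphere 0 1. f z = p z"
    using assms unfolding circle_trig_def by blast
  then show ?thesis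
    unfolding circle_trig_def using trig_poly.scale[of p c] by (intro exI[of _ "\<lambda>z. c * p z"]) auto
qed

lemma circle_trig_cong:
  "\<lbrakk>circle_trig f; \<And>z. z \<in> sphere 0 1 \<Longrightarrow> g z = f z\<rbrakk> \<Longrightarrow> circle_trig g"
  unfolding circle_trig_def by metis

lemma circle_trig_const: "circle_trig (\<lambda>z. c)"
  using circle_trig_scale[OF circle_trig_monomial[of 0], of c] by simp

lemma circle_trig_mult:
  assumes "circle_trig f" "circle_trig g"
  shows "circle_trig (\<lambda>z. f z * g z)"
proof -
  have mono: "circle_trig (\<lambda>z. z powi k * p z)" if "trig_poly p" for k p
    using that
  proof induction
    case (monomial j)
    show ?case
      by (rule circle_trig_cong[OF circle_trig_monomial[of "k + j"]]) (subst power_int_add, auto)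
  next
    case (add f g)
    show ?case
      by (rule circle_trig_cong[OF circle_trig_add[OF add.IH]]) (simp add: distrib_left)
  next
    case (scale f c)
    show ?case
      by (rule circle_trig_cong[OF circle_trig_scale[OF scale.IH, of c]]) simp
  qed
  have "circle_trig (\<lambda>z. q z * p z)" if "trig_poly p" "trig_poly q" for p q
    using that(2)
  proof induction
    case (monomial j)
    show ?case by (rule mono[OF that(1)])
  next
    case (add f g)
    show ?case
      by (rule circle_trig_cong[OF circle_trig_add[OF add.IH]]) (simp add: distrib_right)
  next
    case (scale f c)
    show ?case
      by (rule circle_trig_cong[OF circle_trig_scale[OF scale.IH, of c]]) simp
  qed
  note * = this
  obtain p r where "trig_poly p" "trig_poly r" "\<forall>z\<in>sphere 0 1. f z = p z" "\<forall>z\<in>sphere 0 1. g z = r z"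
    using assms unfolding circle_trig_def by blast
  then show ?thesis using circle_trig_cong[OF *[of r p]] by simp
qed

lemma circle_inverse: "z \<in> sphere 0 1 \<Longrightarrow> z powi (- 1) = cnj z" for z :: complex
  by (simp add: power_int_minus inverse_complex_def complex_eq_iff cmod_def)

text \<open>Links the real polynomial functions of the Stone-Weierstrass theorem with trigonometric
  polynomials; by closure under sums and products only the linear functions need work.\<close>

lemma circle_trig_real_polynomial:
  fixes p :: "complex \<Rightarrow> real"
  assumes "real_polynomial_function p"
  shows "circle_trig (\<lambda>z. of_real (p z))"
  using assms
proof induction
  case (linear f)
  \<comment> \<open>On the circle Re z = (z + 1/z)/2 and Im z = -i(z - 1/z)/2.\<close>
  have lin: "of_real (f z) = of_real (f 1) * (1 / 2 * (z powi 1 + z powi (- 1)))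
      + of_real (f \<i>) * (- \<i> / 2 * (z powi 1 + (- 1) * z powi (- 1)))" if "z \<in> sphere 0 1" for z
  proof -
    have "z = Re z *\<^sub>R 1 + Im z *\<^sub>R \<i>" by (simp add: complex_eq_iff)
    then have "f z = f (Re z *\<^sub>R 1 + Im z *\<^sub>R \<i>)" by (rule arg_cong)
    also have "\<dots> = Re z * f 1 + Im z * f \<i>"
      by (simp only: bounded_linear.linear[OF linear, THEN linear_add]
          bounded_linear.linear[OF linear, THEN linear_scale] real_scaleR_def)
    finally have "f z = Re z * f 1 + Im z * f \<i>" .
    then show ?thesis
      using circle_inverse[OF that] by (simp add: complex_eq_iff)
  qed
  show ?case
    by (rule circle_trig_cong[OF _ lin], intro circle_trig_add circle_trig_scale circle_trig_monomial)
next
  case (const c)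
  show ?case by (rule circle_trig_const)
next
  case (add f g)
  show ?case
    by (rule circle_trig_cong[OF circle_trig_add[OF add.IH]]) simp
next
  case (mult f g)
  show ?case
    by (rule circle_trig_cong[OF circle_trig_mult[OF mult.IH]]) simp
qed

section \<open>Mean-square density of trigonometric polynomials\<close>

locale circle_measure = prob_space \<mu> for \<mu> :: "complex measure" +
  assumes sets_circle: "sets \<mu> = sets circle_borel"
begin

lemma space_circle: "space \<mu> = sphere 0 1"
  using sets_eq_imp_space_eq[OF sets_circle] by (simp add: circle_borel_def space_restrict_space)

lemma measurable_of_borel:
  assumes "f \<in> borel_measurable borel"
  shows "f \<in> borel_measurable \<mu>"
proof -
  have "f \<in> borel_measurable circle_borel"
    unfolding circle_borel_def using assms by (rule measurable_restrict_space1)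
  then show ?thesis using measurable_cong_sets[OF sets_circle refl] by blast
qed

lemma powi_measurable [measurable]: "(\<lambda>z::complex. z powi k) \<in> borel_measurable borel"
  unfolding power_int_def by measurable

lemma trig_poly_measurable_borel:
  assumes "trig_poly f"
  shows "f \<in> borel_measurable borel"
  using assms by induction auto

lemma trig_poly_bounded:
  assumes "trig_poly f"
  shows "\<exists>B\<ge>0. \<forall>z\<in>sphere 0 1. cmod (f z) \<le> B"
  using assms
proof induction
  case (monomial k)
  show ?case by (rule exI[of _ 1]) (auto simp: norm_power_int)
next
  case (add f g)
  then obtain B C where BC: "0 \<le> B" "\<forall>z\<in>sphere 0 1. cmod (f z) \<le> B"
    "0 \<le> C" "\<forall>z\<in>sphere 0 1. cmod (g z) \<le> C"
    by blast
  then have "cmod (f z + g z) \<le> B + C" if "z \<in> sphere 0 1" for z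
    using that by (intro norm_triangle_le add_mono) auto
  then show ?case using BC by (intro exI[of _ "B + C"]) auto
next
  case (scale f c)
  then obtain B where B: "0 \<le> B" "\<forall>z\<in>sphere 0 1. cmod (f z) \<le> B"
    by blast
  then have "cmod (c * f z) \<le> cmod c * B" if "z \<in> sphere 0 1" for z
    using that by (simp add: norm_mult mult_left_mono)
  then show ?case using B by (intro exI[of _ "cmod c * B"]) auto
qed

lemma trig_poly_measurable: "trig_poly f \<Longrightarrow> f \<in> borel_measurable \<mu>"
  by (intro measurable_of_borel trig_poly_measurable_borel)

lemma bounded_integrable:
  fixes f :: "complex \<Rightarrow> 'b::{banach, second_countable_topology}"
  assumes "f \<in> borel_measurable \<mu>" "\<And>z. z \<in> sphere 0 1 \<Longrightarrow> norm (f z) \<le> B"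
  shows "integrable \<mu> f"
  using assms by (intro integrable_const_bound[where B = B]) (auto simp: space_circle)

text \<open>A non-integrable integrand has integral 0, so the notion carries information only for
  square-integrable g; hence the integrability conditions that accompany it.\<close>

definition approximable :: "(complex \<Rightarrow> real) \<Rightarrow> bool" where
  "approximable g \<longleftrightarrow>
    (\<forall>e>0. \<exists>f. trig_poly f \<and> (LINT z|\<mu>. (cmod (f z - of_real (g z)))\<^sup>2) < e)"

lemma norm_add_square_le: "(cmod (a + b))\<^sup>2 \<le> 2 * (cmod a)\<^sup>2 + 2 * (cmod b)\<^sup>2"
proof -
  have "(cmod (a + b))\<^sup>2 \<le> (cmod a + cmod b)\<^sup>2"
    by (intro power_mono norm_triangle_ineq) auto
  also have "\<dots> \<le> 2 * (cmod a)\<^sup>2 + 2 * (cmod b)\<^sup>2"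
    using sum_squares_bound[of "cmod a" "cmod b"] by (simp add: power2_sum)
  finally show ?thesis .
qed

lemma square_diff_integrable:
  assumes f: "trig_poly f" and g: "g \<in> borel_measurable \<mu>" "integrable \<mu> (\<lambda>z. (g z)\<^sup>2)"
  shows "integrable \<mu> (\<lambda>z. (cmod (f z - of_real (g z)))\<^sup>2)"
proof -
  obtain B where B: "0 \<le> B" "\<And>z. z \<in> sphere 0 1 \<Longrightarrow> cmod (f z) \<le> B"
    using trig_poly_bounded[OF f] by blast
  have [measurable]: "f \<in> borel_measurable \<mu>" "g \<in> borel_measurable \<mu>"
    using g trig_poly_measurable[OF f] by auto
  show ?thesis
  proof (rule Bochner_Integration.integrable_bound[of \<mu> "\<lambda>z. 2 * B\<^sup>2 + 2 * (g z)\<^sup>2"])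
    show "integrable \<mu> (\<lambda>z. 2 * B\<^sup>2 + 2 * (g z)\<^sup>2)" using g by simp
    show "AE z in \<mu>. norm ((cmod (f z - of_real (g z)))\<^sup>2) \<le> norm (2 * B\<^sup>2 + 2 * (g z)\<^sup>2)"
    proof (rule AE_I2)
      fix z assume "z \<in> space \<mu>"
      then have "(cmod (f z))\<^sup>2 \<le> B\<^sup>2" using B by (intro power_mono) (auto simp: space_circle)
      then show "norm ((cmod (f z - of_real (g z)))\<^sup>2) \<le> norm (2 * B\<^sup>2 + 2 * (g z)\<^sup>2)"
        using norm_add_square_le[of "f z" "- of_real (g z)"] by simp
    qed
  qed measurable
qed

lemma approximable_limit:
  assumes g: "\<And>n. approximable (u n)"
    and u: "\<And>n. u n \<in> borel_measurable \<mu>" "\<And>n. integrable \<mu> (\<lambda>z. (u n z)\<^sup>2)"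
    and diff: "\<And>n. integrable \<mu> (\<lambda>z. (u n z - g z)\<^sup>2)"
    and lim: "(\<lambda>n. LINT z|\<mu>. (u n z - g z)\<^sup>2) \<longlonglongrightarrow> 0"
  shows "approximable g"
  unfolding approximable_def
proof (intro allI impI)
  fix e :: real assume e: "0 < e"
  \<comment> \<open>A quarter of e for each error, since squaring a sum costs a factor 2.\<close>
  obtain n where n: "(LINT z|\<mu>. (u n z - g z)\<^sup>2) < e / 4"
    using order_tendstoD(2)[OF lim, of "e / 4"] e eventually_happens' by force
  obtain f where f: "trig_poly f" "(LINT z|\<mu>. (cmod (f z - of_real (u n z)))\<^sup>2) < e / 4"
    using g[of n] e unfolding approximable_def by (metis zero_less_divide_iff zero_less_numeral)
  have int: "integrable \<mu> (\<lambda>z. (cmod (f z - of_real (u n z)))\<^sup>2)"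
    by (rule square_diff_integrable[OF f(1) u])
  have "(LINT z|\<mu>. (cmod (f z - of_real (g z)))\<^sup>2)
      \<le> (LINT z|\<mu>. 2 * (cmod (f z - of_real (u n z)))\<^sup>2 + 2 * (u n z - g z)\<^sup>2)"
  proof (rule integral_mono')
    show "(cmod (f z - of_real (g z)))\<^sup>2
        \<le> 2 * (cmod (f z - of_real (u n z)))\<^sup>2 + 2 * (u n z - g z)\<^sup>2" for z
    proof -
      have "(cmod (of_real (u n z) - of_real (g z)))\<^sup>2 = (u n z - g z)\<^sup>2"
        by (metis norm_of_real of_real_diff power2_abs)
      then show ?thesis
        using norm_add_square_le[of "f z - of_real (u n z)" "of_real (u n z) - of_real (g z)"] by simp
    qed
  qed (use int diff in auto)
  also have "\<dots> = 2 * (LINT z|\<mu>. (cmod (f z - of_real (u n z)))\<^sup>2) + 2 * (LINT z|\<mu>. (u n z - g z)\<^sup>2)"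
    using int diff by simp
  also have "\<dots> < e" using n f(2) by simp
  finally show "\<exists>f. trig_poly f \<and> (LINT z|\<mu>. (cmod (f z - of_real (g z)))\<^sup>2) < e"
    using f(1) by blast
qed

text \<open>Dominated convergence for the squared differences: u n and g both lie between 0 and b,
  so b^2 is a majorant.\<close>

lemma approximable_dominated_limit:
  assumes g: "\<And>n. approximable (u n)"
    and meas: "\<And>n. u n \<in> borel_measurable \<mu>" "g \<in> borel_measurable \<mu>"
    and le: "\<And>n z. z \<in> space \<mu> \<Longrightarrow> 0 \<le> u n z" "\<And>n z. z \<in> space \<mu> \<Longrightarrow> u n z \<le> b z"
    and b: "b \<in> borel_measurable \<mu>" "integrable \<mu> (\<lambda>z. (b z)\<^sup>2)"
    and lim: "\<And>z. z \<in> space \<mu> \<Longrightarrow> (\<lambda>n. u n z) \<longlonglongrightarrow> g z"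
  shows "approximable g"
proof -
  note [measurable] = meas b(1)
  have g_le: "0 \<le> g z" "g z \<le> b z" if "z \<in> space \<mu>" for z
    by (rule LIMSEQ_le_const[OF lim[OF that]], use le(1)[OF that] in simp)
      (rule LIMSEQ_le_const2[OF lim[OF that]], use le(2)[OF that] in simp)
  have sq: "(u n z)\<^sup>2 \<le> (b z)\<^sup>2" if "z \<in> space \<mu>" for n z
    using le that by (intro power_mono) auto
  have dsq: "(u n z - g z)\<^sup>2 \<le> (b z)\<^sup>2" if "z \<in> space \<mu>" for n z
    using le[OF that, of n] g_le[OF that] by (intro power2_mono) auto
  have int: "integrable \<mu> (\<lambda>z. (u n z - g z)\<^sup>2)" for n
    by (rule Bochner_Integration.integrable_bound[OF b(2)]) (auto intro!: AE_I2 dsq)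
  show ?thesis
  proof (rule approximable_limit[OF g meas(1) _ int])
    show "integrable \<mu> (\<lambda>z. (u n z)\<^sup>2)" for n
      by (rule Bochner_Integration.integrable_bound[OF b(2)]) (auto intro!: AE_I2 sq)
    have "(\<lambda>n. LINT z|\<mu>. (u n z - g z)\<^sup>2) \<longlonglongrightarrow> (LINT z|\<mu>. 0)"
    proof (rule integral_dominated_convergence[where w = "\<lambda>z. (b z)\<^sup>2"])
      show "AE z in \<mu>. (\<lambda>n. (u n z - g z)\<^sup>2) \<longlonglongrightarrow> 0"
      proof (rule AE_I2)
        fix z assume z: "z \<in> space \<mu>"
        have "(\<lambda>n. (u n z - g z)\<^sup>2) \<longlonglongrightarrow> (g z - g z)\<^sup>2" by (intro tendsto_intros lim z)
        then show "(\<lambda>n. (u n z - g z)\<^sup>2) \<longlonglongrightarrow> 0" by simp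
      qed
    qed (use b(2) dsq in \<open>auto intro!: AE_I2\<close>)
    then show "(\<lambda>n. LINT z|\<mu>. (u n z - g z)\<^sup>2) \<longlonglongrightarrow> 0" by simp
  qed
qed

lemma approximable_continuous:
  assumes "continuous_on (sphere 0 1) g"
  shows "approximable g"
  unfolding approximable_def
proof (intro allI impI)
  fix e :: real assume e: "0 < e"
  \<comment> \<open>d <= 1 gives d^2 <= d < e.\<close>
  define d where "d = min 1 (e / 2)"
  have d: "0 < d" "d \<le> 1" "d < e" using e by (auto simp: d_def)
  obtain p where p: "real_polynomial_function p"
    "\<And>z. z \<in> sphere 0 1 \<Longrightarrow> \<bar>g z - p z\<bar> < d"
    using Stone_Weierstrass_real_polynomial_function[OF compact_sphere assms d(1)] by blast
  obtain f where f: "trig_poly f" "\<And>z. z \<in> sphere 0 1 \<Longrightarrow> of_real (p z) = f z"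
    using circle_trig_real_polynomial[OF p(1)] unfolding circle_trig_def by blast
  have "(LINT z|\<mu>. (cmod (f z - of_real (g z)))\<^sup>2) \<le> (LINT z|\<mu>. d)"
  proof (rule integral_mono')
    fix z assume "z \<in> space \<mu>"
    then have z: "z \<in> sphere 0 1" by (simp add: space_circle)
    have "cmod (f z - of_real (g z)) = \<bar>g z - p z\<bar>"
      using f(2)[OF z] by (metis norm_minus_commute norm_of_real of_real_diff)
    then have "(cmod (f z - of_real (g z)))\<^sup>2 \<le> d\<^sup>2" using p(2)[OF z] by (intro power_mono) auto
    also have "\<dots> \<le> d" using d by (simp add: power2_eq_square mult_left_le)
    finally show "(cmod (f z - of_real (g z)))\<^sup>2 \<le> d" .
  qed (use d in auto)
  also have "\<dots> = d" by (simp add: prob_space)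
  finally show "\<exists>f. trig_poly f \<and> (LINT z|\<mu>. (cmod (f z - of_real (g z)))\<^sup>2) < e"
    using f(1) d by (meson le_less_trans)
qed

lemma approximable_linear:
  assumes "approximable u" "u \<in> borel_measurable \<mu>" "integrable \<mu> (\<lambda>z. (u z)\<^sup>2)"
    and "approximable v" "v \<in> borel_measurable \<mu>" "integrable \<mu> (\<lambda>z. (v z)\<^sup>2)"
  shows "approximable (\<lambda>z. a * u z + b * v z)"
  unfolding approximable_def
proof (intro allI impI)
  fix e :: real assume e: "0 < e"
  define d where "d = e / (2 * a\<^sup>2 + 2 * b\<^sup>2 + 1)"
  have den: "0 < 2 * a\<^sup>2 + 2 * b\<^sup>2 + 1" by (simp add: add_nonneg_pos)
  then have d: "0 < d" "d * (2 * a\<^sup>2 + 2 * b\<^sup>2 + 1) = e" using e by (auto simp: d_def)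
  obtain f where f: "trig_poly f" "(LINT z|\<mu>. (cmod (f z - of_real (u z)))\<^sup>2) < d"
    using assms(1) d unfolding approximable_def by blast
  obtain g where g: "trig_poly g" "(LINT z|\<mu>. (cmod (g z - of_real (v z)))\<^sup>2) < d"
    using assms(4) d unfolding approximable_def by blast
  let ?h = "\<lambda>z. of_real a * f z + of_real b * g z"
  have int: "integrable \<mu> (\<lambda>z. (cmod (f z - of_real (u z)))\<^sup>2)"
    "integrable \<mu> (\<lambda>z. (cmod (g z - of_real (v z)))\<^sup>2)"
    using square_diff_integrable f(1) g(1) assms by auto
  have "(LINT z|\<mu>. (cmod (?h z - of_real (a * u z + b * v z)))\<^sup>2)
      \<le> (LINT z|\<mu>. 2 * a\<^sup>2 * (cmod (f z - of_real (u z)))\<^sup>2 + 2 * b\<^sup>2 * (cmod (g z - of_real (v z)))\<^sup>2)"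
  proof (rule integral_mono')
    fix z
    have "?h z - of_real (a * u z + b * v z)
        = of_real a * (f z - of_real (u z)) + of_real b * (g z - of_real (v z))"
      by (simp add: algebra_simps)
    then show "(cmod (?h z - of_real (a * u z + b * v z)))\<^sup>2
        \<le> 2 * a\<^sup>2 * (cmod (f z - of_real (u z)))\<^sup>2 + 2 * b\<^sup>2 * (cmod (g z - of_real (v z)))\<^sup>2"
      using norm_add_square_le[of "of_real a * (f z - of_real (u z))" "of_real b * (g z - of_real (v z))"]
      by (simp add: norm_mult power_mult_distrib)
  qed (use int in auto)
  also have "\<dots> = 2 * a\<^sup>2 * (LINT z|\<mu>. (cmod (f z - of_real (u z)))\<^sup>2)
      + 2 * b\<^sup>2 * (LINT z|\<mu>. (cmod (g z - of_real (v z)))\<^sup>2)"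
    using int by simp
  also have "\<dots> \<le> 2 * a\<^sup>2 * d + 2 * b\<^sup>2 * d"
    using f(2) g(2) by (intro add_mono mult_left_mono) auto
  also have "\<dots> < e" using d by (simp add: algebra_simps)
  finally show "\<exists>f. trig_poly f \<and> (LINT z|\<mu>. (cmod (f z - of_real (a * u z + b * v z)))\<^sup>2) < e"
    using f(1) g(1) by (blast intro: trig_poly.intros)
qed

lemma indicator_measurable_circle:
  "E \<in> sets borel \<Longrightarrow> (indicator E :: complex \<Rightarrow> real) \<in> borel_measurable \<mu>"
  by (intro measurable_of_borel) auto

lemma indicator_square_integrable:
  "E \<in> sets borel \<Longrightarrow> integrable \<mu> (\<lambda>z. (indicator E z :: real)\<^sup>2)"
  by (rule bounded_integrable[OF borel_measurable_power[OF indicator_measurable_circle], of _ _ 1])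
    (auto simp: indicator_def)

lemma approximable_zero: "approximable (\<lambda>z. 0)"
  by (rule approximable_continuous) simp

text \<open>The closed sets are an intersection-stable generator of the Borel sets, and indicators
  of closed sets are limits of continuous tent functions. Complements follow by linearity, disjoint
  unions by dominated convergence.\<close>

lemma approximable_indicator:
  assumes "E \<in> sets borel"
  shows "approximable (indicator E)"
proof -
  have "Int_stable (Collect closed :: complex set set)" by (auto simp: Int_stable_def)
  moreover have "Collect closed \<subseteq> Pow (UNIV :: complex set)" by simp
  moreover have "E \<in> sigma_sets UNIV (Collect closed)"
    using assms unfolding borel_eq_closed by simp
  ultimately show ?thesis
  proof (induction rule: sigma_sets_induct_disjoint)
    case (basic C)
    show ?case
    \<comment> \<open>The distance to the empty set is 0 by convention, so the tent functions would
      be 1 there.\<close>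
    proof (cases "C = {}")
      case True
      then show ?thesis using approximable_zero by (simp add: indicator_def)
    next
      case False
      have closed: "closed C" using basic by simp
      define u where "u n z = max 0 (1 - real n * infdist z C)" for n z
      have cont: "continuous_on S (u n)" for n S
        unfolding u_def by (intro continuous_intros)
      show ?thesis
      proof (rule approximable_dominated_limit[where u = u and b = "\<lambda>z. 1"])
        show "approximable (u n)" for n by (rule approximable_continuous[OF cont])
        show "u n \<in> borel_measurable \<mu>" for n
          by (intro measurable_of_borel borel_measurable_continuous_onI cont)
        show "(indicator C :: complex \<Rightarrow> real) \<in> borel_measurable \<mu>"
          using closed by (intro indicator_measurable_circle) auto
        show "(\<lambda>n. u n z) \<longlonglongrightarrow> indicator C z" for z
        proof (cases "z \<in> C")
          case True
          then show ?thesis by (simp add: u_def)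
        next
          case F: False
          then have pos: "0 < infdist z C"
            using closed False in_closed_iff_infdist_zero infdist_nonneg[of z C] by force
          obtain N where N: "1 / infdist z C \<le> real N" using real_arch_simple by blast
          have "u n z = 0" if "N \<le> n" for n
          proof -
            have "1 / infdist z C \<le> real n" using N that by simp
            then show ?thesis using pos by (simp add: u_def field_simps)
          qed
          then have "eventually (\<lambda>n. u n z = 0) sequentially"
            unfolding eventually_sequentially by blast
          then show ?thesis using F by (simp add: tendsto_eventually)
        qed
      qed (auto simp: u_def infdist_nonneg)
    qed
  next
    case empty
    then show ?case using approximable_zero by (simp add: indicator_def)
  next
    case (compl E)
    then have E: "E \<in> sets borel" unfolding borel_eq_closed by simp
    have "approximable (\<lambda>z. 1 * indicator UNIV z + (- 1) * indicator E z)"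
      using compl E approximable_continuous[of "\<lambda>z. 1"]
      by (intro approximable_linear indicator_measurable_circle indicator_square_integrable) auto
    moreover have "(\<lambda>z::complex. 1 * indicator UNIV z + (- 1) * indicator E z :: real) = indicator (UNIV - E)"
      by (auto simp: indicator_def)
    ultimately show ?case by simp
  next
    case (union E)
    then have E: "E i \<in> sets borel" for i unfolding borel_eq_closed by auto
    define u where "u n = (indicator (\<Union>i<n. E i) :: complex \<Rightarrow> real)" for n
    have meas: "(\<Union>i<n. E i) \<in> sets borel" for n using E by auto
    have "approximable (u n)" for n
    proof (induction n)
      case 0
      then show ?case using approximable_zero by (simp add: u_def indicator_def)
    next
      case (Suc n)
      have "approximable (\<lambda>z. 1 * u n z + 1 * indicator (E n) z)"
        using Suc union E meas unfolding u_def
        by (intro approximable_linear indicator_measurable_circle indicator_square_integrable) auto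
      moreover have "E n \<inter> E i = {}" if "i < n" for i
        using disjoint_family_onD[OF union(1), of n i] that by auto
      then have "E n \<inter> (\<Union>i<n. E i) = {}" by blast
      then have "(\<lambda>z. 1 * u n z + 1 * indicator (E n) z) = u (Suc n)"
        by (auto simp: u_def indicator_def lessThan_Suc fun_eq_iff)
      ultimately show ?case by simp
    qed
    then show ?case
    proof (rule approximable_dominated_limit[where u = u and b = "\<lambda>z. 1"])
      show "(\<lambda>n. u n z) \<longlonglongrightarrow> indicator (\<Union>i. E i) z" for z
        unfolding u_def by (rule LIMSEQ_indicator_UN)
      show "u n \<in> borel_measurable \<mu>" for n
        unfolding u_def using meas by (rule indicator_measurable_circle)
      show "(indicator (\<Union>i. E i) :: complex \<Rightarrow> real) \<in> borel_measurable \<mu>"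
        using E by (intro indicator_measurable_circle) auto
    qed (auto simp: u_def indicator_def)
  qed
qed

text \<open>Induction over nonnegative measurable functions: square integrability passes to the
  smaller pieces, and increasing limits are dominated by g.\<close>

lemma trig_poly_dense:
  assumes g: "g \<in> borel_measurable \<mu>" "\<And>z. 0 \<le> g z" "integrable \<mu> (\<lambda>z. (g z)\<^sup>2)"
  shows "approximable g"
  using g
proof (induction rule: borel_measurable_induct_real)
  case (set E)
  then obtain F where F: "F \<in> sets borel" "E = sphere 0 1 \<inter> F"
    unfolding sets_circle circle_borel_def sets_restrict_space by blast
  then have "E \<in> sets borel" by auto
  then show ?case by (rule approximable_indicator)
next
  case (mult u c)
  show ?case
  proof (cases "c = 0")
    case True
    then show ?thesis using approximable_zero by simp
  next
    case False
    have "integrable \<mu> (\<lambda>z. (1 / c)\<^sup>2 * (c * u z)\<^sup>2)" using mult.prems by simp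
    then have int: "integrable \<mu> (\<lambda>z. (u z)\<^sup>2)"
      using False by (simp add: power_mult_distrib power_divide)
    have "approximable (\<lambda>z. c * u z + 0 * u z)"
      using mult int by (intro approximable_linear) auto
    then show ?thesis by simp
  qed
next
  case (add u v)
  note [measurable] = add.hyps(1,3)
  have int: "integrable \<mu> (\<lambda>z. (u z)\<^sup>2)" "integrable \<mu> (\<lambda>z. (v z)\<^sup>2)"
    by (rule Bochner_Integration.integrable_bound[OF add.prems]; use add.hyps in \<open>auto intro!: AE_I2 power_mono\<close>)+
  have "approximable (\<lambda>z. 1 * v z + 1 * u z)"
    using add int by (intro approximable_linear) auto
  then show ?case by simp
next
  case (seq U)
  have le: "U n z \<le> g z" if "z \<in> space \<mu>" for n z
    using incseq_le[OF _ seq.hyps(4)[OF that], of n] seq.hyps(3)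
    by (auto simp: incseq_def le_fun_def)
  show ?case
  proof (rule approximable_dominated_limit[OF _ seq.hyps(1) g(1) _ le g(1,3) seq.hyps(4)])
    show "approximable (U n)" for n
    proof (rule seq.IH)
      show "integrable \<mu> (\<lambda>z. (U n z)\<^sup>2)"
        by (rule Bochner_Integration.integrable_bound[OF g(3)])
          (use seq.hyps(1,2) le g(2) in \<open>auto intro!: AE_I2 power_mono\<close>)
    qed
  qed (use seq.hyps(2) in auto)
qed

end

section \<open>The trace of a rotation algebra\<close>

declare pow_nat [simp del] \<comment> \<open>loops with \<open>int_pow_def2\<close>\<close>

text \<open>If L < r, put s = sqrt(L/r) < 1: after division by the power of r, the right side is the
  square of (c n + 1) s^n at n = 2^k, which still tends to 0.\<close>

lemma polynomial_exponential_bound_imp_le: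
  fixes r L c :: real
  assumes "0 \<le> L" "0 \<le> c" "\<And>k. r ^ (2 ^ k) \<le> (c * 2 ^ k + 1)\<^sup>2 * L ^ (2 ^ k)"
  shows "r \<le> L"
proof (rule ccontr)
  assume "\<not> r \<le> L"
  then have r: "L < r" "0 < r" using assms by auto
  define s where "s = sqrt (L / r)"
  have s: "0 \<le> s" "s < 1" "s\<^sup>2 = L / r" using r assms by (auto simp: s_def)
  have one_le: "1 \<le> (c * (of_nat (2 ^ k) * s ^ 2 ^ k) + s ^ 2 ^ k)\<^sup>2" for k
  proof -
    have "1 \<le> (c * 2 ^ k + 1)\<^sup>2 * (L / r) ^ (2 ^ k)"
      using assms(3)[of k] r by (simp add: power_divide field_simps)
    also have "(L / r) ^ (2 ^ k) = (s ^ 2 ^ k)\<^sup>2"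
      by (simp only: s(3)[symmetric] power_mult[symmetric] mult.commute)
    finally show ?thesis
      by (simp only: power_mult_distrib[symmetric]) (simp add: algebra_simps)
  qed
  have sub: "strict_mono (\<lambda>k::nat. (2::nat) ^ k)" by (simp add: strict_monoI)
  have "(\<lambda>n. of_nat n * s ^ n) \<longlonglongrightarrow> 0" "(\<lambda>n. s ^ n) \<longlonglongrightarrow> 0"
    using s by (auto intro!: powser_times_n_limit_0 LIMSEQ_power_zero)
  from this[THEN LIMSEQ_subseq_LIMSEQ[OF _ sub]]
  have "(\<lambda>k. (c * (of_nat (2 ^ k) * s ^ 2 ^ k) + s ^ 2 ^ k)\<^sup>2) \<longlonglongrightarrow> (c * 0 + 0)\<^sup>2"
    by (intro tendsto_intros) (simp_all add: o_def)
  then have "1 \<le> (c * 0 + 0)\<^sup>2"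
    by (rule LIMSEQ_le_const) (use one_le in blast)
  then show False by simp
qed

section \<open>Integer powers of unitaries, and limits of functionals\<close>

context cstar_algebra
begin

text \<open>Powers of the adjoint for negative exponents let the involution simply reverse the
  exponent; for unitaries this is the group power, by \<open>int_pow_eq_zpow\<close>.\<close>

definition zpow :: "'a \<Rightarrow> int \<Rightarrow> 'a" where
  "zpow u k = (if 0 \<le> k then u [^] nat k else star A u [^] nat (- k))"

lemma unitaryD:
  assumes "unitary A u"
  shows "u \<in> carrier A" "star A u \<otimes> u = \<one>" "u \<otimes> star A u = \<one>"
  using assms by (auto simp: unitary_def)

lemma unitary_star: "unitary A u \<Longrightarrow> unitary A (star A u)"
  by (simp add: unitary_def)

lemma cnorm_unitary_le:
  assumes "unitary A u"
  shows "cnorm A u \<le> 1"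
proof -
  have "(cnorm A u)\<^sup>2 \<le> 1\<^sup>2"
    using cnorm_star_mult[of u] cnorm_one_le unitaryD[OF assms] by simp
  then show ?thesis by (rule power2_le_imp_le) simp
qed

lemma zpow_closed [simp, intro]: "u \<in> carrier A \<Longrightarrow> zpow u k \<in> carrier A"
  by (simp add: zpow_def)

lemma zpow_zero [simp]: "zpow u 0 = \<one>"
  by (simp add: zpow_def)

lemma zpow_one [simp]: "u \<in> carrier A \<Longrightarrow> zpow u 1 = u"
  by (simp add: zpow_def)

lemma zpow_star: "u \<in> carrier A \<Longrightarrow> zpow (star A u) (- k) = zpow u k"
  by (auto simp: zpow_def)

lemma star_zpow: "u \<in> carrier A \<Longrightarrow> star A (zpow u k) = zpow u (- k)"
  by (auto simp: zpow_def star_pow)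

lemma zpow_add_one:
  assumes u: "unitary A u"
  shows "zpow u (k + 1) = zpow u k \<otimes> u"
proof (cases "0 \<le> k")
  case True
  then have "nat (k + 1) = Suc (nat k)" by simp
  then show ?thesis using True by (simp add: zpow_def)
next
  case False
  then obtain n where n: "nat (- k) = Suc n" by (metis Suc_pred neg_0_less_iff_less not_le zero_less_nat_eq)
  then have "nat (- (k + 1)) = n" by simp
  then have "zpow u (k + 1) = star A u [^] n" using False by (cases "k = - 1") (auto simp: zpow_def)
  then show ?thesis
    using False n unitaryD[OF u] by (simp add: zpow_def m_assoc)
qed

lemma zpow_diff_one:
  assumes u: "unitary A u"
  shows "zpow u (k - 1) = zpow u k \<otimes> star A u"
  using zpow_add_one[OF unitary_star[OF u], of "- k"] zpow_star[of u k] zpow_star[of u "k - 1"]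
    unitaryD(1)[OF u] by simp

lemma zpow_add:
  assumes u: "unitary A u"
  shows "zpow u (j + k) = zpow u j \<otimes> zpow u k"
proof (induction k rule: int_induct[where k = 0])
  case base
  then show ?case using unitaryD[OF u] by simp
next
  case (step1 k)
  then show ?case
    using zpow_add_one[OF u, of "j + k"] zpow_add_one[OF u, of k] unitaryD(1)[OF u]
    by (simp add: m_assoc add.assoc)
next
  case (step2 k)
  then show ?case
    using zpow_diff_one[OF u, of "j + k"] zpow_diff_one[OF u, of k] unitaryD(1)[OF u]
    by (simp add: m_assoc add_diff_eq)
qed

lemma unitary_zpow:
  assumes u: "unitary A u"
  shows "unitary A (zpow u k)"
  using zpow_add[OF u, of "- k" k] zpow_add[OF u, of k "- k"] unitaryD(1)[OF u]
  by (simp add: unitary_def star_zpow)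

lemma int_pow_eq_zpow:
  assumes u: "unitary A u"
  shows "u [^] (k::int) = zpow u k"
proof (cases "k < 0")
  case True
  have "zpow u (- k) \<otimes> zpow u k = \<one>" "zpow u k \<otimes> zpow u (- k) = \<one>"
    using zpow_add[OF u, of "- k" k] zpow_add[OF u, of k "- k"] by auto
  then have "inv (zpow u (- k)) = zpow u k"
    using unitaryD(1)[OF u] by (metis inv_unique' zpow_closed)
  then show ?thesis using True by (simp add: int_pow_def2 zpow_def)
qed (simp add: int_pow_def2 zpow_def)

text \<open>Multiplying the relation by the adjoint of v on both sides inverts c; this is the
  induction step for negative k.\<close>

lemma zpow_commute:
  assumes x: "x \<in> carrier A" and v: "unitary A v" and c: "c \<noteq> 0"
    and xv: "x \<otimes> v = scale A c (v \<otimes> x)"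
  shows "x \<otimes> zpow v k = scale A (c powi k) (zpow v k \<otimes> x)"
proof -
  note vD = unitaryD[OF v]
  have "star A v \<otimes> x = (star A v \<otimes> (x \<otimes> v)) \<otimes> star A v"
    using vD x by (simp add: m_assoc)
  also have "\<dots> = scale A c ((star A v \<otimes> v) \<otimes> x \<otimes> star A v)"
    using vD(1) x xv by (simp add: scale_mult_left scale_mult_right m_assoc)
  also have "\<dots> = scale A c (x \<otimes> star A v)" using vD x by simp
  finally have xvs: "x \<otimes> star A v = scale A (inverse c) (star A v \<otimes> x)"
    using vD(1) x c by (simp add: scale_scale)
  show ?thesis
  proof (induction k rule: int_induct[where k = 0])
    case base
    then show ?case using x by simp
  next
    case (step1 k)
    have "x \<otimes> (zpow v k \<otimes> v) = (x \<otimes> zpow v k) \<otimes> v" using x vD(1) by (simp add: m_assoc)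
    also have "\<dots> = scale A (c powi k) (zpow v k \<otimes> (x \<otimes> v))"
      using step1 x vD(1) by (simp add: scale_mult_left m_assoc)
    also have "\<dots> = scale A (c powi (k + 1)) ((zpow v k \<otimes> v) \<otimes> x)"
      using x vD(1) c by (simp add: xv scale_mult_right scale_scale m_assoc power_int_add_1)
    finally show ?case by (simp add: zpow_add_one[OF v])
  next
    case (step2 k)
    have "x \<otimes> (zpow v k \<otimes> star A v) = (x \<otimes> zpow v k) \<otimes> star A v"
      using x vD(1) by (simp add: m_assoc)
    also have "\<dots> = scale A (c powi k) (zpow v k \<otimes> (x \<otimes> star A v))"
      using step2 x vD(1) by (simp add: scale_mult_left m_assoc)
    also have "\<dots> = scale A (c powi (k - 1)) ((zpow v k \<otimes> star A v) \<otimes> x)"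
      using x vD(1) c
      by (simp add: xvs scale_mult_right scale_scale m_assoc power_int_diff divide_inverse)
    finally show ?case by (simp add: zpow_diff_one[OF v])
  qed
qed

lemma diff_diff_cancel:
  assumes "x \<in> carrier A" "y \<in> carrier A"
  shows "x \<ominus> (x \<ominus> y) = y"
  using assms by (simp add: a_minus_def minus_add r_neg2)

lemma mult_diff_split:
  assumes "x \<in> carrier A" "x' \<in> carrier A" "y \<in> carrier A" "y' \<in> carrier A"
  shows "(x \<otimes> x') \<ominus> (y \<otimes> y') = x \<otimes> (x' \<ominus> y') \<oplus> (x \<ominus> y) \<otimes> y'"
  using assms
  by (simp add: minus_eq_scale l_distr r_distr scale_mult_left scale_mult_right scale_minus_one
      a_ac l_minus r_minus r_neg1 r_neg2)

lemma add_diff_split: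
  assumes "x \<in> carrier A" "x' \<in> carrier A" "y \<in> carrier A" "y' \<in> carrier A"
  shows "(x \<oplus> x') \<ominus> (y \<oplus> y') = (x \<ominus> y) \<oplus> (x' \<ominus> y')"
  using assms by (simp add: minus_eq_scale scale_add_right a_ac)

lemma scale_diff:
  assumes "x \<in> carrier A" "y \<in> carrier A"
  shows "scale A c x \<ominus> scale A c y = scale A c (x \<ominus> y)"
  using assms by (simp add: minus_eq_scale scale_add_right scale_scale mult.commute)

lemma dual_limit:
  assumes F: "\<And>n::nat. F n \<in> dual A" and bound: "\<And>n x. x \<in> carrier A \<Longrightarrow> cmod (F n x) \<le> K * cnorm A x"
    and conv: "\<And>x. x \<in> carrier A \<Longrightarrow> convergent (\<lambda>n. F n x)"
  obtains \<tau> where "\<tau> \<in> dual A" "\<And>x. x \<in> carrier A \<Longrightarrow> (\<lambda>n. F n x) \<longlonglongrightarrow> \<tau> x"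
proof -
  define \<tau> where "\<tau> = (\<lambda>x\<in>carrier A. lim (\<lambda>n. F n x))"
  have lim: "(\<lambda>n. F n x) \<longlonglongrightarrow> \<tau> x" if "x \<in> carrier A" for x
    using conv[OF that] that by (simp add: \<tau>_def convergent_LIMSEQ_iff)
  have "\<tau> \<in> dual A"
  proof (rule dualI[where C = K])
    show "\<tau> \<in> extensional (carrier A)" by (simp add: \<tau>_def)
    show "\<tau> (x \<oplus> y) = \<tau> x + \<tau> y" if xy: "x \<in> carrier A" "y \<in> carrier A" for x y
    proof (rule LIMSEQ_unique)
      show "(\<lambda>n. F n (x \<oplus> y)) \<longlonglongrightarrow> \<tau> (x \<oplus> y)" using xy by (intro lim) auto
      show "(\<lambda>n. F n (x \<oplus> y)) \<longlonglongrightarrow> \<tau> x + \<tau> y"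
        using tendsto_add[OF lim[OF xy(1)] lim[OF xy(2)]] xy by (simp add: dual_add[OF F])
    qed
    show "\<tau> (scale A c x) = c * \<tau> x" if x: "x \<in> carrier A" for c x
    proof (rule LIMSEQ_unique)
      show "(\<lambda>n. F n (scale A c x)) \<longlonglongrightarrow> \<tau> (scale A c x)" using x by (intro lim) auto
      show "(\<lambda>n. F n (scale A c x)) \<longlonglongrightarrow> c * \<tau> x"
        using tendsto_mult_left[OF lim[OF x], of c] x by (simp add: dual_scale[OF F])
    qed
    show "cmod (\<tau> x) \<le> K * cnorm A x" if x: "x \<in> carrier A" for x
      by (rule LIMSEQ_le_const2[OF tendsto_norm[OF lim[OF x]]]) (use bound x in auto)
  qed
  then show ?thesis using that lim by blast
qed

text \<open>At a square of x, the conjugated functional is \<phi> at the square of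
  \<open>x \<otimes> u\<close>.\<close>

lemma posf_conjugate:
  assumes "posf \<phi>" "u \<in> carrier A"
  shows "posf (dual_act A (lact u \<phi>) (star A u))"
  unfolding posf_def
proof (intro conjI ballI)
  fix x assume x: "x \<in> carrier A"
  have "dual_act A (lact u \<phi>) (star A u) (star A x \<otimes> x) = \<phi> (star A (x \<otimes> u) \<otimes> (x \<otimes> u))"
    using assms x by (simp add: star_mult m_assoc)
  then show "dual_act A (lact u \<phi>) (star A u) (star A x \<otimes> x) \<in> \<real>\<^sub>\<ge>\<^sub>0"
    using assms x by (simp only: posf_def m_closed)
qed (use assms in \<open>auto simp: posf_dual\<close>)

end

text \<open>The geometric sums stay bounded by 2/|r - 1|.\<close>

lemma geometric_average_tendsto_zero:
  fixes r :: complex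
  assumes "cmod r = 1" "r \<noteq> 1"
  shows "(\<lambda>N. (\<Sum>n<N. r ^ n) / of_nat N) \<longlonglongrightarrow> 0"
proof (rule Lim_null_comparison)
  show "\<forall>\<^sub>F N in sequentially. norm ((\<Sum>n<N. r ^ n) / of_nat N) \<le> 2 / cmod (r - 1) * (1 / real N)"
  proof (rule always_eventually, rule allI)
    fix N
    have "cmod (\<Sum>n<N. r ^ n) = cmod (r ^ N - 1) / cmod (r - 1)"
      using assms(2) by (simp add: geometric_sum norm_divide)
    also have "\<dots> \<le> 2 / cmod (r - 1)"
      using norm_triangle_ineq4[of "r ^ N" 1] assms(1)
      by (intro divide_right_mono) (auto simp: norm_power)
    finally have "cmod (\<Sum>n<N. r ^ n) / real N \<le> 2 / cmod (r - 1) / real N"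
      by (rule divide_right_mono) simp
    then show "norm ((\<Sum>n<N. r ^ n) / of_nat N) \<le> 2 / cmod (r - 1) * (1 / real N)"
      by (simp add: norm_divide)
  qed
  show "(\<lambda>N. 2 / cmod (r - 1) * (1 / real N)) \<longlonglongrightarrow> 0"
    using tendsto_mult[OF tendsto_const lim_1_over_n, of "2 / cmod (r - 1)"] by simp
qed

section \<open>Rotation algebras and their Laurent polynomials\<close>

locale rotation_algebra = cstar_algebra A for A :: "('a, 'm) cstar_scheme" (structure) +
  fixes U V :: 'a and q :: complex
  assumes unitary_U: "unitary A U" and unitary_V: "unitary A V"
    and norm_q: "cmod q = 1"
    and UV: "U \<otimes> V = scale A q (V \<otimes> U)"
    and generated: "\<lbrakk>cstar_subalgebra S A; U \<in> S; V \<in> S\<rbrakk> \<Longrightarrow> S = carrier A"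
begin

lemma U_closed [simp, intro]: "U \<in> carrier A" and V_closed [simp, intro]: "V \<in> carrier A"
  using unitaryD(1) unitary_U unitary_V by auto

lemma q_nonzero [simp]: "q \<noteq> 0"
  using norm_q by auto

text \<open>The element W(k,l) without its phase, which is a half-integral power of q; without it
  all commutation factors are integral powers of q.\<close>

definition w :: "int \<Rightarrow> int \<Rightarrow> 'a" where
  "w k l = zpow U k \<otimes> zpow V l"

lemma w_closed [simp, intro]: "w k l \<in> carrier A"
  by (simp add: w_def)

lemma w_zero: "w 0 0 = \<one>"
  by (simp add: w_def)

lemma VU_commute: "zpow V l \<otimes> zpow U k = scale A (q powi (- l * k)) (zpow U k \<otimes> zpow V l)"
proof -
  have "U \<otimes> zpow V l = scale A (q powi l) (zpow V l \<otimes> U)"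
    by (rule zpow_commute[OF U_closed unitary_V q_nonzero UV])
  then have "zpow V l \<otimes> U = scale A (q powi (- l)) (U \<otimes> zpow V l)"
    by (simp add: scale_scale power_int_minus)
  then have "zpow V l \<otimes> zpow U k = scale A ((q powi (- l)) powi k) (zpow U k \<otimes> zpow V l)"
    by (intro zpow_commute unitary_U) auto
  then show ?thesis by (simp only: power_int_mult)
qed

lemma w_mult: "w k l \<otimes> w k' l' = scale A (q powi (- l * k')) (w (k + k') (l + l'))"
proof -
  have "w k l \<otimes> w k' l' = zpow U k \<otimes> (zpow V l \<otimes> zpow U k') \<otimes> zpow V l'"
    by (simp add: w_def m_assoc)
  then show ?thesis
    by (simp add: VU_commute w_def zpow_add[OF unitary_U] zpow_add[OF unitary_V]
        scale_mult_left scale_mult_right m_assoc)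
qed

lemma star_w: "star A (w k l) = scale A (q powi (- l * k)) (w (- k) (- l))"
  using VU_commute[of "- l" "- k"] by (simp add: w_def star_mult star_zpow)

lemma norm_q_powi [simp]: "cmod (q powi k) = 1"
  by (simp add: norm_power_int norm_q)

text \<open>Laurent polynomials in U and V of degree at most r in each variable. Degrees add under
  multiplication, so the n-th power of an element has degree at most n r.\<close>

inductive_set box :: "nat \<Rightarrow> 'a set" for r where
  w: "\<lbrakk>\<bar>k\<bar> \<le> int r; \<bar>l\<bar> \<le> int r\<rbrakk> \<Longrightarrow> w k l \<in> box r"
| zero: "\<zero> \<in> box r"
| add: "\<lbrakk>x \<in> box r; y \<in> box r\<rbrakk> \<Longrightarrow> x \<oplus> y \<in> box r"
| scale: "x \<in> box r \<Longrightarrow> scale A c x \<in> box r"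

lemma box_closed [simp]: "x \<in> box r \<Longrightarrow> x \<in> carrier A"
  by (induction rule: box.induct) auto

lemma box_mono:
  assumes "x \<in> box r" "r \<le> s"
  shows "x \<in> box s"
  using assms by (induction rule: box.induct) (auto intro: box.intros)

lemma box_star: "x \<in> box r \<Longrightarrow> star A x \<in> box r"
  by (induction rule: box.induct) (auto simp: star_w star_add star_scale intro!: box.intros)

lemma box_mult:
  assumes x: "x \<in> box r" and y: "y \<in> box s"
  shows "x \<otimes> y \<in> box (r + s)"
  using x
proof (induction rule: box.induct)
  case (w k l)
  show ?case
    using y
  proof (induction rule: box.induct)
    case (w k' l')
    then show ?case
      unfolding w_mult using \<open>\<bar>k\<bar> \<le> int r\<close> \<open>\<bar>l\<bar> \<le> int r\<close> by (intro box.scale box.w) auto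
  qed (auto simp: r_distr scale_mult_right intro: box.intros)
next
  case zero
  then show ?case using y by (auto intro: box.zero)
next
  case (add x x')
  then show ?case using y by (auto simp: l_distr intro: box.add)
next
  case (scale x c)
  then show ?case using y by (auto simp: scale_mult_left intro: box.scale)
qed

lemma box_pow: "x \<in> box r \<Longrightarrow> x [^] (n::nat) \<in> box (n * r)"
proof (induction n)
  case 0
  then show ?case using box.w[of 0 0 0] by (simp add: w_zero)
next
  case (Suc n)
  then have "x [^] n \<otimes> x \<in> box (n * r + r)" by (intro box_mult) auto
  then show ?case by (simp add: add.commute)
qed

text \<open>The limits of Laurent polynomials form a C*-subalgebra that contains U and V.\<close>

lemma box_dense:
  assumes "x \<in> carrier A" "0 < e"
  obtains r y where "y \<in> box r" "cnorm A (x \<ominus> y) < e"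
proof -
  define S where "S = {x \<in> carrier A. \<forall>e>0. \<exists>r. \<exists>y\<in>box r. cnorm A (x \<ominus> y) < e}"
  have box_S: "x \<in> S" if "x \<in> box r" for x r
    using that by (auto simp: S_def a_minus_def r_neg intro!: exI[of _ r] bexI[of _ x])
  have SD: "x \<in> carrier A" if "x \<in> S" for x using that by (simp add: S_def)
  have Sapprox: "\<exists>r. \<exists>y\<in>box r. cnorm A (x \<ominus> y) < e" if "x \<in> S" "0 < e" for x e
    using that by (simp add: S_def)
  have SI: "x \<in> S" if "x \<in> carrier A" "\<And>e. 0 < e \<Longrightarrow> \<exists>r. \<exists>y\<in>box r. cnorm A (x \<ominus> y) < e" for x
    using that by (simp add: S_def)
  have S_mult: "x \<otimes> x' \<in> S" if xs: "x \<in> S" "x' \<in> S" for x x'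
  proof (rule SI)
    have x: "x \<in> carrier A" "x' \<in> carrier A" using xs SD by auto
    then show "x \<otimes> x' \<in> carrier A" by simp
    fix e :: real assume e: "0 < e"
    \<comment> \<open>d <= 1 bounds the norm of the approximant of x' by that of x' plus 1; the
      denominator exceeds the total coefficient of d in the error.\<close>
    define d where "d = min 1 (e / (cnorm A x + cnorm A x' + 2))"
    have den: "0 < cnorm A x + cnorm A x' + 2"
      using cnorm_nonneg[OF x(1)] cnorm_nonneg[OF x(2)] by linarith
    have "d \<le> e / (cnorm A x + cnorm A x' + 2)" by (simp add: d_def)
    then have d: "0 < d" "d \<le> 1" "d * (cnorm A x + cnorm A x' + 2) \<le> e"
      using e den by (simp_all only: pos_le_divide_eq) (simp_all add: d_def)
    obtain r y where y: "y \<in> box r" "cnorm A (x \<ominus> y) < d" using Sapprox[OF xs(1) d(1)] by blast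
    obtain s y' where y': "y' \<in> box s" "cnorm A (x' \<ominus> y') < d" using Sapprox[OF xs(2) d(1)] by blast
    have c: "y \<in> carrier A" "y' \<in> carrier A" using y y' by auto
    have "y' = x' \<ominus> (x' \<ominus> y')"
      using x c by (simp add: diff_diff_cancel)
    then have "cnorm A y' \<le> cnorm A x' + d"
      using cnorm_diff_le[of x' "x' \<ominus> y'"] x c y'(2) by simp
    then have ny': "cnorm A y' \<le> cnorm A x' + 1" using d by linarith
    have "cnorm A ((x \<otimes> x') \<ominus> (y \<otimes> y')) \<le> cnorm A (x \<otimes> (x' \<ominus> y')) + cnorm A ((x \<ominus> y) \<otimes> y')"
      using x c by (simp add: mult_diff_split cnorm_triangle)
    also have "\<dots> \<le> cnorm A x * cnorm A (x' \<ominus> y') + cnorm A (x \<ominus> y) * cnorm A y'"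
      using x c by (intro add_mono cnorm_mult) auto
    also have "\<dots> \<le> cnorm A x * d + d * (cnorm A x' + 1)"
      using x c y(2) y'(2) ny' d cnorm_nonneg by (intro add_mono mult_mono) auto
    also have "\<dots> < d * (cnorm A x + cnorm A x' + 2)" using d by (simp add: algebra_simps)
    finally have "cnorm A ((x \<otimes> x') \<ominus> (y \<otimes> y')) < e" using d by simp
    then show "\<exists>r. \<exists>z\<in>box r. cnorm A ((x \<otimes> x') \<ominus> z) < e"
      using box_mult[OF y(1) y'(1)] by blast
  qed
  have S_add: "x \<oplus> x' \<in> S" if xs: "x \<in> S" "x' \<in> S" for x x'
  proof (rule SI)
    have x: "x \<in> carrier A" "x' \<in> carrier A" using xs SD by auto
    then show "x \<oplus> x' \<in> carrier A" by simp
    fix e :: real assume e: "0 < e"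
    obtain r y where y: "y \<in> box r" "cnorm A (x \<ominus> y) < e / 2"
      using Sapprox[OF xs(1), of "e / 2"] e by auto
    obtain s y' where y': "y' \<in> box s" "cnorm A (x' \<ominus> y') < e / 2"
      using Sapprox[OF xs(2), of "e / 2"] e by auto
    have c: "y \<in> carrier A" "y' \<in> carrier A" using y y' by auto
    have "cnorm A ((x \<oplus> x') \<ominus> (y \<oplus> y')) \<le> cnorm A (x \<ominus> y) + cnorm A (x' \<ominus> y')"
      using x c by (simp add: add_diff_split cnorm_triangle)
    then have "cnorm A ((x \<oplus> x') \<ominus> (y \<oplus> y')) < e" using y y' by simp
    moreover have "y \<oplus> y' \<in> box (r + s)"
      using y(1) y'(1) by (intro box.add) (auto elim: box_mono)
    ultimately show "\<exists>r. \<exists>z\<in>box r. cnorm A ((x \<oplus> x') \<ominus> z) < e" by blast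
  qed
  have S_scale: "scale A c x \<in> S" if xs: "x \<in> S" for c x
  proof (rule SI)
    have x: "x \<in> carrier A" using xs SD by auto
    then show "scale A c x \<in> carrier A" by simp
    fix e :: real assume e: "0 < e"
    have pos: "0 < cmod c + 1" by (simp add: add_nonneg_pos)
    obtain r y where y: "y \<in> box r" "cnorm A (x \<ominus> y) < e / (cmod c + 1)"
      using Sapprox[OF xs, of "e / (cmod c + 1)"] e pos by auto
    have c: "y \<in> carrier A" using y by auto
    have "cnorm A (scale A c x \<ominus> scale A c y) \<le> (cmod c + 1) * cnorm A (x \<ominus> y)"
      using x c cnorm_nonneg[of "x \<ominus> y"] by (simp add: scale_diff cnorm_scale mult_right_mono)
    also have "\<dots> < e" using y(2) pos by (simp add: pos_less_divide_eq mult.commute)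
    finally show "\<exists>r. \<exists>z\<in>box r. cnorm A (scale A c x \<ominus> z) < e"
      using box.scale[OF y(1)] by blast
  qed
  have S_star: "star A x \<in> S" if xs: "x \<in> S" for x
  proof (rule SI)
    have x: "x \<in> carrier A" using xs SD by auto
    then show "star A x \<in> carrier A" by simp
    fix e :: real assume e: "0 < e"
    obtain r y where y: "y \<in> box r" "cnorm A (x \<ominus> y) < e" using Sapprox[OF xs e] by blast
    then have "cnorm A (star A x \<ominus> star A y) < e"
      using x by (simp add: star_diff[symmetric] cnorm_star)
    then show "\<exists>r. \<exists>z\<in>box r. cnorm A (star A x \<ominus> z) < e" using box_star[OF y(1)] by blast
  qed
  have S_limit: "l \<in> S"
    if s: "\<And>n. s n \<in> S" "l \<in> carrier A" "(\<lambda>n. cnorm A (s n \<ominus> l)) \<longlonglongrightarrow> 0" for s :: "nat \<Rightarrow> 'a" and l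
  proof (rule SI[OF s(2)])
    fix e :: real assume e: "0 < e"
    obtain n where n: "cnorm A (s n \<ominus> l) < e / 2"
      using order_tendstoD(2)[OF s(3), of "e / 2"] e eventually_happens' by force
    obtain r y where y: "y \<in> box r" "cnorm A (s n \<ominus> y) < e / 2"
      using Sapprox[OF s(1), of "e / 2" n] e by auto
    have c: "s n \<in> carrier A" "y \<in> carrier A" using y s(1) SD by auto
    have "l \<ominus> y = (l \<ominus> s n) \<oplus> (s n \<ominus> y)"
      using c s(2) by (simp add: a_minus_def a_assoc r_neg1)
    then have "cnorm A (l \<ominus> y) \<le> cnorm A (l \<ominus> s n) + cnorm A (s n \<ominus> y)"
      using c s(2) by (simp add: cnorm_triangle)
    then have "cnorm A (l \<ominus> y) < e"
      using n y(2) cnorm_diff_commute[OF s(2) c(1)] by simp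
    then show "\<exists>r. \<exists>y\<in>box r. cnorm A (l \<ominus> y) < e" using y(1) by blast
  qed
  have "subring S A"
  proof (rule subringI)
    show "\<one> \<in> S" using box_S[OF box.w[of 0 0 0]] by (simp add: w_zero)
    show "\<ominus> x \<in> S" if "x \<in> S" for x
      using S_scale[OF that, of "- 1"] SD[OF that] by (simp add: scale_minus_one)
  qed (use SD S_mult S_add in auto)
  then have "cstar_subalgebra S A"
    unfolding cstar_subalgebra_def using S_scale S_star S_limit by blast
  moreover have "U \<in> S" using box_S[OF box.w[of 1 1 0]] by (simp add: w_def)
  moreover have "V \<in> S" using box_S[OF box.w[of 0 1 1]] by (simp add: w_def)
  ultimately have "S = carrier A" by (rule generated)
  then show ?thesis using Sapprox[of x e] assms that by blast
qed

lemma dense_bound: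
  assumes \<phi>: "\<phi> \<in> dual A" and K: "0 \<le> K"
    and bound: "\<And>r y. y \<in> box r \<Longrightarrow> cmod (\<phi> y) \<le> K * cnorm A y" and x: "x \<in> carrier A"
  shows "cmod (\<phi> x) \<le> K * cnorm A x"
proof (rule le_if_le_add_mult)
  fix e :: real assume e: "0 < e"
  obtain r y where y: "y \<in> box r" "cnorm A (x \<ominus> y) < e" using box_dense[OF x e] by blast
  have c: "y \<in> carrier A" using y by simp
  have "y = x \<ominus> (x \<ominus> y)" using x c by (simp add: diff_diff_cancel)
  then have "cnorm A y \<le> cnorm A x + e" using cnorm_diff_le[of x "x \<ominus> y"] x c y(2) by simp
  then have "K * cnorm A y \<le> K * (cnorm A x + e)" using K by (rule mult_left_mono)
  moreover have "cmod (\<phi> (x \<ominus> y)) \<le> dual_norm A \<phi> * e"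
    using order_trans[OF dual_norm_bound[OF \<phi>, of "x \<ominus> y"] mult_left_mono[OF _ dual_norm_nonneg[OF \<phi>]]]
      x c y(2) by simp
  moreover have "cmod (\<phi> x) \<le> cmod (\<phi> y) + cmod (\<phi> (x \<ominus> y))"
    using norm_triangle_ineq[of "\<phi> y" "\<phi> x - \<phi> y"] x c \<phi> by (simp add: dual_diff)
  ultimately show "cmod (\<phi> x) \<le> K * cnorm A x + e * (K + dual_norm A \<phi>)"
    using bound[OF y(1)] by (simp add: algebra_simps)
qed

lemma dual_eq_on_w:
  assumes \<phi>: "\<phi> \<in> dual A" "\<theta> \<in> dual A" and eq: "\<And>k l. \<phi> (w k l) = \<theta> (w k l)"
  shows "\<phi> = \<theta>"
proof (rule dual_eqI[OF \<phi>])
  fix x assume x: "x \<in> carrier A"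
  have "\<phi> y = \<theta> y" if "y \<in> box r" for r y
    using that by (induction rule: box.induct) (auto simp: eq \<phi> dual_add dual_scale)
  then have "cmod (fadd \<phi> (fscale (- 1) \<theta>) x) \<le> 0 * cnorm A x"
    using \<phi> by (intro dense_bound[OF _ _ _ x]) auto
  then show "\<phi> x = \<theta> x" using x by simp
qed

text \<open>Conjugation by V^n multiplies U^k V^l by q^(kn). The averages of \<omega> tend to 0
  where k is nonzero, since q^k is not 1, and are constant for k = 0, where \<omega> already has the
  required values.\<close>

lemma trace_exists:
  assumes pos: "posf \<omega>" and \<omega>w: "\<And>k l. l \<noteq> 0 \<Longrightarrow> \<omega> (w k l) = 0" and one: "\<omega> \<one> = 1"
    and irrational: "\<And>k. k \<noteq> 0 \<Longrightarrow> q powi k \<noteq> 1"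
  obtains \<tau> where "posf \<tau>" "\<And>k l. \<tau> (w k l) = (if k = 0 \<and> l = 0 then 1 else 0)"
proof -
  have d: "\<omega> \<in> dual A" using pos by (rule posf_dual)
  define \<sigma> where "\<sigma> n = dual_act A (lact (zpow V (int n)) \<omega>) (star A (zpow V (int n)))" for n
  have \<sigma>_pos: "posf (\<sigma> n)" for n unfolding \<sigma>_def by (rule posf_conjugate[OF pos]) simp
  have \<sigma>_w: "\<sigma> n (w k l) = (q powi k) ^ n * \<omega> (w k l)" for n k l
  proof -
    have "zpow V (int n) = w 0 (int n)" "star A (zpow V (int n)) = w 0 (- int n)"
      by (auto simp: w_def star_zpow)
    then have "\<sigma> n (w k l) = \<omega> (w 0 (- int n) \<otimes> w k l \<otimes> w 0 (int n))"
      by (simp add: \<sigma>_def)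
    also have "\<dots> = q powi (int n * k) * \<omega> (w k l)"
      using d by (simp add: w_mult scale_mult_left dual_scale)
    also have "q powi (int n * k) = (q powi k) ^ n"
      by (simp add: mult.commute[of "int n"] power_int_mult)
    finally show ?thesis .
  qed
  have \<sigma>_bound: "cmod (\<sigma> n x) \<le> dual_norm A \<omega> * cnorm A x" if x: "x \<in> carrier A" for n x
  proof -
    let ?u = "zpow V (int n)"
    have nu: "cnorm A ?u \<le> 1" "cnorm A (star A ?u) \<le> 1"
      using cnorm_unitary_le unitary_zpow[OF unitary_V] unitary_star by auto
    have "cnorm A (star A ?u \<otimes> x \<otimes> ?u) \<le> cnorm A (star A ?u) * cnorm A x * cnorm A ?u"
      using x cnorm_mult[of "star A ?u \<otimes> x" ?u] cnorm_mult[of "star A ?u" x]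
        mult_right_mono[of "cnorm A (star A ?u \<otimes> x)" "cnorm A (star A ?u) * cnorm A x" "cnorm A ?u"]
        cnorm_nonneg[of ?u] by simp
    also have "\<dots> \<le> 1 * cnorm A x * 1"
      using nu x cnorm_nonneg by (intro mult_mono) auto
    finally have "dual_norm A \<omega> * cnorm A (star A ?u \<otimes> x \<otimes> ?u) \<le> dual_norm A \<omega> * cnorm A x"
      using dual_norm_nonneg[OF d] by (intro mult_left_mono) auto
    then show ?thesis
      using dual_norm_bound[OF d, of "star A ?u \<otimes> x \<otimes> ?u"] x by (simp add: \<sigma>_def)
  qed
  \<comment> \<open>\<open>F 0\<close> is 0 by division by zero; the uniform bound includes
    it.\<close>
  define F where "F N = (\<lambda>x\<in>carrier A. (\<Sum>n<N. \<sigma> n x) / of_nat N)" for N :: nat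
  have F_bound: "cmod (F N x) \<le> dual_norm A \<omega> * cnorm A x" if x: "x \<in> carrier A" for N x
  proof (cases "N = 0")
    case True
    then show ?thesis using x dual_norm_nonneg[OF d] cnorm_nonneg[OF x] by (simp add: F_def)
  next
    case False
    have "cmod (\<Sum>n<N. \<sigma> n x) \<le> of_nat N * (dual_norm A \<omega> * cnorm A x)"
      using sum_norm_le[of "{..<N}" "\<lambda>n. \<sigma> n x" "\<lambda>n. dual_norm A \<omega> * cnorm A x"] \<sigma>_bound[OF x] by simp
    then show ?thesis using False x by (simp add: F_def norm_divide field_simps)
  qed
  have F_dual: "F N \<in> dual A" for N
  proof (rule dualI[OF _ _ _ F_bound])
    have s: "\<sigma> n \<in> dual A" for n using \<sigma>_pos by (rule posf_dual)
    show "F N (x \<oplus> y) = F N x + F N y" if "x \<in> carrier A" "y \<in> carrier A" for x y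
      using that by (simp add: F_def dual_add[OF s] sum.distrib add_divide_distrib)
    show "F N (scale A c x) = c * F N x" if "x \<in> carrier A" for c x
      using that by (simp add: F_def dual_scale[OF s] sum_distrib_left)
    show "F N \<in> extensional (carrier A)" unfolding F_def by (rule restrict_extensional)
  qed
  have F_w: "(\<lambda>N. F N (w k l)) \<longlonglongrightarrow> (if k = 0 \<and> l = 0 then 1 else 0)" for k l
  proof -
    have F_eq: "F N (w k l) = (\<Sum>n<N. (q powi k) ^ n) / of_nat N * \<omega> (w k l)" for N
      by (simp add: F_def \<sigma>_w sum_distrib_right)
    show ?thesis
    proof (cases "k = 0")
      case True
      have "eventually (\<lambda>N. F N (w k l) = \<omega> (w k l)) sequentially"
        using eventually_gt_at_top[of 0] by eventually_elim (use F_eq True in simp)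
      then have "(\<lambda>N. F N (w k l)) \<longlonglongrightarrow> \<omega> (w k l)" by (rule tendsto_eventually)
      then show ?thesis using True \<omega>w one by (cases "l = 0") (auto simp: w_zero)
    next
      case False
      then show ?thesis
        unfolding F_eq
        using tendsto_mult_right[OF geometric_average_tendsto_zero[of "q powi k"], of "\<omega> (w k l)"]
          irrational[OF False] by simp
    qed
  qed
  have conv_box: "convergent (\<lambda>N. F N y)" if "y \<in> box r" for y r
    using that
  proof (induction rule: box.induct)
    case (w k l)
    then show ?case using F_w by (rule_tac convergentI)
  next
    case zero
    then show ?case using F_dual by (simp add: convergent_const)
  next
    case (add x y)
    then show ?case by (simp add: dual_add[OF F_dual] convergent_add)
  next
    case (scale x c)
    then show ?case
      unfolding convergent_def
      by (auto simp: dual_scale[OF F_dual] intro: tendsto_mult_left)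
  qed
  \<comment> \<open>Uniform boundedness carries convergence from Laurent polynomials to the whole
    algebra.\<close>
  have conv: "convergent (\<lambda>N. F N x)" if x: "x \<in> carrier A" for x
  proof -
    have "Cauchy (\<lambda>N. F N x)"
    proof (rule metric_CauchyI)
      fix e :: real assume e: "0 < e"
      define K where "K = dual_norm A \<omega> + 1"
      have K: "0 < K" using dual_norm_nonneg[OF d] by (simp add: K_def)
      have "0 < e / (3 * K)" using e K by simp
      then obtain r y where y: "y \<in> box r" "cnorm A (x \<ominus> y) < e / (3 * K)"
        using box_dense[OF x] by blast
      have c: "y \<in> carrier A" using y by simp
      have close: "cmod (F N x - F N y) < e / 3" for N
      proof -
        have "cmod (F N x - F N y) \<le> dual_norm A \<omega> * cnorm A (x \<ominus> y)"
          using F_bound[of "x \<ominus> y" N] x c by (simp add: dual_diff[OF F_dual])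
        also have "\<dots> \<le> K * cnorm A (x \<ominus> y)"
          using cnorm_nonneg[of "x \<ominus> y"] x c by (intro mult_right_mono) (auto simp: K_def)
        also have "\<dots> < e / 3" using y(2) K by (simp add: field_simps)
        finally show ?thesis .
      qed
      obtain M where M: "\<And>m n. \<lbrakk>M \<le> m; M \<le> n\<rbrakk> \<Longrightarrow> dist (F m y) (F n y) < e / 3"
        using metric_CauchyD[OF convergent_Cauchy[OF conv_box[OF y(1)]], of "e / 3"] e by auto
      have "dist (F m x) (F n x) < e" if "M \<le> m" "M \<le> n" for m n
        using M[OF that] close[of m] close[of n] dist_triangle[of "F m x" "F n x" "F m y"]
          dist_triangle[of "F m y" "F n x" "F n y"]
        by (simp add: dist_norm norm_minus_commute)
      then show "\<exists>M. \<forall>m\<ge>M. \<forall>n\<ge>M. dist (F m x) (F n x) < e" by blast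
    qed
    then show ?thesis by (simp add: Cauchy_convergent_iff)
  qed
  obtain \<tau> where \<tau>: "\<tau> \<in> dual A" "\<And>x. x \<in> carrier A \<Longrightarrow> (\<lambda>N. F N x) \<longlonglongrightarrow> \<tau> x"
    using dual_limit[OF F_dual F_bound conv] by blast
  have "\<tau> (star A x \<otimes> x) \<in> \<real>\<^sub>\<ge>\<^sub>0" if x: "x \<in> carrier A" for x
  proof (rule Lim_in_closed_set[OF closed_nonneg_Reals_complex _ _ \<tau>(2)])
    have "\<sigma> n (star A x \<otimes> x) \<in> \<real>\<^sub>\<ge>\<^sub>0" for n using \<sigma>_pos x by (simp add: posf_def)
    then have "(\<Sum>n<N. \<sigma> n (star A x \<otimes> x)) \<in> \<real>\<^sub>\<ge>\<^sub>0" for N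
      by (induction N) (auto intro: nonneg_Reals_add_I)
    then have "F N (star A x \<otimes> x) \<in> \<real>\<^sub>\<ge>\<^sub>0" for N
      using x by (simp add: F_def nonneg_Reals_divide_I)
    then show "\<forall>\<^sub>F N in sequentially. F N (star A x \<otimes> x) \<in> \<real>\<^sub>\<ge>\<^sub>0" by simp
  qed (use x in auto)
  then have "posf \<tau>" using \<tau>(1) by (simp add: posf_def)
  moreover have "\<tau> (w k l) = (if k = 0 \<and> l = 0 then 1 else 0)" for k l
    using LIMSEQ_unique[OF \<tau>(2)[OF w_closed] F_w] .
  ultimately show ?thesis using that by blast
qed

end

section \<open>The norm and the column inequality in the trace representation\<close>

locale rotation_trace = rotation_algebra +
  fixes \<tau> :: "'a \<Rightarrow> complex"
  assumes trace_pos: "posf \<tau>"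
    and trace_w: "\<tau> (w k l) = (if k = 0 \<and> l = 0 then 1 else 0)"
begin

lemma trace_dual: "\<tau> \<in> dual A"
  using trace_pos by (rule posf_dual)

lemma sn_trace_one: "sn \<tau> \<one> = 1"
  using trace_w[of 0 0] by (simp add: sn_def w_zero)

lemma ip_trace_w: "ip \<tau> (w k l) (w k' l') = (if k = k' \<and> l = l' then 1 else 0)"
proof -
  have "ip \<tau> (w k l) (w k' l') = q powi (- l * k) * (q powi (l * k') * \<tau> (w (k' - k) (l' - l)))"
    using trace_dual by (simp add: ip_def star_w w_mult scale_mult_left dual_scale)
  then show ?thesis
    by (auto simp: trace_w power_int_minus)
qed

text \<open>x is the sum of its (2r+1)^2 Fourier components. Each is a unitary times a coefficient
  that Cauchy-Schwarz bounds by \<open>sn \<tau> x\<close>, since the monomials are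
  orthonormal.\<close>

lemma box_cnorm_le:
  assumes x: "x \<in> box r"
  shows "cnorm A x \<le> (2 * real r + 1)\<^sup>2 * sn \<tau> x"
proof -
  define I where "I = {- int r..int r} \<times> {- int r..int r}"
  define g where "g x i = scale A (ip \<tau> (w (fst i) (snd i)) x) (w (fst i) (snd i))" for x i
  have fin: "finite I" by (simp add: I_def)
  have g_closed: "g x \<in> I \<rightarrow> carrier A" for x by (auto simp: g_def)
  have "x = finsum A (g x) I"
    using x
  proof (induction rule: box.induct)
    case (w k l)
    have "finsum A (g (w k l)) I = finsum A (\<lambda>i. if (k, l) = i then w (fst i) (snd i) else \<zero>) I"
      by (rule finsum_cong') (auto simp: g_def ip_trace_w)
    also have "\<dots> = w (fst (k, l)) (snd (k, l))"
      using fin w by (intro finsum_singleton) (auto simp: I_def)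
    finally show ?case by simp
  next
    case zero
    have "finsum A (g \<zero>) I = finsum A (\<lambda>i. \<zero>) I"
      by (rule finsum_cong') (auto simp: g_def ip_def trace_dual)
    then show ?case by simp
  next
    case (add x y)
    have "finsum A (g (x \<oplus> y)) I = finsum A (\<lambda>i. g x i \<oplus> g y i) I"
      using add by (intro finsum_cong') (auto simp: g_def ip_linear[OF trace_dual] scale_add_left)
    then show ?case using add g_closed by (simp add: finsum_addf)
  next
    case (scale x c)
    have xc: "x \<in> carrier A" using scale.hyps by (rule box_closed)
    have "finsum A (\<lambda>i. scale A c (g x i)) J = scale A c (finsum A (g x) J)" if "finite J" for J
      using that
    proof induction
      case (insert j J)
      then show ?case
        using g_closed scale by (simp add: finsum_insert Pi_def g_def scale_add_right)
    qed simp
    moreover have "finsum A (g (scale A c x)) I = finsum A (\<lambda>i. scale A c (g x i)) I"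
      using xc by (intro finsum_cong') (auto simp: g_def ip_linear[OF trace_dual] scale_scale)
    ultimately show ?case using scale fin by simp
  qed
  moreover have "cnorm A (finsum A (g x) J) \<le> of_nat (card J) * sn \<tau> x" if "finite J" for J
    using that
  proof induction
    case (insert j J)
    have gj: "g x j \<in> carrier A" and gJ: "finsum A (g x) J \<in> carrier A"
      by (auto simp: g_def intro!: finsum_closed)
    have w1: "sn \<tau> (w k l) = 1" for k l by (simp add: sn_def ip_trace_w)
    have "unitary A (w k l)" for k l
      using unitary_zpow[OF unitary_U, of k] unitary_zpow[OF unitary_V, of l]
      by (auto simp: unitary_def w_def star_mult m_assoc)
        (metis (no_types, lifting) U_closed V_closed l_one m_assoc m_closed star_closed zpow_closed)+
    then have "cnorm A (w k l) \<le> 1" for k l by (rule cnorm_unitary_le)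
    moreover have "cmod (ip \<tau> (w k l) x) \<le> sn \<tau> x" for k l
      using ip_le[OF trace_pos w_closed box_closed[OF x]] w1 by simp
    ultimately have "cmod (ip \<tau> (w k l) x) * cnorm A (w k l) \<le> sn \<tau> x * 1" for k l
      using ip_self(2)[OF trace_pos box_closed[OF x]] cnorm_nonneg by (intro mult_mono) auto
    then have "cnorm A (g x j) \<le> sn \<tau> x"
      by (simp add: g_def cnorm_scale)
    then have "cnorm A (g x j \<oplus> finsum A (g x) J) \<le> sn \<tau> x + of_nat (card J) * sn \<tau> x"
      using cnorm_triangle[OF gj gJ] insert.IH by simp
    then show ?case
      using insert.hyps gj by (subst finsum_insert) (auto simp: g_def algebra_simps)
  qed simp
  ultimately have "cnorm A x \<le> of_nat (card I) * sn \<tau> x" using fin by metis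
  also have "of_nat (card I) = (2 * real r + 1)\<^sup>2"
    by (simp add: I_def card_cartesian_product power2_eq_square)
  finally show ?thesis .
qed

lemma cnorm_pow_two:
  assumes h: "h \<in> carrier A" "star A h = h"
  shows "cnorm A (h [^] ((2::nat) ^ k)) = cnorm A h ^ (2 ^ k)"
proof (induction k)
  case (Suc k)
  let ?g = "h [^] ((2::nat) ^ k)"
  have "h [^] ((2::nat) ^ Suc k) = star A ?g \<otimes> ?g"
    using h by (simp add: star_pow nat_pow_mult mult_2)
  then have "cnorm A (h [^] ((2::nat) ^ Suc k)) = (cnorm A ?g)\<^sup>2"
    using h by (simp only: cnorm_star_mult nat_pow_closed)
  then show ?case using Suc by (simp add: power_mult[symmetric] mult.commute)
qed (use h in simp)

text \<open>The norm of a rotation algebra is the operator norm in the trace representation: the number of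
  monomials in the \<open>n\<close>-th power of a polynomial grows polynomially in \<open>n\<close>, so that on powers the
  \<open>\<ell>\<^sup>1\<close>-norm is only polynomially larger than the \<open>\<ell>\<^sup>2\<close>-norm, and the C*-identity
  removes the polynomial factor.\<close>

lemma box_cnorm_le_operator_norm:
  assumes x: "x \<in> box r" and M: "\<And>y. y \<in> carrier A \<Longrightarrow> sn \<tau> (x \<otimes> y) \<le> M * sn \<tau> y"
  shows "cnorm A x \<le> M"
proof -
  have xc: "x \<in> carrier A" using x by simp
  have M0: "0 \<le> M"
    using order_trans[OF ip_self(2)[OF trace_pos, of "x \<otimes> \<one>"] M[of \<one>]] xc by (simp add: sn_trace_one)
  \<comment> \<open>The adjoint of x has the same operator bound, so h has the bound M^2.\<close>
  have adj: "sn \<tau> (star A x \<otimes> y) \<le> M * sn \<tau> y" if y: "y \<in> carrier A" for y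
  proof -
    let ?z = "star A x \<otimes> y"
    have z: "?z \<in> carrier A" using xc y by simp
    have "(sn \<tau> ?z)\<^sup>2 = Re (ip \<tau> (x \<otimes> ?z) y)"
      using xc y by (simp add: sn_power2[OF trace_pos] ip_mult(2)[OF trace_dual] star_mult m_assoc)
    also have "\<dots> \<le> sn \<tau> (x \<otimes> ?z) * sn \<tau> y"
      using xc y by (intro Re_ip_le[OF trace_pos]) auto
    also have "\<dots> \<le> M * sn \<tau> ?z * sn \<tau> y"
      using M[OF z] ip_self(2)[OF trace_pos y] by (rule mult_right_mono)
    finally have "sn \<tau> ?z * sn \<tau> ?z \<le> (M * sn \<tau> y) * sn \<tau> ?z"
      by (simp add: power2_eq_square mult_ac)
    then show ?thesis
      using ip_self(2)[OF trace_pos z] ip_self(2)[OF trace_pos y] M0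
        mult_right_le_imp_le[of "sn \<tau> ?z" "sn \<tau> ?z" "M * sn \<tau> y"]
      by (cases "sn \<tau> ?z = 0") auto
  qed
  define h where "h = star A x \<otimes> x"
  have h: "h \<in> carrier A" "star A h = h" using xc by (auto simp: h_def star_mult)
  have h_box: "h \<in> box (2 * r)" using box_mult[OF box_star[OF x] x] by (simp add: h_def mult_2)
  have h_le: "sn \<tau> (h \<otimes> y) \<le> M\<^sup>2 * sn \<tau> y" if y: "y \<in> carrier A" for y
    using order_trans[OF adj[of "x \<otimes> y"] mult_left_mono[OF M[OF y] M0]] xc y
    by (simp add: h_def m_assoc power2_eq_square)
  have pow_le: "sn \<tau> (h [^] (n::nat)) \<le> (M\<^sup>2) ^ n" for n
  proof (induction n)
    case 0
    then show ?case by (simp add: sn_trace_one)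
  next
    case (Suc n)
    have "sn \<tau> (h [^] Suc n) = sn \<tau> (h \<otimes> h [^] n)" using h nat_pow_Suc2 by metis
    also have "\<dots> \<le> M\<^sup>2 * (M\<^sup>2) ^ n"
      using order_trans[OF h_le mult_left_mono[OF Suc]] h by simp
    finally show ?case by simp
  qed
  have "cnorm A h \<le> M\<^sup>2"
  proof (rule polynomial_exponential_bound_imp_le)
    fix k :: nat
    have "cnorm A h ^ 2 ^ k = cnorm A (h [^] ((2::nat) ^ k))" using cnorm_pow_two[OF h] by simp
    \<comment> \<open>The power h^(2^k) has degree at most 2^k times 2r, so the factor from
      \<open>box_cnorm_le\<close> grows only quadratically in 2^k.\<close>
    also have "\<dots> \<le> (2 * real (2 ^ k * (2 * r)) + 1)\<^sup>2 * sn \<tau> (h [^] ((2::nat) ^ k))"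
      by (rule box_cnorm_le[OF box_pow[OF h_box]])
    also have "\<dots> \<le> (2 * real (2 ^ k * (2 * r)) + 1)\<^sup>2 * (M\<^sup>2) ^ 2 ^ k"
      using pow_le by (intro mult_left_mono) auto
    finally show "cnorm A h ^ 2 ^ k \<le> (4 * real r * 2 ^ k + 1)\<^sup>2 * (M\<^sup>2) ^ 2 ^ k"
      by (simp add: mult_ac)
  qed auto
  then have "(cnorm A x)\<^sup>2 \<le> M\<^sup>2" using xc by (simp add: h_def cnorm_star_mult)
  then show ?thesis using M0 by (rule power2_le_imp_le)
qed

text \<open>Replacing x by a Laurent polynomial within e changes the operator bound and the norm by
  at most e each.\<close>

lemma cnorm_le_operator_norm:
  assumes x: "x \<in> carrier A" and M: "\<And>y. y \<in> carrier A \<Longrightarrow> sn \<tau> (x \<otimes> y) \<le> M * sn \<tau> y"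
  shows "cnorm A x \<le> M"
proof (rule le_if_le_add_mult)
  fix e :: real assume e: "0 < e"
  obtain r y where y: "y \<in> box r" "cnorm A (x \<ominus> y) < e" using box_dense[OF x e] by blast
  have c: "y \<in> carrier A" using y by simp
  have "cnorm A y \<le> M + e"
  proof (rule box_cnorm_le_operator_norm[OF y(1)])
    fix z assume z: "z \<in> carrier A"
    have "y \<otimes> z = x \<otimes> z \<ominus> (x \<ominus> y) \<otimes> z"
    proof -
      have "(x \<ominus> y) \<otimes> z = x \<otimes> z \<ominus> y \<otimes> z"
        using x c z by (simp add: a_minus_def l_distr l_minus)
      then show ?thesis using x c z by (simp add: diff_diff_cancel)
    qed
    then have "sn \<tau> (y \<otimes> z) \<le> sn \<tau> (x \<otimes> z) + sn \<tau> ((x \<ominus> y) \<otimes> z)"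
      using sn_triangle_diff[OF trace_pos] x c z by simp
    also have "\<dots> \<le> M * sn \<tau> z + cnorm A (x \<ominus> y) * sn \<tau> z"
      using M[OF z] sn_mult_le[OF trace_pos _ z, of "x \<ominus> y"] x c by simp
    also have "\<dots> \<le> M * sn \<tau> z + e * sn \<tau> z"
      using y(2) ip_self(2)[OF trace_pos z] by (intro add_left_mono mult_right_mono) auto
    finally show "sn \<tau> (y \<otimes> z) \<le> (M + e) * sn \<tau> z" by (simp add: distrib_right)
  qed
  moreover have "cnorm A x \<le> cnorm A (x \<ominus> y) + cnorm A y"
    using cnorm_triangle[of "x \<ominus> y" y] x c by (simp add: diff_add_cancel)
  ultimately show "cnorm A x \<le> M + e * 2" using y(2) by simp
qed

text \<open>In the trace representation this is Cauchy-Schwarz for the vectors x z with x in the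
  list, whose squared norms add up to the inner product of z with
  \<open>sqsum xs \<otimes> z\<close>; \<open>cnorm_le_operator_norm\<close> converts it into norms
  of the algebra.\<close>

lemma column_inequality:
  assumes xs: "set xs \<subseteq> carrier A"
  shows "(cnorm A (lincomb c xs))\<^sup>2 \<le> (\<Sum>x\<leftarrow>xs. (cmod (c x))\<^sup>2) * cnorm A (sqsum xs)"
proof -
  define S where "S = (\<Sum>x\<leftarrow>xs. (cmod (c x))\<^sup>2)"
  have S: "0 \<le> S" unfolding S_def by (rule sum_list_nonneg) auto
  have T: "0 \<le> cnorm A (sqsum xs)" using xs by (simp add: cnorm_nonneg)
  have cs: "(sn \<tau> (lincomb c ys \<otimes> z))\<^sup>2 \<le> (\<Sum>x\<leftarrow>ys. (cmod (c x))\<^sup>2) * Re (ip \<tau> z (sqsum ys \<otimes> z))"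
    if z: "z \<in> carrier A" and "set ys \<subseteq> carrier A" for z ys
    using that(2)
  proof (induction ys)
    case Nil
    then show ?case using z by (simp add: sn_def ip_def trace_dual)
  next
    case (Cons x ys)
    define a where "a = (\<Sum>x\<leftarrow>ys. (cmod (c x))\<^sup>2)"
    define b where "b = Re (ip \<tau> z (sqsum ys \<otimes> z))"
    define s where "s = sn \<tau> (lincomb c ys \<otimes> z)"
    define t where "t = sn \<tau> (x \<otimes> z)"
    have x: "x \<in> carrier A" "set ys \<subseteq> carrier A" using Cons.prems by auto
    have a0: "0 \<le> a" unfolding a_def by (rule sum_list_nonneg) auto
    have b_nonneg: "0 \<le> Re (ip \<tau> z (sqsum ys \<otimes> z))" if "set ys \<subseteq> carrier A" for ys
      using that
    proof (induction ys)
      case Nil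
      then show ?case using z by (simp add: ip_def trace_dual)
    next
      case (Cons y ys)
      have "ip \<tau> z (star A y \<otimes> y \<otimes> z) = ip \<tau> (y \<otimes> z) (y \<otimes> z)"
        using Cons.prems z by (simp add: ip_mult(2)[OF trace_dual] m_assoc)
      then have "0 \<le> Re (ip \<tau> z (star A y \<otimes> y \<otimes> z))"
        using Cons.prems z sn_power2[OF trace_pos, of "y \<otimes> z"] by (simp flip: sn_power2[OF trace_pos])
      then show ?case using Cons z by (simp add: l_distr ip_linear[OF trace_dual])
    qed
    have b0: "0 \<le> b" using b_nonneg x(2) by (simp add: b_def)
    have st: "0 \<le> s" "0 \<le> t" using x z ip_self(2)[OF trace_pos] by (auto simp: s_def t_def)
    have IH: "s\<^sup>2 \<le> a * b" using Cons.IH[OF x(2)] by (simp add: s_def a_def b_def)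
    have "sn \<tau> (lincomb c (x # ys) \<otimes> z) \<le> sn \<tau> (scale A (c x) (x \<otimes> z)) + s"
      using sn_triangle[OF trace_pos, of "scale A (c x) (x \<otimes> z)" "lincomb c ys \<otimes> z"] x z
      by (simp add: l_distr scale_mult_left s_def)
    also have "\<dots> = cmod (c x) * t + s" using x z by (simp add: sn_scale[OF trace_pos] t_def)
    finally have "(sn \<tau> (lincomb c (x # ys) \<otimes> z))\<^sup>2 \<le> (cmod (c x) * t + s)\<^sup>2"
      using x z ip_self(2)[OF trace_pos] Cons.prems by (intro power_mono) auto
    also have "\<dots> \<le> ((cmod (c x))\<^sup>2 + a) * (t\<^sup>2 + b)"
    proof -
      \<comment> \<open>The cross term is controlled by s^2 <= a b and the arithmetic-geometric mean
        inequality.\<close>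
      have "(2 * (cmod (c x) * t) * s)\<^sup>2 = 4 * (cmod (c x))\<^sup>2 * t\<^sup>2 * s\<^sup>2"
        by (simp add: power_mult_distrib)
      also have "\<dots> \<le> 4 * (cmod (c x))\<^sup>2 * t\<^sup>2 * (a * b)"
        using IH by (intro mult_left_mono) auto
      also have "\<dots> = 4 * ((cmod (c x))\<^sup>2 * b) * (a * t\<^sup>2)" by (simp add: mult_ac)
      also have "\<dots> \<le> ((cmod (c x))\<^sup>2 * b + a * t\<^sup>2)\<^sup>2"
      proof -
        have "4 * u * v \<le> (u + v)\<^sup>2" for u v :: real
          using zero_le_power2[of "u - v"] by (simp add: power2_diff power2_sum)
        then show ?thesis .
      qed
      finally have "2 * (cmod (c x) * t) * s \<le> (cmod (c x))\<^sup>2 * b + a * t\<^sup>2"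
        by (rule power2_le_imp_le) (use a0 b0 in simp)
      then show ?thesis using IH by (simp add: power2_sum power_mult_distrib algebra_simps)
    qed
    also have "t\<^sup>2 + b = Re (ip \<tau> z (sqsum (x # ys) \<otimes> z))"
    proof -
      have "ip \<tau> z (star A x \<otimes> x \<otimes> z) = ip \<tau> (x \<otimes> z) (x \<otimes> z)"
        using x z by (simp add: ip_mult(2)[OF trace_dual] m_assoc)
      then show ?thesis
        using x z by (simp add: t_def b_def sn_power2[OF trace_pos] l_distr ip_linear[OF trace_dual])
    qed
    finally show ?case by (simp add: a_def)
  qed
  have "cnorm A (lincomb c xs) \<le> sqrt (S * cnorm A (sqsum xs))"
  proof (rule cnorm_le_operator_norm)
    fix z assume z: "z \<in> carrier A"
    have "Re (ip \<tau> z (sqsum xs \<otimes> z)) \<le> sn \<tau> z * sn \<tau> (sqsum xs \<otimes> z)"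
      using xs z by (intro Re_ip_le[OF trace_pos]) auto
    also have "\<dots> \<le> sn \<tau> z * (cnorm A (sqsum xs) * sn \<tau> z)"
      using xs z ip_self(2)[OF trace_pos z] by (intro mult_left_mono sn_mult_le[OF trace_pos]) auto
    finally have "S * Re (ip \<tau> z (sqsum xs \<otimes> z)) \<le> S * (sn \<tau> z * (cnorm A (sqsum xs) * sn \<tau> z))"
      using S by (rule mult_left_mono)
    then have "(sn \<tau> (lincomb c xs \<otimes> z))\<^sup>2 \<le> (S * cnorm A (sqsum xs)) * (sn \<tau> z)\<^sup>2"
      using cs[OF z xs] by (simp add: S_def power2_eq_square mult_ac)
    also have "\<dots> = (sqrt (S * cnorm A (sqsum xs)) * sn \<tau> z)\<^sup>2"
      using S T by (simp add: power_mult_distrib)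
    finally show "sn \<tau> (lincomb c xs \<otimes> z) \<le> sqrt (S * cnorm A (sqsum xs)) * sn \<tau> z"
      by (rule power2_le_imp_le) (use S T ip_self(2)[OF trace_pos z] in simp)
  qed (use xs in auto)
  then have "(cnorm A (lincomb c xs))\<^sup>2 \<le> (sqrt (S * cnorm A (sqsum xs)))\<^sup>2"
    using xs by (intro power_mono cnorm_nonneg) auto
  then show ?thesis using S T by (simp add: S_def)
qed

sublocale column_cstar_algebra
  by unfold_locales (rule column_inequality)

end

section \<open>States given by quasi-invariant measures\<close>

text \<open>Conjugation by V and by its adjoint rotates \<mu> by q and by the inverse of q; this is
  the form in which quasi-invariance acts on the generators.\<close>

locale quasi_invariant_state = rotation_algebra A U V q + circle_measure \<mu>
  for A :: "('a, 'm) cstar_scheme" (structure) and U V q \<mu> +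
  fixes \<omega> :: "'a \<Rightarrow> complex"
  assumes omega_pos: "posf \<omega>"
    and omega_w: "\<omega> (w k l) = (if l = 0 then fourier_coeff \<mu> k else 0)"
    and irrational: "k \<noteq> 0 \<Longrightarrow> q powi k \<noteq> 1"
    and ac: "absolutely_continuous \<mu> (distr \<mu> circle_borel ((*) q))"
    and ac_inverse: "absolutely_continuous \<mu> (distr \<mu> circle_borel ((*) (inverse q)))"
begin

lemma omega_dual: "\<omega> \<in> dual A"
  using omega_pos by (rule posf_dual)

lemma omega_one: "\<omega> \<one> = 1"
  using omega_w[of 0 0] by (simp add: w_zero fourier_coeff_def prob_space)

text \<open>The trace is interpreted inside this proof, so that only the column inequality, which
  does not mention it, passes to the locale.\<close>

lemma column_cstar: "column_cstar_algebra A"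
proof -
  obtain \<tau> where "posf \<tau>" "\<And>k l. \<tau> (w k l) = (if k = 0 \<and> l = 0 then 1 else 0)"
    using trace_exists[OF omega_pos _ omega_one irrational] omega_w by (metis (no_types, lifting))
  then interpret rotation_trace A U V q \<tau> by unfold_locales auto
  show ?thesis by (rule column_cstar_algebra_axioms)
qed

sublocale column_cstar_algebra
  by (rule column_cstar)

text \<open>D is the Radon-Nikodym density of the rotated measure, whose Fourier coefficients are
  those of \<mu> times c^k. It is taken real and nonnegative everywhere because its square root will
  be approximated.\<close>

lemma real_density:
  assumes c: "cmod c = 1" and abs_cont: "absolutely_continuous \<mu> (distr \<mu> circle_borel ((*) c))"
  obtains D where "D \<in> borel_measurable \<mu>" "\<And>z. 0 \<le> D z" "integrable \<mu> D"
    "\<And>k. c powi k * fourier_coeff \<mu> k = (LINT z|\<mu>. of_real (D z) * z powi k)"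
proof -
  let ?N = "distr \<mu> circle_borel ((*) c)"
  have meas: "(*) c \<in> measurable \<mu> circle_borel"
    unfolding circle_borel_def
  proof (rule measurable_restrict_space2)
    show "(*) c \<in> space \<mu> \<rightarrow> sphere 0 1" using c by (auto simp: space_circle norm_mult)
    show "(*) c \<in> borel_measurable \<mu>" by (intro measurable_of_borel) simp
  qed
  interpret N: prob_space ?N by (rule prob_space_distr[OF meas])
  have sets_N: "sets ?N = sets \<mu>" using sets_circle by simp
  obtain D where D: "D \<in> borel_measurable \<mu>" "AE z in \<mu>. RN_deriv \<mu> ?N z = ennreal (D z)"
    "AE z in ?N. 0 < D z" "\<And>z. 0 \<le> D z"
    using real_RN_deriv[OF N.finite_measure_axioms abs_cont sets_N] by blast
  have "?N = density \<mu> (RN_deriv \<mu> ?N)"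
    using density_RN_deriv[OF abs_cont sets_N] by simp
  also have "\<dots> = density \<mu> (\<lambda>z. ennreal (D z))"
    using D by (intro density_cong) auto
  finally have N_eq: "?N = density \<mu> (\<lambda>z. ennreal (D z))" .
  have "integrable ?N (\<lambda>z. 1 :: real)" by simp
  then have "integrable \<mu> D"
    unfolding N_eq using D by (simp add: integrable_density)
  moreover have "c powi k * fourier_coeff \<mu> k = (LINT z|\<mu>. of_real (D z) * z powi k)" for k
  proof -
    have "c powi k * fourier_coeff \<mu> k = (LINT z|\<mu>. (c * z) powi k)"
      by (simp add: fourier_coeff_def power_int_mult_distrib)
    also have "\<dots> = (LINT z|?N. z powi k)"
    proof (rule integral_distr[symmetric, OF meas])
      show "(\<lambda>z. z powi k) \<in> borel_measurable circle_borel"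
        unfolding circle_borel_def by (intro measurable_restrict_space1) simp
    qed
    also have "\<dots> = (LINT z|\<mu>. D z *\<^sub>R z powi k)"
      unfolding N_eq using D measurable_of_borel[OF powi_measurable] by (intro integral_density) auto
    finally show ?thesis by (simp add: scaleR_conv_of_real)
  qed
  ultimately show ?thesis using that D by blast
qed

section \<open>Functional calculus of trigonometric polynomials in U\<close>

inductive trig_elem :: "'a \<Rightarrow> (complex \<Rightarrow> complex) \<Rightarrow> bool" where
  monomial: "trig_elem (zpow U k) (\<lambda>z. z powi k)"
| add: "\<lbrakk>trig_elem x f; trig_elem y g\<rbrakk> \<Longrightarrow> trig_elem (x \<oplus> y) (\<lambda>z. f z + g z)"
| scale: "trig_elem x f \<Longrightarrow> trig_elem (scale A c x) (\<lambda>z. c * f z)"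

lemma trig_elem_closed [simp]: "trig_elem x f \<Longrightarrow> x \<in> carrier A"
  by (induction rule: trig_elem.induct) auto

lemma trig_elem_poly: "trig_elem x f \<Longrightarrow> trig_poly f"
  by (induction rule: trig_elem.induct) (auto intro: trig_poly.intros)

text \<open>The calculus is a relation, so existence is all there is to show: no choice of
  coefficients has to be well defined.\<close>

lemma trig_elem_exists: "trig_poly f \<Longrightarrow> \<exists>x. trig_elem x f"
  by (induction rule: trig_poly.induct) (blast intro: trig_elem.intros)+

lemma trig_elem_diff:
  assumes "trig_elem x f" "trig_elem y g"
  shows "trig_elem (x \<ominus> y) (\<lambda>z. f z - g z)"
  using trig_elem.add[OF assms(1) trig_elem.scale[OF assms(2), of "- 1"]] assms
  by (simp add: minus_eq_scale)

lemma trig_integrable: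
  assumes "trig_poly f" "trig_poly g"
  shows "integrable \<mu> (\<lambda>z. z powi k * g z)" "integrable \<mu> (\<lambda>z. cnj (f z) * (z powi k * g z))"
proof -
  obtain B C where B: "\<And>z. z \<in> sphere 0 1 \<Longrightarrow> cmod (f z) \<le> B"
    and C: "\<And>z. z \<in> sphere 0 1 \<Longrightarrow> cmod (g z) \<le> C"
    using trig_poly_bounded assms by metis
  have [measurable]: "f \<in> borel_measurable \<mu>" "g \<in> borel_measurable \<mu>"
    "(\<lambda>z. z powi k) \<in> borel_measurable \<mu>"
    using assms trig_poly_measurable by (auto intro: trig_poly.intros)
  have [measurable]: "(\<lambda>z. cnj (f z)) \<in> borel_measurable \<mu>"
    by (rule borel_measurable_continuous_on[of cnj]) (auto intro: continuous_intros)
  show "integrable \<mu> (\<lambda>z. z powi k * g z)"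
    by (rule bounded_integrable[of _ C]) (use C in \<open>auto simp: norm_mult norm_power_int\<close>)
  show "integrable \<mu> (\<lambda>z. cnj (f z) * (z powi k * g z))"
  proof (rule bounded_integrable[of _ "B * C"])
    fix z :: complex assume z: "z \<in> sphere 0 1"
    have "cmod (f z) * cmod (g z) \<le> B * C"
      using B[OF z] C[OF z] order_trans[OF norm_ge_zero B[OF z]] by (intro mult_mono) auto
    then show "norm (cnj (f z) * (z powi k * g z)) \<le> B * C"
      using z by (simp add: norm_mult norm_power_int)
  qed measurable
qed

lemma omega_mult_trig:
  assumes "trig_elem y g"
  shows "\<omega> (w k l \<otimes> y) = (if l = 0 then LINT z|\<mu>. z powi k * g z else 0)"
  using assms
proof (induction rule: trig_elem.induct)
  case (monomial j)
  have "zpow U j = w j 0" by (simp add: w_def)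
  moreover have "fourier_coeff \<mu> (k + j) = (LINT z|\<mu>. z powi k * z powi j)"
    unfolding fourier_coeff_def
    by (intro Bochner_Integration.integral_cong refl) (subst power_int_add; auto simp: space_circle)
  ultimately show ?case
    by (simp add: w_mult dual_scale[OF omega_dual] omega_w)
next
  case (add x f y g)
  then show ?case
    using trig_integrable(1)[OF trig_elem_poly[OF add.hyps(1)] trig_elem_poly[OF add.hyps(1)]]
      trig_integrable(1)[OF trig_elem_poly[OF add.hyps(2)] trig_elem_poly[OF add.hyps(2)]]
      trig_elem_closed[OF add.hyps(1)] trig_elem_closed[OF add.hyps(2)]
    by (simp add: r_distr dual_add[OF omega_dual] distrib_left)
next
  case (scale x f c)
  then show ?case
    using trig_elem_closed[OF scale.hyps]
    by (simp add: scale_mult_right dual_scale[OF omega_dual] mult.left_commute)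
qed

text \<open>The algebra of U applied to the cyclic vector of \<omega> gives a copy of L2(\<mu>), on
  which U^k multiplies by z^k; a nonzero power of V moves it to an orthogonal subspace.\<close>

lemma omega_sandwich:
  assumes x: "trig_elem x f" and y: "trig_elem y g"
  shows "ip \<omega> x (w k l \<otimes> y) = (if l = 0 then LINT z|\<mu>. cnj (f z) * (z powi k * g z) else 0)"
  using x
proof (induction rule: trig_elem.induct)
  case (monomial j)
  have "star A (zpow U j) = w (- j) 0" by (simp add: w_def star_zpow)
  then have "ip \<omega> (zpow U j) (w k l \<otimes> y) = \<omega> (w (k - j) l \<otimes> y)"
    using y by (simp add: ip_def m_assoc[symmetric] w_mult)
  moreover have "(LINT z|\<mu>. z powi (k - j) * g z) = (LINT z|\<mu>. cnj (z powi j) * (z powi k * g z))"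
  proof (intro Bochner_Integration.integral_cong refl)
    fix z assume "z \<in> space \<mu>"
    then have z: "z \<in> sphere 0 1" by (simp add: space_circle)
    then have "z \<noteq> 0" by auto
    have "cnj (z powi j) = (z powi (- 1)) powi j"
      using circle_inverse[OF z] by simp
    also have "\<dots> = z powi (- j)" by (simp only: power_int_mult[symmetric] mult_minus1)
    finally have "cnj (z powi j) = z powi (- j)" .
    then show "z powi (k - j) * g z = cnj (z powi j) * (z powi k * g z)"
      using \<open>z \<noteq> 0\<close> by (simp add: power_int_add[symmetric] mult.assoc[symmetric])
  qed
  ultimately show ?case using omega_mult_trig[OF y] by simp
next
  case (add x f x' f')
  then show ?case
    using trig_integrable(2)[OF trig_elem_poly[OF add.hyps(1)] trig_elem_poly[OF y]]
      trig_integrable(2)[OF trig_elem_poly[OF add.hyps(2)] trig_elem_poly[OF y]]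
      trig_elem_closed[OF add.hyps(1)] trig_elem_closed[OF add.hyps(2)] trig_elem_closed[OF y]
    by (simp add: ip_linear[OF omega_dual] distrib_right)
next
  case (scale x f c)
  then show ?case
    using trig_elem_closed[OF scale.hyps] trig_elem_closed[OF y]
    by (simp add: ip_scale[OF omega_dual] mult.assoc)
qed

lemma sn_trig_elem:
  assumes "trig_elem x f"
  shows "(sn \<omega> x)\<^sup>2 = (LINT z|\<mu>. (cmod (f z))\<^sup>2)"
proof -
  have "ip \<omega> x x = (LINT z|\<mu>. cnj (f z) * f z)"
    using omega_sandwich[OF assms assms, of 0 0] assms by (simp add: w_zero)
  also have "\<dots> = (LINT z|\<mu>. of_real ((cmod (f z))\<^sup>2))"
    by (intro Bochner_Integration.integral_cong refl) (simp only: complex_norm_square mult.commute)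
  also have "\<dots> = of_real (LINT z|\<mu>. (cmod (f z))\<^sup>2)" by (rule integral_complex_of_real)
  finally show ?thesis using assms by (simp add: sn_power2[OF omega_pos])
qed

text \<open>On a monomial of degree l in V the two products differ by the factor q^(-lj), which is 1
  for l = 0; for other l both values vanish.\<close>

lemma omega_U_commute:
  assumes x: "x \<in> carrier A"
  shows "\<omega> (x \<otimes> zpow U j) = \<omega> (zpow U j \<otimes> x)"
proof -
  have U: "zpow U j = w j 0" by (simp add: w_def)
  have "lact (zpow U j) \<omega> = dual_act A \<omega> (zpow U j)"
    by (rule dual_eq_on_w)
      (auto simp: omega_dual U w_mult dual_scale[OF omega_dual] omega_w add.commute)
  from fun_cong[OF this, of x] show ?thesis using x by simp
qed

lemma omega_trig_commute:
  assumes "trig_elem y f" "x \<in> carrier A"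
  shows "\<omega> (x \<otimes> y) = \<omega> (y \<otimes> x)"
  using assms(1)
  by (induction rule: trig_elem.induct)
    (use assms(2) in \<open>simp_all add: omega_U_commute l_distr r_distr dual_add[OF omega_dual]
      scale_mult_left scale_mult_right dual_scale[OF omega_dual]\<close>)

text \<open>With \<open>h\<close> the density of the rotated measure, the vector state of \<open>\<surd>h(U)\<xi>\<close> is the
  rotated state; approximating \<open>\<surd>h\<close> by trigonometric polynomials \<open>g\<close> and using that \<open>\<omega>\<close>
  commutes with \<open>U\<close>, this is a norm limit of the functionals \<open>\<omega>(g(U) g(U)\<^sup>* \<cdot>)\<close>.\<close>

lemma rotated_state_approx:
  assumes c: "cmod c = 1" and abs_cont: "absolutely_continuous \<mu> (distr \<mu> circle_borel ((*) c))"
    and \<sigma>: "\<sigma> \<in> dual A" and \<sigma>_w: "\<And>k l. \<sigma> (w k l) = c powi k * \<omega> (w k l)" and e: "0 < e"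
  obtains b where "b \<in> carrier A"
    "\<And>x. x \<in> carrier A \<Longrightarrow> cmod (\<sigma> x - \<omega> (b \<otimes> x)) \<le> e * cnorm A x"
proof -
  obtain D where D: "D \<in> borel_measurable \<mu>" "\<And>z. 0 \<le> D z" "integrable \<mu> D"
    and Dk: "\<And>k. c powi k * fourier_coeff \<mu> k = (LINT z|\<mu>. of_real (D z) * z powi k)"
    using real_density[OF c abs_cont] by blast
  define g where "g z = sqrt (D z)" for z
  have g: "g \<in> borel_measurable \<mu>" "\<And>z. 0 \<le> g z" "integrable \<mu> (\<lambda>z. (g z)\<^sup>2)" "\<And>z. (g z)\<^sup>2 = D z"
    using D unfolding g_def by auto
  define I where "I = (LINT z|\<mu>. (g z)\<^sup>2)"
  have I: "0 \<le> I" by (simp add: I_def)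
  define d where "d n = 1 / (real n + 1)" for n :: nat
  have d: "0 < d n" "d n \<le> 1" for n by (auto simp: d_def)
  have d_lim: "d \<longlonglongrightarrow> 0" unfolding d_def by (rule inverse_Suc_tendsto)
  have d_antimono: "d m \<le> d n" if "n \<le> m" for m n using that by (simp add: d_def frac_le)
  have "\<exists>f x. trig_elem x f \<and> (LINT z|\<mu>. (cmod (f z - of_real (g z)))\<^sup>2) < (d n)\<^sup>2" for n
  proof -
    have "0 < (d n)\<^sup>2" using d(1)[of n] by simp
    then show ?thesis
      using trig_poly_dense[OF g(1-3)] trig_elem_exists unfolding approximable_def by meson
  qed
  then obtain f G where G: "\<And>n. trig_elem (G n) (f n)"
    and f: "\<And>n. (LINT z|\<mu>. (cmod (f n z - of_real (g z)))\<^sup>2) < (d n)\<^sup>2" by metis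
  have Gc: "G n \<in> carrier A" for n by (rule trig_elem_closed[OF G])
  have f_poly: "trig_poly (f n)" for n by (rule trig_elem_poly[OF G])
  have fg_int: "integrable \<mu> (\<lambda>z. (cmod (f n z - of_real (g z)))\<^sup>2)" for n
    by (rule square_diff_integrable[OF f_poly g(1,3)])
  have diff_le: "sn \<omega> (G m \<ominus> G n) \<le> 2 * d n" if nm: "n \<le> m" for m n
  proof -
    have "(sn \<omega> (G m \<ominus> G n))\<^sup>2 = (LINT z|\<mu>. (cmod (f m z - f n z))\<^sup>2)"
      by (rule sn_trig_elem[OF trig_elem_diff[OF G G]])
    also have "\<dots> \<le> (LINT z|\<mu>. 2 * (cmod (f m z - of_real (g z)))\<^sup>2 + 2 * (cmod (f n z - of_real (g z)))\<^sup>2)"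
    proof (rule integral_mono')
      show "(cmod (f m z - f n z))\<^sup>2
          \<le> 2 * (cmod (f m z - of_real (g z)))\<^sup>2 + 2 * (cmod (f n z - of_real (g z)))\<^sup>2" for z
        using norm_add_square_le[of "f m z - of_real (g z)" "of_real (g z) - f n z"]
        by (simp add: norm_minus_commute)
    qed (use fg_int in auto)
    also have "\<dots> \<le> 2 * (d m)\<^sup>2 + 2 * (d n)\<^sup>2" using fg_int f[of m] f[of n] by simp
    also have "\<dots> \<le> 4 * (d n)\<^sup>2"
      using d_antimono[OF nm] d(1)[of m] power_mono[of "d m" "d n" 2] by simp
    also have "\<dots> = (2 * d n)\<^sup>2" by (simp add: power_mult_distrib)
    finally show ?thesis by (rule power2_le_imp_le) (use d(1)[of n] in simp)
  qed
  define B where "B = sqrt (2 + 2 * I)"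
  have B: "0 \<le> B" using I by (simp add: B_def)
  have G_le: "sn \<omega> (G n) \<le> B" for n
  proof -
    have "(sn \<omega> (G n))\<^sup>2 = (LINT z|\<mu>. (cmod (f n z))\<^sup>2)" by (rule sn_trig_elem[OF G])
    also have "\<dots> \<le> (LINT z|\<mu>. 2 * (cmod (f n z - of_real (g z)))\<^sup>2 + 2 * (g z)\<^sup>2)"
    proof (rule integral_mono')
      show "(cmod (f n z))\<^sup>2 \<le> 2 * (cmod (f n z - of_real (g z)))\<^sup>2 + 2 * (g z)\<^sup>2" for z
        using norm_add_square_le[of "f n z - of_real (g z)" "of_real (g z)"] by simp
    qed (use fg_int g(3) in auto)
    also have "\<dots> \<le> 2 * (d n)\<^sup>2 + 2 * I" using fg_int g(3) f[of n] by (simp add: I_def)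
    also have "\<dots> \<le> 2 + 2 * I" using d[of n] by (simp add: power_le_one)
    finally show ?thesis unfolding B_def by (rule real_le_rsqrt)
  qed
  \<comment> \<open>\<open>F n\<close> is the vector functional of \<open>G n\<close> applied to the
    cyclic vector. It is Cauchy in norm with rate 4 B \<open>d n\<close> and converges to \<sigma>
    on monomials.\<close>
  define F where "F n = dual_act A (lact (G n) \<omega>) (star A (G n))" for n
  have F_dual: "F n \<in> dual A" for n using Gc omega_dual by (simp add: F_def)
  have F_apply: "F n x = ip \<omega> (G n) (x \<otimes> G n)" if "x \<in> carrier A" for n x
    using that Gc by (simp add: F_def ip_def m_assoc)
  have F_diff: "cmod (F m x - F n x) \<le> (4 * B * d n) * cnorm A x"
    if nm: "n \<le> m" and x: "x \<in> carrier A" for m n x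
  proof -
    have "F m x - F n x = ip \<omega> (G m \<ominus> G n) (x \<otimes> G m) + ip \<omega> (G n) (x \<otimes> (G m \<ominus> G n))"
    proof -
      have "x \<otimes> (G m \<ominus> G n) = x \<otimes> G m \<ominus> x \<otimes> G n"
        using x Gc by (simp add: a_minus_def r_distr r_minus)
      then show ?thesis using x Gc by (simp add: F_apply ip_linear[OF omega_dual])
    qed
    also have "cmod \<dots> \<le> sn \<omega> (G m \<ominus> G n) * sn \<omega> (x \<otimes> G m) + sn \<omega> (G n) * sn \<omega> (x \<otimes> (G m \<ominus> G n))"
      using x Gc by (intro order_trans[OF norm_triangle_ineq] add_mono ip_le[OF omega_pos]) auto
    also have "\<dots> \<le> (2 * d n) * (cnorm A x * B) + B * (cnorm A x * (2 * d n))"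
    proof -
      have "sn \<omega> (x \<otimes> G m) \<le> cnorm A x * B"
        using sn_mult_le[OF omega_pos x Gc[of m]] mult_left_mono[OF G_le[of m] cnorm_nonneg[OF x]]
        by linarith
      moreover have "sn \<omega> (x \<otimes> (G m \<ominus> G n)) \<le> cnorm A x * (2 * d n)"
        using sn_mult_le[OF omega_pos x, of "G m \<ominus> G n"] Gc
          mult_left_mono[OF diff_le[OF nm] cnorm_nonneg[OF x]] by simp
      ultimately show ?thesis
        using diff_le[OF nm] G_le[of n] B d(1)[of n] x Gc ip_self(2)[OF omega_pos]
        by (intro add_mono mult_mono) auto
    qed
    finally show ?thesis by (simp add: mult_ac)
  qed
  have F_w: "(\<lambda>n. F n (w k l)) \<longlonglongrightarrow> \<sigma> (w k l)" for k l
  proof (cases "l = 0")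
    case False
    then show ?thesis using omega_sandwich[OF G G] by (simp add: F_apply \<sigma>_w omega_w)
  next
    case True
    have int1: "integrable \<mu> (\<lambda>z. cnj (f n z) * (z powi k * f n z))" for n
      by (rule trig_integrable[OF f_poly f_poly])
    have [measurable]: "(\<lambda>z. z powi k) \<in> borel_measurable \<mu>" by (intro measurable_of_borel) simp
    have int2: "integrable \<mu> (\<lambda>z. of_real (D z) * z powi k)"
    proof (rule Bochner_Integration.integrable_bound[OF D(3)])
      show "(\<lambda>z. complex_of_real (D z) * z powi k) \<in> borel_measurable \<mu>" using D(1) by measurable
      show "AE z in \<mu>. norm (complex_of_real (D z) * z powi k) \<le> norm (D z)"
        by (rule AE_I2) (auto simp: space_circle norm_mult norm_power_int)
    qed
    have bnd: "norm (F n (w k l) - \<sigma> (w k l)) \<le> (I + 2) * d n" for n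
    proof -
      have "F n (w k l) - \<sigma> (w k l)
          = (LINT z|\<mu>. cnj (f n z) * (z powi k * f n z) - of_real (D z) * z powi k)"
        using True omega_sandwich[OF G G] int1 int2 Dk by (simp add: F_apply \<sigma>_w omega_w)
      also have "norm \<dots> \<le> (LINT z|\<mu>. norm (cnj (f n z) * (z powi k * f n z) - of_real (D z) * z powi k))"
        by (rule integral_norm_bound)
      \<comment> \<open>With s = |f - g| the difference of squares is at most s(s + 2g), and 2sg <=
        s^2/d + d g^2. The weight d makes both terms of order d, since s^2 has integral below
        d^2.\<close>
      also have "\<dots> \<le> (LINT z|\<mu>. (1 + 1 / d n) * (cmod (f n z - of_real (g z)))\<^sup>2 + d n * (g z)\<^sup>2)"
      proof (rule integral_mono')
        show "integrable \<mu> (\<lambda>z. (1 + 1 / d n) * (cmod (f n z - of_real (g z)))\<^sup>2 + d n * (g z)\<^sup>2)"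
          using fg_int g(3) by auto
        fix z assume "z \<in> space \<mu>"
        then have z: "cmod z = 1" by (simp add: space_circle)
        show "0 \<le> (1 + 1 / d n) * (cmod (f n z - of_real (g z)))\<^sup>2 + d n * (g z)\<^sup>2"
          using d(1)[of n] by simp
        define s where "s = cmod (f n z - of_real (g z))"
        define t where "t = cmod (f n z)"
        have ts: "\<bar>t - g z\<bar> \<le> s"
          using norm_triangle_ineq3[of "f n z" "of_real (g z)"] g(2)[of z] by (simp add: s_def t_def)
        have "cnj (f n z) * (z powi k * f n z) - of_real (D z) * z powi k
            = (cnj (f n z) * f n z - of_real ((g z)\<^sup>2)) * z powi k"
          by (simp add: g(4) algebra_simps)
        also have "cnj (f n z) * f n z = of_real (t\<^sup>2)"
          unfolding t_def by (simp only: complex_norm_square mult.commute)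
        finally have "cmod (cnj (f n z) * (z powi k * f n z) - of_real (D z) * z powi k)
            = cmod (of_real (t\<^sup>2 - (g z)\<^sup>2))"
          by (simp only: of_real_diff norm_mult norm_power_int z power_int_1_left mult_1_right)
        then have "cmod (cnj (f n z) * (z powi k * f n z) - of_real (D z) * z powi k) = \<bar>t\<^sup>2 - (g z)\<^sup>2\<bar>"
          by (simp only: norm_of_real)
        also have "\<dots> = \<bar>t - g z\<bar> * \<bar>t + g z\<bar>" by (simp add: abs_mult[symmetric] power2_eq_square algebra_simps)
        also have "\<dots> \<le> s * (s + 2 * g z)"
          using ts g(2)[of z] by (intro mult_mono) auto
        also have "\<dots> \<le> (1 + 1 / d n) * s\<^sup>2 + d n * (g z)\<^sup>2"
        proof -
          have "0 \<le> (s - d n * g z)\<^sup>2 / d n" using d(1)[of n] by simp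
          also have "\<dots> = s\<^sup>2 / d n - 2 * s * g z + d n * (g z)\<^sup>2"
            using d(1)[of n] by (simp add: power2_diff power_mult_distrib field_simps power2_eq_square)
          finally show ?thesis by (simp add: algebra_simps power2_eq_square)
        qed
        finally show "norm (cnj (f n z) * (z powi k * f n z) - of_real (D z) * z powi k)
            \<le> (1 + 1 / d n) * (cmod (f n z - of_real (g z)))\<^sup>2 + d n * (g z)\<^sup>2" by (simp add: s_def)
      qed
      also have "\<dots> = (1 + 1 / d n) * (LINT z|\<mu>. (cmod (f n z - of_real (g z)))\<^sup>2) + d n * I"
        using fg_int g(3) by (simp add: I_def)
      also have "\<dots> \<le> (1 + 1 / d n) * (d n)\<^sup>2 + d n * I"
        using f[of n] d(1)[of n] by (intro add_right_mono mult_left_mono) auto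
      also have "(1 + 1 / d n) * (d n)\<^sup>2 = d n * d n + d n"
        using d(1)[of n] by (simp add: field_simps power2_eq_square)
      also have "d n * d n + d n + d n * I \<le> (I + 2) * d n"
        using d[of n] mult_left_le[of "d n" "d n"] by (simp add: algebra_simps)
      finally show ?thesis .
    qed
    have "(\<lambda>n. F n (w k l) - \<sigma> (w k l)) \<longlonglongrightarrow> 0"
    proof (rule Lim_null_comparison)
      show "\<forall>\<^sub>F n in sequentially. norm (F n (w k l) - \<sigma> (w k l)) \<le> (I + 2) * d n"
        by (rule always_eventually, rule allI, rule bnd)
      show "(\<lambda>n. (I + 2) * d n) \<longlonglongrightarrow> 0" by (rule tendsto_mult_right_zero[OF d_lim])
    qed
    then show ?thesis by (simp add: LIM_zero_iff)
  qed
  have F_box: "(\<lambda>n. F n y) \<longlonglongrightarrow> \<sigma> y" if "y \<in> box r" for y r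
    using that
  proof (induction rule: box.induct)
    case (add x y)
    then show ?case using tendsto_add[OF add.IH] by (simp add: dual_add[OF F_dual] dual_add[OF \<sigma>])
  next
    case (scale x c)
    then show ?case
      using tendsto_mult_left[OF scale.IH, of c] by (simp add: dual_scale[OF F_dual] dual_scale[OF \<sigma>])
  qed (simp_all add: F_w F_dual \<sigma>)
  \<comment> \<open>The rate is known between members of the sequence; letting m tend to infinity on
    Laurent polynomials and using density transfers it to \<sigma>.\<close>
  have est: "cmod (\<sigma> x - F n x) \<le> (4 * B * d n) * cnorm A x" if x: "x \<in> carrier A" for n x
  proof -
    have "cmod (fadd \<sigma> (fscale (- 1) (F n)) x) \<le> (4 * B * d n) * cnorm A x"
    proof (rule dense_bound[OF _ _ _ x])
      show "0 \<le> 4 * B * d n" using B d(1)[of n] by simp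
      fix r y assume y: "y \<in> box r"
      have "(\<lambda>m. cmod (F m y - F n y)) \<longlonglongrightarrow> cmod (\<sigma> y - F n y)"
        by (intro tendsto_intros F_box[OF y])
      then have "cmod (\<sigma> y - F n y) \<le> (4 * B * d n) * cnorm A y"
        by (rule LIMSEQ_le_const2) (intro exI[of _ n] allI impI F_diff box_closed[OF y])
      then show "cmod (fadd \<sigma> (fscale (- 1) (F n)) y) \<le> (4 * B * d n) * cnorm A y"
        using box_closed[OF y] by simp
    qed (use \<sigma> F_dual in auto)
    then show ?thesis using x by simp
  qed
  obtain n where n: "4 * B * d n < e"
    using order_tendstoD(2)[OF tendsto_mult_right_zero[OF d_lim, of "4 * B"] e] eventually_happens' by force
  show ?thesis
  \<comment> \<open>\<omega> commutes with \<open>G n\<close>, so the factor on the right of x moves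
    to the front and b is \<open>G n \<otimes> star A (G n)\<close>.\<close>
  proof (rule that[of "G n \<otimes> star A (G n)"])
    fix x assume x: "x \<in> carrier A"
    have "\<omega> ((G n \<otimes> star A (G n)) \<otimes> x) = F n x"
      using omega_trig_commute[OF G, of "star A (G n) \<otimes> x" n] x Gc by (simp add: F_def m_assoc)
    then show "cmod (\<sigma> x - \<omega> ((G n \<otimes> star A (G n)) \<otimes> x)) \<le> e * cnorm A x"
      using est[OF x, of n] n mult_right_mono[of "4 * B * d n" e "cnorm A x"] cnorm_nonneg[OF x] by simp
  qed (use Gc in auto)
qed

section \<open>The bimodule generated by the state\<close>

definition folium :: "('a \<Rightarrow> complex) set" where
  "folium = {\<phi> \<in> dual A. \<forall>e>0. \<exists>a\<in>carrier A. \<forall>x\<in>carrier A.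
    cmod (\<phi> x - \<omega> (a \<otimes> x)) \<le> e * cnorm A x}"

lemma folium_dual: "\<phi> \<in> folium \<Longrightarrow> \<phi> \<in> dual A"
  by (simp add: folium_def)

lemma folium_approx:
  assumes "\<phi> \<in> folium" "0 < e"
  obtains a where "a \<in> carrier A" "\<And>x. x \<in> carrier A \<Longrightarrow> cmod (\<phi> x - \<omega> (a \<otimes> x)) \<le> e * cnorm A x"
  using assms unfolding folium_def by blast

lemma omega_folium: "\<omega> \<in> folium"
  unfolding folium_def using omega_dual cnorm_nonneg by (auto intro!: bexI[of _ \<one>])

lemma folium_closed:
  assumes \<phi>: "\<phi> \<in> dual A"
    and approx: "\<And>e. 0 < e \<Longrightarrow> \<exists>\<nu>\<in>folium. \<forall>x\<in>carrier A. cmod (\<phi> x - \<nu> x) \<le> e * cnorm A x"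
  shows "\<phi> \<in> folium"
  unfolding folium_def
proof (intro CollectI conjI \<phi> allI impI)
  fix e :: real assume e: "0 < e"
  obtain \<nu> where \<nu>: "\<nu> \<in> folium" "\<And>x. x \<in> carrier A \<Longrightarrow> cmod (\<phi> x - \<nu> x) \<le> e / 2 * cnorm A x"
    using approx[of "e / 2"] e by auto
  obtain a where a: "a \<in> carrier A" "\<And>x. x \<in> carrier A \<Longrightarrow> cmod (\<nu> x - \<omega> (a \<otimes> x)) \<le> e / 2 * cnorm A x"
    using folium_approx[OF \<nu>(1), of "e / 2"] e by auto
  have "cmod (\<phi> x - \<omega> (a \<otimes> x)) \<le> e * cnorm A x" if x: "x \<in> carrier A" for x
    using \<nu>(2)[OF x] a(2)[OF x] norm_triangle_ineq[of "\<phi> x - \<nu> x" "\<nu> x - \<omega> (a \<otimes> x)"] by simp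
  then show "\<exists>a\<in>carrier A. \<forall>x\<in>carrier A. cmod (\<phi> x - \<omega> (a \<otimes> x)) \<le> e * cnorm A x"
    using a(1) by blast
qed

lemma folium_add:
  assumes "\<nu> \<in> folium" "\<nu>' \<in> folium"
  shows "fadd \<nu> \<nu>' \<in> folium"
  unfolding folium_def
proof (intro CollectI conjI allI impI)
  show "fadd \<nu> \<nu>' \<in> dual A" using assms folium_dual by auto
  fix e :: real assume e: "0 < e"
  obtain a where a: "a \<in> carrier A" "\<And>x. x \<in> carrier A \<Longrightarrow> cmod (\<nu> x - \<omega> (a \<otimes> x)) \<le> e / 2 * cnorm A x"
    using folium_approx[OF assms(1), of "e / 2"] e by auto
  obtain b where b: "b \<in> carrier A" "\<And>x. x \<in> carrier A \<Longrightarrow> cmod (\<nu>' x - \<omega> (b \<otimes> x)) \<le> e / 2 * cnorm A x"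
    using folium_approx[OF assms(2), of "e / 2"] e by auto
  have "cmod (fadd \<nu> \<nu>' x - \<omega> ((a \<oplus> b) \<otimes> x)) \<le> e * cnorm A x" if x: "x \<in> carrier A" for x
    using a(2)[OF x] b(2)[OF x] norm_triangle_ineq[of "\<nu> x - \<omega> (a \<otimes> x)" "\<nu>' x - \<omega> (b \<otimes> x)"] a(1) b(1) x
    by (simp add: l_distr dual_add[OF omega_dual] algebra_simps)
  then show "\<exists>a\<in>carrier A. \<forall>x\<in>carrier A. cmod (fadd \<nu> \<nu>' x - \<omega> (a \<otimes> x)) \<le> e * cnorm A x"
    using a(1) b(1) by blast
qed

lemma folium_scale:
  assumes "\<nu> \<in> folium"
  shows "fscale c \<nu> \<in> folium"
  unfolding folium_def
proof (intro CollectI conjI allI impI)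
  show "fscale c \<nu> \<in> dual A" using assms folium_dual by auto
  fix e :: real assume e: "0 < e"
  have pos: "0 < cmod c + 1" by (simp add: add_nonneg_pos)
  obtain a where a: "a \<in> carrier A"
    "\<And>x. x \<in> carrier A \<Longrightarrow> cmod (\<nu> x - \<omega> (a \<otimes> x)) \<le> e / (cmod c + 1) * cnorm A x"
    using folium_approx[OF assms, of "e / (cmod c + 1)"] e pos by auto
  have "cmod (fscale c \<nu> x - \<omega> (scale A c a \<otimes> x)) \<le> e * cnorm A x" if x: "x \<in> carrier A" for x
  proof -
    have "fscale c \<nu> x - \<omega> (scale A c a \<otimes> x) = c * (\<nu> x - \<omega> (a \<otimes> x))"
      using x a(1) by (simp add: scale_mult_left dual_scale[OF omega_dual] right_diff_distrib)
    then have "cmod (fscale c \<nu> x - \<omega> (scale A c a \<otimes> x)) \<le> (cmod c + 1) * cmod (\<nu> x - \<omega> (a \<otimes> x))"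
      by (simp add: norm_mult mult_right_mono)
    also have "\<dots> \<le> (cmod c + 1) * (e / (cmod c + 1) * cnorm A x)"
      using a(2)[OF x] pos by (intro mult_left_mono) auto
    also have "\<dots> = e * cnorm A x" using pos by simp
    finally show ?thesis .
  qed
  then show "\<exists>a\<in>carrier A. \<forall>x\<in>carrier A. cmod (fscale c \<nu> x - \<omega> (a \<otimes> x)) \<le> e * cnorm A x"
    using a(1) by blast
qed

lemma folium_right:
  assumes \<nu>: "\<nu> \<in> folium" and a: "a \<in> carrier A"
  shows "dual_act A \<nu> a \<in> folium"
  unfolding folium_def
proof (intro CollectI conjI allI impI)
  show "dual_act A \<nu> a \<in> dual A" using assms folium_dual by auto
  fix e :: real assume e: "0 < e"
  have pos: "0 < cnorm A a + 1" using cnorm_nonneg[OF a] by simp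
  obtain b where b: "b \<in> carrier A"
    "\<And>x. x \<in> carrier A \<Longrightarrow> cmod (\<nu> x - \<omega> (b \<otimes> x)) \<le> e / (cnorm A a + 1) * cnorm A x"
    using folium_approx[OF \<nu>, of "e / (cnorm A a + 1)"] e pos by auto
  have "cmod (dual_act A \<nu> a x - \<omega> ((b \<otimes> a) \<otimes> x)) \<le> e * cnorm A x" if x: "x \<in> carrier A" for x
  proof -
    have "cmod (\<nu> (a \<otimes> x) - \<omega> (b \<otimes> (a \<otimes> x))) \<le> e / (cnorm A a + 1) * cnorm A (a \<otimes> x)"
      using a x by (intro b(2)) auto
    also have "\<dots> \<le> e / (cnorm A a + 1) * ((cnorm A a + 1) * cnorm A x)"
      using cnorm_mult[OF a x] cnorm_nonneg[OF x] e pos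
      by (intro mult_left_mono) (auto simp: distrib_right)
    also have "\<dots> = e * cnorm A x" using pos by simp
    finally show ?thesis using a b(1) x by (simp add: m_assoc)
  qed
  then show "\<exists>b\<in>carrier A. \<forall>x\<in>carrier A. cmod (dual_act A \<nu> a x - \<omega> (b \<otimes> x)) \<le> e * cnorm A x"
    using a b(1) by blast
qed

text \<open>The left and the right action commute, so left translating \<omega>(b x) is right
  translating the left translate of \<omega>: left invariance is to be checked on \<omega>
  alone.\<close>

lemma folium_left_if:
  assumes \<nu>: "\<nu> \<in> folium" and a: "a \<in> carrier A" and \<omega>a: "lact a \<omega> \<in> folium"
  shows "lact a \<nu> \<in> folium"
proof (rule folium_closed)
  show "lact a \<nu> \<in> dual A" using \<nu> a folium_dual by auto
  fix e :: real assume e: "0 < e"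
  have pos: "0 < cnorm A a + 1" using cnorm_nonneg[OF a] by simp
  obtain b where b: "b \<in> carrier A"
    "\<And>x. x \<in> carrier A \<Longrightarrow> cmod (\<nu> x - \<omega> (b \<otimes> x)) \<le> e / (cnorm A a + 1) * cnorm A x"
    using folium_approx[OF \<nu>, of "e / (cnorm A a + 1)"] e pos by auto
  have "cmod (lact a \<nu> x - dual_act A (lact a \<omega>) b x) \<le> e * cnorm A x" if x: "x \<in> carrier A" for x
  proof -
    have "cmod (\<nu> (x \<otimes> a) - \<omega> (b \<otimes> (x \<otimes> a))) \<le> e / (cnorm A a + 1) * cnorm A (x \<otimes> a)"
      using a x by (intro b(2)) auto
    also have "\<dots> \<le> e / (cnorm A a + 1) * (cnorm A x * (cnorm A a + 1))"
      using cnorm_mult[OF x a] cnorm_nonneg[OF x] e pos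
      by (intro mult_left_mono) (auto simp: distrib_left)
    also have "\<dots> = e * cnorm A x" using pos by simp
    finally show ?thesis using a b(1) x by (simp add: m_assoc)
  qed
  then show "\<exists>\<nu>'\<in>folium. \<forall>x\<in>carrier A. cmod (lact a \<nu> x - \<nu>' x) \<le> e * cnorm A x"
    using folium_right[OF \<omega>a b(1)] by blast
qed

text \<open>For a unitary v let \<sigma> be \<omega> conjugated by v. Then \<omega>(x v) =
  \<sigma>(v x), and \<open>rotated_state_approx\<close> makes \<sigma> a limit of functionals
  \<omega>(b x).\<close>

lemma lact_V_folium: "lact V \<omega> \<in> folium"
  and lact_star_V_folium: "lact (star A V) \<omega> \<in> folium"
proof -
  have zV: "w 0 1 = V" "w 0 (- 1) = star A V"
    by (auto simp: w_def zpow_def)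
  have iq: "cmod (inverse q) = 1" by (simp add: norm_inverse norm_q)
  have *: "lact v \<omega> \<in> folium"
    if v: "unitary A v" and c: "cmod c = 1" and abs_cont: "absolutely_continuous \<mu> (distr \<mu> circle_borel ((*) c))"
      and vw: "\<And>k l. \<omega> (star A v \<otimes> w k l \<otimes> v) = c powi k * \<omega> (w k l)" for v c
    unfolding folium_def
  proof (intro CollectI conjI allI impI)
    note vD = unitaryD[OF v]
    show "lact v \<omega> \<in> dual A" using vD omega_dual by auto
    fix e :: real assume e: "0 < e"
    let ?\<sigma> = "dual_act A (lact v \<omega>) (star A v)"
    have \<sigma>d: "?\<sigma> \<in> dual A" using vD omega_dual by auto
    have \<sigma>w: "?\<sigma> (w k l) = c powi k * \<omega> (w k l)" for k l using vw vD by simp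
    obtain b where b: "b \<in> carrier A"
      "\<And>x. x \<in> carrier A \<Longrightarrow> cmod (?\<sigma> x - \<omega> (b \<otimes> x)) \<le> e * cnorm A x"
      using rotated_state_approx[OF c abs_cont \<sigma>d \<sigma>w e] by blast
    have "cmod (lact v \<omega> x - \<omega> ((b \<otimes> v) \<otimes> x)) \<le> e * cnorm A x" if x: "x \<in> carrier A" for x
    proof -
      have "?\<sigma> (v \<otimes> x) = \<omega> (((star A v \<otimes> v) \<otimes> x) \<otimes> v)"
        using vD(1) x by (simp add: m_assoc)
      then have "?\<sigma> (v \<otimes> x) = lact v \<omega> x" using vD x by simp
      then have "cmod (lact v \<omega> x - \<omega> ((b \<otimes> v) \<otimes> x)) \<le> e * cnorm A (v \<otimes> x)"
        using b(2)[of "v \<otimes> x"] b(1) vD(1) x by (simp add: m_assoc)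
      also have "\<dots> \<le> e * (1 * cnorm A x)"
        using cnorm_mult[OF vD(1) x] mult_right_mono[OF cnorm_unitary_le[OF v] cnorm_nonneg[OF x]] e
        by (intro mult_left_mono) auto
      finally show ?thesis by simp
    qed
    then show "\<exists>a\<in>carrier A. \<forall>x\<in>carrier A. cmod (lact v \<omega> x - \<omega> (a \<otimes> x)) \<le> e * cnorm A x"
      using b(1) vD(1) by blast
  qed
  show "lact V \<omega> \<in> folium"
  proof (rule *[OF unitary_V norm_q ac])
    have h: "\<omega> (w 0 (- 1) \<otimes> w k l \<otimes> w 0 1) = q powi k * \<omega> (w k l)" for k l
      by (simp add: w_mult scale_mult_left dual_scale[OF omega_dual])
    show "\<omega> (star A V \<otimes> w k l \<otimes> V) = q powi k * \<omega> (w k l)" for k l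
      using h[of k l] unfolding zV .
  qed
  show "lact (star A V) \<omega> \<in> folium"
  proof (rule *[OF unitary_star[OF unitary_V] iq ac_inverse])
    have h: "\<omega> (w 0 1 \<otimes> w k l \<otimes> w 0 (- 1)) = inverse q powi k * \<omega> (w k l)" for k l
      by (simp add: w_mult scale_mult_left dual_scale[OF omega_dual] power_int_minus power_int_inverse)
    show "\<omega> (star A (star A V) \<otimes> w k l \<otimes> star A V) = inverse q powi k * \<omega> (w k l)" for k l
      using h[of k l] unfolding zV star_star[OF V_closed] .
  qed
qed

lemma lact_zpow_U_folium: "lact (zpow U j) \<omega> \<in> folium"
proof -
  have "lact (zpow U j) \<omega> = dual_act A \<omega> (zpow U j)"
    by (rule dual_eqI) (auto simp: omega_dual omega_U_commute)
  then show ?thesis using folium_right[OF omega_folium] by simp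
qed

lemma lact_lact:
  assumes "\<phi> \<in> dual A" "a \<in> carrier A" "b \<in> carrier A"
  shows "lact a (lact b \<phi>) = lact (a \<otimes> b) \<phi>"
  by (rule dual_eqI) (use assms in \<open>auto simp: m_assoc\<close>)

text \<open>The elements that translate \<omega> into the folium, together with their adjoints, form
  a C*-subalgebra containing U and V. The adjoint is built into S because \<open>folium_star\<close>
  is deduced from this lemma.\<close>

lemma lact_folium:
  assumes a: "a \<in> carrier A"
  shows "lact a \<omega> \<in> folium"
proof -
  define S where "S = {a \<in> carrier A. lact a \<omega> \<in> folium \<and> lact (star A a) \<omega> \<in> folium}"
  have mult: "lact (x \<otimes> y) \<omega> \<in> folium"
    if "x \<in> carrier A" "y \<in> carrier A" "lact x \<omega> \<in> folium" "lact y \<omega> \<in> folium" for x y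
    using folium_left_if[OF that(4,1,3)] lact_lact[OF omega_dual that(1,2)] by simp
  have limit: "lact l \<omega> \<in> folium"
    if s: "\<And>n. s n \<in> carrier A" "l \<in> carrier A" "(\<lambda>n. cnorm A (s n \<ominus> l)) \<longlonglongrightarrow> 0"
      "\<And>n. lact (s n) \<omega> \<in> folium" for s :: "nat \<Rightarrow> 'a" and l
  proof (rule folium_closed)
    show "lact l \<omega> \<in> dual A" using s omega_dual by auto
    fix e :: real assume e: "0 < e"
    define K where "K = dual_norm A \<omega> + 1"
    have K: "0 < K" "dual_norm A \<omega> \<le> K" using dual_norm_nonneg[OF omega_dual] by (auto simp: K_def)
    obtain n where n: "cnorm A (s n \<ominus> l) < e / K"
      using order_tendstoD(2)[OF s(3), of "e / K"] e K eventually_happens' by force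
    have "cmod (lact l \<omega> x - lact (s n) \<omega> x) \<le> e * cnorm A x" if x: "x \<in> carrier A" for x
    proof -
      have "x \<otimes> (s n \<ominus> l) = x \<otimes> s n \<ominus> x \<otimes> l"
        using x s(1)[of n] s(2) by (simp add: a_minus_def r_distr r_minus)
      then have "cmod (lact l \<omega> x - lact (s n) \<omega> x) = cmod (\<omega> (x \<otimes> (s n \<ominus> l)))"
        using x s(1)[of n] s(2) by (simp add: dual_diff[OF omega_dual] norm_minus_commute)
      also have "\<dots> \<le> dual_norm A \<omega> * cnorm A (s n \<ominus> l) * cnorm A x"
        using norm_dual_act_le(2)[OF omega_dual _ x, of "s n \<ominus> l"] s(1)[of n] s(2) by simp
      also have "\<dots> \<le> K * (e / K) * cnorm A x"
        using n K cnorm_nonneg[OF x] cnorm_nonneg[of "s n \<ominus> l"] s(1)[of n] s(2)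
        by (intro mult_right_mono mult_mono) auto
      finally show ?thesis using K by simp
    qed
    then show "\<exists>\<nu>\<in>folium. \<forall>x\<in>carrier A. cmod (lact l \<omega> x - \<nu> x) \<le> e * cnorm A x"
      using s(4) by blast
  qed
  have SD: "x \<in> carrier A" "lact x \<omega> \<in> folium" "lact (star A x) \<omega> \<in> folium" if "x \<in> S" for x
    using that by (auto simp: S_def)
  have S_scale: "scale A c x \<in> S" if "x \<in> S" for c x
    using SD[OF that] by (simp add: S_def star_scale lact_linear[OF omega_dual] folium_scale)
  have S_star: "star A x \<in> S" if "x \<in> S" for x
    using SD[OF that] by (simp add: S_def)
  have S_limit: "l \<in> S"
    if s: "\<And>n. s n \<in> S" "l \<in> carrier A" "(\<lambda>n. cnorm A (s n \<ominus> l)) \<longlonglongrightarrow> 0" for s :: "nat \<Rightarrow> 'a" and l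
  proof -
    have c: "s n \<in> carrier A" for n using s(1) SD by blast
    have "cnorm A (star A (s n) \<ominus> star A l) = cnorm A (s n \<ominus> l)" for n
      using c[of n] s(2) by (simp add: star_diff[symmetric] cnorm_star)
    then have "(\<lambda>n. cnorm A (star A (s n) \<ominus> star A l)) \<longlonglongrightarrow> 0" using s(3) by simp
    then have "lact (star A l) \<omega> \<in> folium"
      by (rule limit[OF star_closed[OF c] star_closed[OF s(2)] _ SD(3)[OF s(1)]])
    moreover have "lact l \<omega> \<in> folium" by (rule limit[OF c s(2,3) SD(2)[OF s(1)]])
    ultimately show ?thesis using s(2) by (simp add: S_def)
  qed
  have "subring S A"
  proof (rule subringI)
    show "\<one> \<in> S" using lact_zpow_U_folium[of 0] by (simp add: S_def)
    show "\<ominus> x \<in> S" if "x \<in> S" for x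
      using S_scale[OF that, of "- 1"] SD(1)[OF that] by (simp add: scale_minus_one)
    show "x \<otimes> y \<in> S" if "x \<in> S" "y \<in> S" for x y
      using SD[OF that(1)] SD[OF that(2)] by (simp add: S_def star_mult mult)
    show "x \<oplus> y \<in> S" if "x \<in> S" "y \<in> S" for x y
      using SD[OF that(1)] SD[OF that(2)]
      by (simp add: S_def star_add lact_linear[OF omega_dual] folium_add)
  qed (use SD in auto)
  then have "cstar_subalgebra S A"
    unfolding cstar_subalgebra_def using S_scale S_star S_limit by blast
  moreover have "U \<in> S"
    using lact_zpow_U_folium[of 1] lact_zpow_U_folium[of "- 1"] by (simp add: S_def zpow_def)
  moreover have "V \<in> S"
    using lact_V_folium lact_star_V_folium by (simp add: S_def)
  ultimately have "S = carrier A" by (rule generated)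
  then show ?thesis using a SD by blast
qed

text \<open>Since \<omega> is hermitian, the adjoint of the right translate of \<omega> by a is its
  left translate by the adjoint of a.\<close>

lemma folium_star:
  assumes \<nu>: "\<nu> \<in> folium"
  shows "dual_star A \<nu> \<in> folium"
proof (rule folium_closed)
  show "dual_star A \<nu> \<in> dual A" using \<nu> folium_dual by auto
  fix e :: real assume e: "0 < e"
  obtain a where a: "a \<in> carrier A"
    "\<And>x. x \<in> carrier A \<Longrightarrow> cmod (\<nu> x - \<omega> (a \<otimes> x)) \<le> e * cnorm A x"
    using folium_approx[OF \<nu> e] by blast
  have "cmod (dual_star A \<nu> x - lact (star A a) \<omega> x) \<le> e * cnorm A x" if x: "x \<in> carrier A" for x
  proof -
    have "\<omega> (x \<otimes> star A a) = cnj (\<omega> (a \<otimes> star A x))"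
      using posf_star[OF omega_pos, of "a \<otimes> star A x"] a(1) x by (simp add: star_mult)
    then have "dual_star A \<nu> x - lact (star A a) \<omega> x = cnj (\<nu> (star A x) - \<omega> (a \<otimes> star A x))"
      using x by simp
    then show ?thesis
      using a(2)[of "star A x"] x by (simp only: complex_mod_cnj) (simp add: cnorm_star)
  qed
  then show "\<exists>\<nu>'\<in>folium. \<forall>x\<in>carrier A. cmod (dual_star A \<nu> x - \<nu>' x) \<le> e * cnorm A x"
    using lact_folium[of "star A a"] a(1) by blast
qed

sublocale folium: invariant_subspace A folium
proof unfold_locales
  show "folium \<subseteq> dual A" using folium_dual by blast
  show "folium \<noteq> {}" using omega_folium by blast
qed (use folium_add folium_scale folium_closed folium_right folium_left_if lact_folium folium_star in auto)

text \<open>In a representation, the projection r = 1 - e with \<omega>(r) = 0 kills the cyclic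
  vector. Here r is approximated by some c on functionals dominated by \<omega>; idempotence makes
  the seminorm of c small, so r vanishes on every \<open>vec \<omega> a\<close>, and by closure on
  the folium.\<close>

lemma projection_one_on_folium:
  assumes pr: "projection (bidual A) e" and e1: "e \<omega> = 1" and \<nu>: "\<nu> \<in> folium"
  shows "e \<nu> = \<nu> \<one>"
proof -
  have e: "e \<in> bd" "e \<otimes>\<^bsub>bidual A\<^esub> e = e" "star (bidual A) e = e"
    using pr by (auto simp: projection_def)
  define r where "r = (\<lambda>\<phi>\<in>dual A. \<phi> \<one> - e \<phi>)"
  have r_apply: "r \<phi> = \<phi> \<one> - e \<phi>" if "\<phi> \<in> dual A" for \<phi> using that by (simp add: r_def)
  obtain L where L: "0 \<le> L" "\<And>\<phi>. \<phi> \<in> dual A \<Longrightarrow> cmod (e \<phi>) \<le> L * dual_norm A \<phi>"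
    using bidual_bound[OF e(1)] by blast
  have r: "r \<in> bd"
  proof (rule bidualI[where C = "cnorm A \<one> + L"])
    show "cmod (r \<phi>) \<le> (cnorm A \<one> + L) * dual_norm A \<phi>" if \<phi>: "\<phi> \<in> dual A" for \<phi>
      using norm_triangle_ineq4[of "\<phi> \<one>" "e \<phi>"] dual_norm_bound[OF \<phi>, of \<one>] L(2)[OF \<phi>] \<phi>
      by (simp add: r_apply algebra_simps)
  qed (use e(1) in \<open>auto simp: r_def bidual_add bidual_scale algebra_simps\<close>)
  have r_star: "r (dual_star A \<phi>) = cnj (r \<phi>)" if \<phi>: "\<phi> \<in> dual A" for \<phi>
  proof -
    have "e \<phi> = cnj (e (dual_star A \<phi>))"
      using fun_cong[OF e(3), of \<phi>] \<phi> by (simp add: bidual_eqs(4))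
    then show ?thesis using \<phi> by (simp add: r_apply)
  qed
  define \<xi> where "\<xi> = bidual_act A r \<omega>"
  have \<xi>: "\<xi> \<in> dual A" using r omega_dual by (simp add: \<xi>_def)
  \<comment> \<open>Idempotence of r, evaluated at \<omega>.\<close>
  have "r \<xi> = 0"
  proof -
    have e\<omega>: "bidual_act A e \<omega> \<in> dual A" using e(1) omega_dual by simp
    have one: "dual_act A \<omega> \<one> = \<omega>" by (rule dual_eqI) (auto simp: omega_dual)
    have "\<xi> = fadd \<omega> (fscale (- 1) (bidual_act A e \<omega>))"
      by (rule dual_eqI) (use \<xi> e\<omega> omega_dual in \<open>auto simp: \<xi>_def r_apply\<close>)
    then have "r \<xi> = r \<omega> - r (bidual_act A e \<omega>)"
      using r omega_dual e\<omega> by (simp add: bidual_add bidual_scale)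
    also have "r \<omega> = 0" using e1 omega_one by (simp add: r_apply omega_dual)
    also have "r (bidual_act A e \<omega>) = 0"
      using e\<omega> one e1 fun_cong[OF e(2), of \<omega>] omega_dual by (simp add: r_apply bidual_eqs(2))
    finally show ?thesis by simp
  qed
  then have r\<xi>: "r (dual_star A \<xi>) = 0" using r_star[OF \<xi>] by simp
  obtain K where K: "0 \<le> K" "\<And>\<phi> \<theta> e. \<lbrakk>\<phi> \<in> dual A; \<theta> \<in> dual A; 0 \<le> e;
      \<And>x. x \<in> carrier A \<Longrightarrow> cmod (\<phi> x - \<theta> x) \<le> e * cnorm A x\<rbrakk> \<Longrightarrow> cmod (r \<phi> - r \<theta>) \<le> K * e"
    "\<And>\<phi> e. \<lbrakk>\<phi> \<in> dual A; 0 \<le> e;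
      \<And>x. x \<in> carrier A \<Longrightarrow> cmod (\<phi> x) \<le> e * cnorm A x\<rbrakk> \<Longrightarrow> cmod (r \<phi>) \<le> K * e"
    using bidual_bound_pointwise[OF r] by blast
  define D where "D = K * sn \<omega> \<one>"
  have s1: "0 \<le> sn \<omega> \<one>" using ip_self(2)[OF omega_pos] by simp
  have D: "0 \<le> D" using K(1) s1 by (simp add: D_def)
  have vec_dual: "vec \<omega> a \<in> dual A" if "a \<in> carrier A" for a
    using that omega_dual by (simp add: vec_def)
  \<comment> \<open>This functional sends a to the conjugate of \<open>r (vec \<omega> a)\<close>;
    being dominated, it can be tested against the approximation of r by c.\<close>
  have "dominated \<omega> D (dual_star A \<xi>)"
    unfolding dominated_def
  proof (intro conjI ballI D)
    show "dual_star A \<xi> \<in> dual A" using \<xi> by simp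
    fix a assume a: "a \<in> carrier A"
    have "cmod (r (vec \<omega> a)) \<le> K * (sn \<omega> a * sn \<omega> \<one>)"
      by (rule K(3)[OF vec_dual[OF a]])
        (use dominated_pointwise[OF omega_pos dominated_vec[OF omega_pos a]] s1 ip_self(2)[OF omega_pos a] in auto)
    then show "cmod (dual_star A \<xi> a) \<le> D * sn \<omega> a"
      using a by (simp add: \<xi>_def vec_def D_def mult_ac)
  qed
  note dom\<xi> = this
  have r_vec: "r (vec \<omega> a) = 0" if a: "a \<in> carrier A" for a
  proof -
    have sa: "0 \<le> sn \<omega> a" using ip_self(2)[OF omega_pos a] .
    have "cmod (r (vec \<omega> a)) \<le> 0"
    proof (rule le_if_le_add_mult)
      fix \<delta>' :: real assume \<delta>': "0 < \<delta>'"
      \<comment> \<open>Tolerance \<delta>^2 gives s^2 of order \<delta>^2, hence s of order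
        \<delta>; the cap 1 absorbs the mixed term.\<close>
      define \<delta> where "\<delta> = min 1 \<delta>'"
      have \<delta>: "0 < \<delta>" "\<delta> \<le> 1" "\<delta> \<le> \<delta>'" using \<delta>' by (auto simp: \<delta>_def)
      have "0 < \<delta>\<^sup>2" using \<delta> by simp
      then obtain c where c: "c \<in> carrier A"
        "\<And>C \<xi>. dominated \<omega> C \<xi> \<Longrightarrow> cmod (r \<xi> - \<xi> c) \<le> \<delta>\<^sup>2 * C"
        using bidual_riesz[OF r omega_pos] by blast
      define s where "s = sn \<omega> c"
      have s: "0 \<le> s" using ip_self(2)[OF omega_pos c(1)] by (simp add: s_def)
      \<comment> \<open>Two evaluations of \<open>r (vec \<omega> c)\<close>: nearly 0 because r
        vanishes on the adjoint of \<xi>, and nearly s^2 because r is close to evaluation at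
        c.\<close>
      have "cmod (dual_star A \<xi> c) \<le> \<delta>\<^sup>2 * D" using c(2)[OF dom\<xi>] r\<xi> by simp
      then have 1: "cmod (r (vec \<omega> c)) \<le> \<delta>\<^sup>2 * D" using c(1) by (simp add: \<xi>_def vec_def)
      have 2: "cmod (r (vec \<omega> c) - of_real (s\<^sup>2)) \<le> \<delta>\<^sup>2 * s"
        using c(2)[OF dominated_vec[OF omega_pos c(1)]] c(1) ip_self(1)[OF omega_pos c(1)]
        by (simp add: s_def)
      have "s\<^sup>2 = cmod (of_real (s\<^sup>2))" by (simp add: norm_power)
      also have "\<dots> \<le> cmod (r (vec \<omega> c)) + cmod (r (vec \<omega> c) - of_real (s\<^sup>2))"
        using norm_triangle_ineq4[of "r (vec \<omega> c)" "r (vec \<omega> c) - of_real (s\<^sup>2)"] by simp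
      finally have s2: "s\<^sup>2 \<le> \<delta>\<^sup>2 * D + \<delta>\<^sup>2 * s" using 1 2 by linarith
      have s_le: "s \<le> \<delta> * (D + 1)"
      proof (rule ccontr)
        assume "\<not> s \<le> \<delta> * (D + 1)"
        then have gt: "\<delta> * (D + 1) < s" by simp
        have "\<delta> \<le> \<delta> * (D + 1)" using D \<delta> by simp
        then have \<delta>s: "\<delta> < s" using gt by linarith
        then have "\<delta> * (D + 1) * s < s * s" using gt \<delta> by (intro mult_strict_right_mono) auto
        moreover have "\<delta> * D * \<delta> \<le> \<delta> * D * s" using \<delta>s \<delta> D by (intro mult_left_mono) auto
        moreover have "\<delta> * \<delta> * s \<le> 1 * \<delta> * s" using \<delta> s by (intro mult_right_mono) auto
        ultimately show False using s2 by (simp add: power2_eq_square algebra_simps)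
      qed
      have "cmod (r (vec \<omega> a) - ip \<omega> a c) \<le> \<delta>\<^sup>2 * sn \<omega> a"
        using c(2)[OF dominated_vec[OF omega_pos a]] c(1) by simp
      moreover have "cmod (ip \<omega> a c) \<le> sn \<omega> a * s" using ip_le[OF omega_pos a c(1)] by (simp add: s_def)
      moreover have "cmod (r (vec \<omega> a)) \<le> cmod (r (vec \<omega> a) - ip \<omega> a c) + cmod (ip \<omega> a c)"
        using norm_triangle_ineq[of "r (vec \<omega> a) - ip \<omega> a c" "ip \<omega> a c"] by simp
      ultimately have "cmod (r (vec \<omega> a)) \<le> (\<delta>\<^sup>2 + s) * sn \<omega> a" by (simp add: algebra_simps)
      also have "\<dots> \<le> (\<delta>' * (D + 2)) * sn \<omega> a"
      proof (rule mult_right_mono[OF _ sa])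
        have "\<delta>\<^sup>2 \<le> \<delta>" using \<delta> by (simp add: power2_eq_square mult_left_le)
        then have "\<delta>\<^sup>2 + s \<le> \<delta> * (D + 2)" using s_le by (simp add: algebra_simps)
        also have "\<dots> \<le> \<delta>' * (D + 2)" using \<delta> D by (intro mult_right_mono) auto
        finally show "\<delta>\<^sup>2 + s \<le> \<delta>' * (D + 2)" .
      qed
      finally show "cmod (r (vec \<omega> a)) \<le> 0 + \<delta>' * ((D + 2) * sn \<omega> a)" by (simp add: mult.assoc)
    qed
    then show ?thesis by simp
  qed
  have "cmod (r \<nu>) \<le> 0"
  proof (rule le_if_le_add_mult)
    fix \<delta> :: real assume \<delta>: "0 < \<delta>"
    obtain b where b: "b \<in> carrier A"
      "\<And>x. x \<in> carrier A \<Longrightarrow> cmod (\<nu> x - \<omega> (b \<otimes> x)) \<le> \<delta> * cnorm A x"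
      using folium_approx[OF \<nu> \<delta>] by blast
    have "cmod (r \<nu> - r (vec \<omega> (star A b))) \<le> K * \<delta>"
      using b \<delta> folium_dual[OF \<nu>] vec_dual by (intro K(2)) (auto simp: ip_def)
    then show "cmod (r \<nu>) \<le> 0 + \<delta> * K" using r_vec[of "star A b"] b(1) by (simp add: mult.commute)
  qed
  then show ?thesis using r_apply[OF folium_dual[OF \<nu>]] by simp
qed

text \<open>A projection e with value 1 at \<omega> agrees with the unit on the folium, where the
  action of p takes its values; so e p = p, and centrality gives p e = p. Thus p is least, and by
  commutativity with p a second least projection equals p.\<close>

lemma support_central: "support A \<omega> \<in> centre (bidual A)"
proof -
  obtain p where p: "projection (bidual A) p" "p \<in> centre (bidual A)"
    and range: "\<And>\<phi>. \<phi> \<in> dual A \<Longrightarrow> bidual_act A p \<phi> \<in> folium"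
    and one: "\<And>\<nu>. \<nu> \<in> folium \<Longrightarrow> p \<nu> = \<nu> \<one>"
    using folium.central_projection by blast
  have p\<omega>: "p \<omega> = 1" using one[OF omega_folium] omega_one by simp
  have pbd: "p \<in> bd" using p(1) by (simp add: projection_def)
  have comm: "p \<otimes>\<^bsub>bidual A\<^esub> x = x \<otimes>\<^bsub>bidual A\<^esub> p" if "x \<in> bd" for x
    using p(2) that by (simp add: centre_def)
  have minimal: "p \<otimes>\<^bsub>bidual A\<^esub> e = p" if e: "projection (bidual A) e" "e \<omega> = 1" for e
  proof -
    have ebd: "e \<in> bd" using e(1) by (simp add: projection_def)
    have "e \<otimes>\<^bsub>bidual A\<^esub> p = p"
    proof (rule bidual_eqI[OF bidual_mult_closed[OF ebd pbd] pbd])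
      fix \<phi> assume \<phi>: "\<phi> \<in> dual A"
      have "dual_act A \<phi> \<one> = \<phi>" by (rule dual_eqI) (use \<phi> in auto)
      then show "(e \<otimes>\<^bsub>bidual A\<^esub> p) \<phi> = p \<phi>"
        using projection_one_on_folium[OF e range[OF \<phi>]] \<phi> by (simp add: bidual_eqs(2))
    qed
    then show ?thesis using comm[OF ebd] by simp
  qed
  have "support A \<omega> = p"
    unfolding support_def
  proof (rule the_equality)
    show "projection (bidual A) p \<and> p \<omega> = 1
        \<and> (\<forall>e. projection (bidual A) e \<and> e \<omega> = 1 \<longrightarrow> p \<otimes>\<^bsub>bidual A\<^esub> e = p)"
      using p(1) p\<omega> minimal by blast
    fix p' assume p': "projection (bidual A) p' \<and> p' \<omega> = 1
        \<and> (\<forall>e. projection (bidual A) e \<and> e \<omega> = 1 \<longrightarrow> p' \<otimes>\<^bsub>bidual A\<^esub> e = p')"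
    then have "p' \<in> bd" by (simp add: projection_def)
    have "p' = p' \<otimes>\<^bsub>bidual A\<^esub> p" using p' p(1) p\<omega> by metis
    also have "\<dots> = p \<otimes>\<^bsub>bidual A\<^esub> p'" using comm[OF \<open>p' \<in> bd\<close>] by simp
    also have "\<dots> = p" using minimal p' by blast
    finally show "p' = p" .
  qed
  then show ?thesis using p(2) by simp
qed

end

section \<open>From the given data to q and the monomials\<close>

lemma exp_powi_ne_one:
  assumes "\<alpha> \<notin> \<rat>" "k \<noteq> 0"
  shows "exp (2 * of_real pi * \<i> * of_real (2 * \<alpha>)) powi k \<noteq> 1"
proof
  assume "exp (2 * of_real pi * \<i> * of_real (2 * \<alpha>)) powi k = 1"
  then have "exp (of_int k * (2 * of_real pi * \<i> * of_real (2 * \<alpha>))) = 1"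
    by (simp add: exp_power_int)
  then obtain n :: int where "Im (of_int k * (2 * of_real pi * \<i> * of_real (2 * \<alpha>))) = of_int (2 * n) * pi"
    unfolding exp_eq_1 by blast
  \<comment> \<open>Comparing imaginary parts gives 4 pi k \<alpha> = 2 pi n, which would make
    \<alpha> rational.\<close>
  then have "pi * (4 * of_int k * \<alpha>) = pi * (2 * of_int n)" by (simp add: algebra_simps)
  then have "\<alpha> = of_int n / of_int (2 * k)" using assms(2) by (simp add: field_simps)
  then show False using assms(1) by (metis Rats_divide Rats_of_int)
qed

lemma (in cstar_algebra) W_eq:
  assumes "unitary A U" "unitary A V"
  shows "W \<alpha> A U V (k, n) = scale A (exp (- 2 * of_real pi * \<i> * of_real \<alpha> * of_int k * of_int n))
    (zpow U k \<otimes> zpow V n)"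
  using assms by (simp add: W_def int_pow_eq_zpow)

text \<open>The defining formula is tested on the indicator of (k, l). The phase of the Weyl element
  drops out: it is 1 for l = 0, and for other l the value is 0.\<close>

lemma (in cstar_algebra) state_of_measure_monomial:
  assumes U: "unitary A U" and V: "unitary A V" and st: "is_state_of_measure \<alpha> A U V \<mu> \<omega>"
  shows "\<omega> (zpow U k \<otimes> zpow V l) = (if l = 0 then fourier_coeff \<mu> k else 0)"
proof -
  have d: "\<omega> \<in> dual A" using st by (simp add: is_state_of_measure_def state_def)
  have c: "zpow U k \<otimes> zpow V l \<in> carrier A" using unitaryD(1) U V by simp
  define f :: "int \<times> int \<Rightarrow> complex" where "f x = (if x = (k, l) then 1 else 0)" for x
  have supp: "{x. f x \<noteq> 0} = {(k, l)}" by (auto simp: f_def)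
  define t where "t = exp (- 2 * of_real pi * \<i> * of_real \<alpha> * of_int k * of_int l)"
  have Wc: "W \<alpha> A U V (k, l) = scale A t (zpow U k \<otimes> zpow V l)"
    using W_eq[OF U V] by (simp add: t_def)
  have "Wsum \<alpha> A U V f = scale A (f (k, l)) (W \<alpha> A U V (k, l))"
    unfolding Wsum_def supp using c by (simp add: finsum_insert Wc)
  then have "Wsum \<alpha> A U V f = scale A t (zpow U k \<otimes> zpow V l)" using c by (simp add: f_def Wc)
  moreover have "\<omega> (Wsum \<alpha> A U V f) = (\<Sum>k'\<in>{k'. f (k', 0) \<noteq> 0}. fourier_coeff \<mu> k' * f (k', 0))"
    using st supp unfolding is_state_of_measure_def by auto
  ultimately have "t * \<omega> (zpow U k \<otimes> zpow V l)
      = (\<Sum>k'\<in>{k'. f (k', 0) \<noteq> 0}. fourier_coeff \<mu> k' * f (k', 0))"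
    using c by (simp add: dual_scale[OF d])
  also have "\<dots> = (if l = 0 then fourier_coeff \<mu> k else 0)"
  proof (cases "l = 0")
    case True
    then have "{k'. f (k', 0) \<noteq> 0} = {k}" by (auto simp: f_def)
    then show ?thesis using True by (simp add: f_def)
  next
    case False
    then have "{k'. f (k', 0) \<noteq> 0} = {}" by (auto simp: f_def)
    then show ?thesis using False by simp
  qed
  finally show ?thesis by (auto simp: t_def split: if_splits)
qed

theorem proposition4p2:
  fixes \<alpha> :: real
    and A :: "'a cstar" and U V :: 'a
    and \<mu> :: "complex measure"
    and \<omega> :: "'a \<Rightarrow> complex"
  assumes "0 < \<alpha>" and "\<alpha> < 1 / 2" and "\<alpha> \<notin> \<rat>"
    and "universal_rotation_algebra A (2 * \<alpha>) U V"
    and "prob_space \<mu>" and "sets \<mu> = sets circle_borel"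
    and "\<And>n :: int. absolutely_continuous \<mu> (rotated_measure \<alpha> \<mu> (2 * n))"
    and "is_state_of_measure \<alpha> A U V \<mu> \<omega>"
  shows "support A \<omega> \<in> centre (bidual A)"
proof -
  interpret universal_rotation_algebra A "2 * \<alpha>" U V by fact
  define q where "q = exp (2 * of_real pi * \<i> * of_real (2 * \<alpha>))"
  have gens: "unitary A U" "unitary A V" "U \<otimes>\<^bsub>A\<^esub> V = scale A q (V \<otimes>\<^bsub>A\<^esub> U)"
    using generators by (auto simp: rotation_pair_def q_def)
  \<comment> \<open>q belongs to the angle 4 pi \<alpha>, so it is the second power of the rotation
    that multiplies by q.\<close>
  have rot: "rot \<alpha> 2 = (*) q" "rot \<alpha> (- 2) = (*) (inverse q)"
    by (auto simp: fun_eq_iff rot_def q_def exp_minus[symmetric] mult_ac)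
  interpret rotation_algebra A U V q
  proof unfold_locales
    show "cmod q = 1" by (simp add: q_def norm_exp_eq_Re)
  qed (use gens generated in auto)
  interpret quasi_invariant_state A U V q \<mu> \<omega>
  proof (intro quasi_invariant_state.intro circle_measure.intro rotation_algebra_axioms
      circle_measure_axioms.intro quasi_invariant_state_axioms.intro assms(5,6))
    show "posf \<omega>"
      using assms(8) by (simp add: is_state_of_measure_def state_def posf_def)
    show "\<omega> (w k l) = (if l = 0 then fourier_coeff \<mu> k else 0)" for k l
      using state_of_measure_monomial[OF gens(1,2) assms(8)] by (simp add: w_def)
    show "q powi k \<noteq> 1" if "k \<noteq> 0" for k
      unfolding q_def using exp_powi_ne_one[OF assms(3) that] .
    \<comment> \<open>\<open>rotated_measure\<close> pushes forward along the inverse rotation, so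
      multiplication by q belongs to n = -1.\<close>
    show "absolutely_continuous \<mu> (distr \<mu> circle_borel ((*) q))"
      using assms(7)[of "- 1"] rot(1) by (simp add: rotated_measure_def)
    show "absolutely_continuous \<mu> (distr \<mu> circle_borel ((*) (inverse q)))"
      using assms(7)[of 1] rot(2) by (simp add: rotated_measure_def)
  qed
  show ?thesis by (rule support_central)
qed

end
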